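(* Let $\Omega\subset\mathbb{R}^3$ be a bounded connected open set, and let $v$ be a velocity field on $[0,\infty)\times\bar\Omega$ satisfying (H1)–(H3) of the context, with flow $X$. Let $\Sigma(0)\subset\Omega$ be a closed (i.e. compact, without boundary) $C^2$-smooth surface, and let $\phi^0:\Omega\to\mathbb{R}$ be a $C^2$-function with $\{x\in\Omega \mid \phi^0(x)=0\}=\Sigma(0)$ and $\nabla\phi^0\neq 0$ on $\Sigma(0)$. Put $\Sigma(t):=X(t,0,\Sigma(0))$ for $t\ge 0$. Let $\alpha>0$ be a constant such that $$-\alpha|p|^2\le\langle(\nabla v(t,x))p,p\rangle\le\alpha|p|^2\qquad\text{for all }p\in\mathbb{R}^3\text{ and all }(t,x)\in[0,\infty)\times\Omega,$$ and let $\beta>\alpha$ be a constant. Suppose that $\beta-\alpha\le|\nabla\phi^0|\le\beta+\alpha$ on $\Sigma(0)$. Then there exists a tubular neighborhood $\Theta\subset[0,\infty)\times\Omega$ of $\{\Sigma(t)\}_{t\ge0}$ for which the problem $$\frac{\partial\phi}{\partial t}+v\cdot\nabla\phi=\phi\,(\beta-|\nabla\phi|)\ \text{ in }\Theta,\qquad \phi(0,\cdot)=\phi^0\ \text{ on }\Theta|_{t=0}$$ admits a unique $C^2$-solution $\phi:\Theta\to\mathbb{R}$, and this $\phi$ satisfies: 1. $\{x \mid (t,x)\in\Theta,\ \phi(t,x)=0\}=\Sigma(t)$ for all $t\in[0,\infty)$; 2. $\beta-\alpha\le|\nabla\phi(t,x)|\le\beta+\alpha$ for all $t\in[0,\infty)$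 and all $x\in\Sigma(t)$.
   Context: Notation. $\nabla$ is the gradient in $x\in\mathbb{R}^3$; $(\nabla v)_{ij}=\partial v_i/\partial x_j$; $\langle\cdot,\cdot\rangle$ is the Euclidean inner product and $|\cdot|$ the Euclidean norm; $\Theta|_{t=0}=\{x \mid (0,x)\in\Theta\}$. Contingent cone. For a closed set $K\subset\mathbb{R}^d$ and $x\in K$, $T_K(x):=\{z\in\mathbb{R}^d \mid \liminf_{h\to0+}h^{-1}\,\mathrm{dist}(x+hz,K)=0\}$. Hypotheses on $v$. (H1) $v\in C^0([0,\infty)\times\bar\Omega;\mathbb{R}^3)\cap C^1([0,\infty)\times\Omega;\mathbb{R}^3)$ is locally Lipschitz in $x\in\bar\Omega$ (for every $(t_0,x_0)$ there are $\delta,L>0$ with $|v(t,x)-v(t,\bar x)|\le L|x-\bar x|$ for all $t\ge 0$ with $|t-t_0|<\delta$ and $x,\bar x\in\bar\Omega$ within distance $\delta$ of $x_0$); $v$ is three times partially differentiable in $x$; all of the partial derivatives of $v$ belong to $C^0([0,\infty)\times\Omega;\mathbb{R}^3)$. (H2) $\pm v(s,x)\in T_{\partial\Omega}(x)$ for all $s\in[0,\infty)$, $x\in\partial\Omega$. (H3) $|\partial v_i/\partial x_j|$ ($i,j=1,2,3$) are bounded on $[0,\infty)\times\Omega$. Flow. Under these hypotheses, for each $(\tau,\xi)\in[0,\infty)\times\bar\Omega$ the ODE $x'(s)=v(s,x(s))$, $x(\tau)=\xi$ has a unique solution on $[0,\infty)$ staying in $\bar\Omega$; its value at time $s$ is denoted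 $X(s,\tau,\xi)$. The sets $\bar\Omega$, $\partial\Omega$ and $\Omega$ are invariant under this flow; in particular $\Sigma(t)\subset\Omega$ for all $t\ge0$. Tubular neighborhood. For $\varepsilon>0$ let $\Sigma_\varepsilon(t):=\bigcup_{x\in\Sigma(t)}\{y\in\mathbb{R}^3 \mid |x-y|<\varepsilon\}$; only $\varepsilon$ with $\Sigma_\varepsilon(t)\subset\Omega$ are considered. A set $\Theta\subset[0,\infty)\times\Omega$ is a ($t$-global) tubular neighborhood of $\{\Sigma(t)\}_{t\ge0}$ if it contains $\bigcup_{t\ge0}(\{t\}\times\Sigma(t))$ and there is a nonincreasing function $\varepsilon:[0,\infty)\to\mathbb{R}_{>0}$ such that $\{t\}\times\Sigma_{\varepsilon(t)}(t)\subset\Theta$ for all $t\ge0$. *)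

theory Defs
  imports "HOL-Analysis.Analysis"
begin

text \<open>
  Class \<open>C\<^sup>k\<close>, jointly in all variables.  Derivatives are taken within \<open>S\<close>, so that \<open>S\<close> may
  contain part of its boundary: on \<open>[0,\<infinity>) \<times> \<Omega>\<close> the time derivative at \<open>t = 0\<close> is one-sided.
  The notion is only meant for sets \<open>S\<close> that are open, or relatively open in \<open>[0,\<infinity>) \<times> \<real>\<^sup>3\<close>; there
  the derivative within \<open>S\<close> is unique.
\<close>

primrec Ck_on ::
  "nat \<Rightarrow> 'a::euclidean_space set \<Rightarrow> ('a \<Rightarrow> 'b::real_normed_vector) \<Rightarrow> bool" where
  "Ck_on 0 S f \<longleftrightarrow> continuous_on S f"
| "Ck_on (Suc k) S f \<longleftrightarrow>
     (\<exists>f'. (\<forall>z\<in>S. (f has_derivative f' z) (at z within S)) \<and> (\<forall>h. Ck_on k S (\<lambda>z. f' z h)))"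

text \<open>
  All iterated partial derivatives in \<open>x\<close> up to order \<open>k\<close> exist on \<open>[0,\<infinity>) \<times> \<Omega>\<close> and are
  continuous in \<open>(t, x)\<close>; nothing is required of time derivatives.
\<close>

primrec space_Ck ::
  "nat \<Rightarrow> (real^3) set \<Rightarrow> (real \<Rightarrow> real^3 \<Rightarrow> 'b::real_normed_vector) \<Rightarrow> bool" where
  "space_Ck 0 \<Omega> w \<longleftrightarrow> continuous_on ({0..} \<times> \<Omega>) (\<lambda>(t, x). w t x)"
| "space_Ck (Suc k) \<Omega> w \<longleftrightarrow>
     continuous_on ({0..} \<times> \<Omega>) (\<lambda>(t, x). w t x) \<and>
     (\<forall>i. \<exists>w'. (\<forall>t\<ge>0. \<forall>x\<in>\<Omega>.
               ((\<lambda>r. w t (x + r *\<^sub>R axis i 1)) has_vector_derivative w' t x) (at 0)) \<and>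
             space_Ck k \<Omega> w')"

definition grad :: "('a::real_inner \<Rightarrow> real) \<Rightarrow> 'a \<Rightarrow> 'a" where
  "grad f x = (THE D. GDERIV f x :> D)"

definition contingent_cone :: "'a::euclidean_space set \<Rightarrow> 'a \<Rightarrow> 'a set" where
  "contingent_cone K x =
     {z. Liminf (at_right 0) (\<lambda>h::real. ereal (infdist (x + h *\<^sub>R z) K / h)) = 0}"

definition locally_Lipschitz_in_space ::
  "(real^3) set \<Rightarrow> (real \<Rightarrow> real^3 \<Rightarrow> real^3) \<Rightarrow> bool" where
  "locally_Lipschitz_in_space D v \<longleftrightarrow>
     (\<forall>t0\<ge>0. \<forall>x0\<in>D. \<exists>\<delta>>0. \<exists>L>0. \<forall>t\<ge>0. \<bar>t - t0\<bar> < \<delta> \<longrightarrow>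
        (\<forall>x\<in>D \<inter> cball x0 \<delta>. \<forall>y\<in>D \<inter> cball x0 \<delta>. norm (v t x - v t y) \<le> L * norm (x - y)))"

definition velocity_regular :: "(real^3) set \<Rightarrow> (real \<Rightarrow> real^3 \<Rightarrow> real^3) \<Rightarrow> bool" where
  "velocity_regular \<Omega> v \<longleftrightarrow>
     continuous_on ({0..} \<times> closure \<Omega>) (\<lambda>(t, x). v t x) \<and>
     Ck_on 1 ({0..} \<times> \<Omega>) (\<lambda>(t, x). v t x) \<and>
     locally_Lipschitz_in_space (closure \<Omega>) v \<and>
     space_Ck 3 \<Omega> v"

definition velocity_tangential :: "(real^3) set \<Rightarrow> (real \<Rightarrow> real^3 \<Rightarrow> real^3) \<Rightarrow> bool" where
  "velocity_tangential \<Omega> v \<longleftrightarrow>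
     (\<forall>s\<ge>0. \<forall>x\<in>frontier \<Omega>.
        v s x \<in> contingent_cone (frontier \<Omega>) x \<and> - v s x \<in> contingent_cone (frontier \<Omega>) x)"

definition velocity_gradient_bounded ::
  "(real^3) set \<Rightarrow> (real \<Rightarrow> real^3 \<Rightarrow> real^3) \<Rightarrow> bool" where
  "velocity_gradient_bounded \<Omega> v \<longleftrightarrow>
     (\<forall>i j. \<exists>M. \<forall>t\<ge>0. \<forall>x\<in>\<Omega>. \<bar>jacobian (v t) (at x) $ i $ j\<bar> \<le> M)"

definition flow_solution ::
  "(real^3) set \<Rightarrow> (real \<Rightarrow> real^3 \<Rightarrow> real^3) \<Rightarrow> real \<Rightarrow> real^3 \<Rightarrow> (real \<Rightarrow> real^3) \<Rightarrow> bool" where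
  "flow_solution \<Omega> v \<tau> \<xi> x \<longleftrightarrow>
     x \<tau> = \<xi> \<and>
     (\<forall>s\<ge>0. x s \<in> closure \<Omega> \<and> (x has_vector_derivative v s (x s)) (at s within {0..}))"

text \<open>
  \<open>flow \<Omega> v s \<tau> \<xi>\<close> is \<open>X(s, \<tau>, \<xi>)\<close>.  The description operator selects the value at time \<open>s\<close>
  rather than the solution itself, because a solution is only determined on \<open>[0,\<infinity>)\<close>.
\<close>

definition flow ::
  "(real^3) set \<Rightarrow> (real \<Rightarrow> real^3 \<Rightarrow> real^3) \<Rightarrow> real \<Rightarrow> real \<Rightarrow> real^3 \<Rightarrow> real^3" where
  "flow \<Omega> v s \<tau> \<xi> = (THE y. \<exists>x. flow_solution \<Omega> v \<tau> \<xi> x \<and> y = x s)"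

text \<open>
  Compact two-dimensional \<open>C\<^sup>2\<close> submanifold without boundary of \<open>\<real>\<^sup>3\<close>: near each of its points the
  set is straightened to a coordinate plane by a \<open>C\<^sup>2\<close>-diffeomorphism of open sets of \<open>\<real>\<^sup>3\<close>.
\<close>

definition closed_C2_surface :: "(real^3) set \<Rightarrow> bool" where
  "closed_C2_surface S \<longleftrightarrow>
     compact S \<and>
     (\<forall>x\<in>S. \<exists>U V (g :: real^3 \<Rightarrow> real^3) (h :: real^3 \<Rightarrow> real^3). open U \<and> open V \<and> x \<in> U \<and>
        homeomorphism U V g h \<and>
        Ck_on 2 U g \<and> Ck_on 2 V h \<and> g ` (S \<inter> U) = {z \<in> V. z $ 3 = 0})"

definition tube :: "(real^3) set \<Rightarrow> real \<Rightarrow> (real^3) set" where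
  "tube S \<epsilon> = (\<Union>x\<in>S. {y. norm (x - y) < \<epsilon>})"

text \<open>The tubes lie in \<open>\<Omega>\<close> because \<open>\<Theta>\<close> contains them and is a subset of \<open>[0,\<infinity>) \<times> \<Omega>\<close>.\<close>

definition tubular_neighborhood ::
  "(real^3) set \<Rightarrow> (real \<Rightarrow> (real^3) set) \<Rightarrow> (real \<times> (real^3)) set \<Rightarrow> bool" where
  "tubular_neighborhood \<Omega> \<Sigma> \<Theta> \<longleftrightarrow>
     \<Theta> \<subseteq> {0..} \<times> \<Omega> \<and>
     (\<Union>t\<in>{0..}. {t} \<times> \<Sigma> t) \<subseteq> \<Theta> \<and>
     (\<exists>\<epsilon>::real \<Rightarrow> real. (\<forall>t\<ge>0. \<epsilon> t > 0) \<and> antimono_on {0..} \<epsilon> \<and>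
        (\<forall>t\<ge>0. {t} \<times> tube (\<Sigma> t) (\<epsilon> t) \<subseteq> \<Theta>))"

definition C2_solution ::
  "(real \<Rightarrow> real^3 \<Rightarrow> real^3) \<Rightarrow> real \<Rightarrow> (real^3 \<Rightarrow> real) \<Rightarrow> (real \<times> (real^3)) set \<Rightarrow>
     (real \<Rightarrow> real^3 \<Rightarrow> real) \<Rightarrow> bool" where
  "C2_solution v \<beta> \<phi>0 \<Theta> \<phi> \<longleftrightarrow>
     Ck_on 2 \<Theta> (\<lambda>(t, x). \<phi> t x) \<and>
     (\<forall>(t, x)\<in>\<Theta>.
        vector_derivative (\<lambda>s. \<phi> s x) (at t within {0..}) + v t x \<bullet> grad (\<phi> t) x
          = \<phi> t x * (\<beta> - norm (grad (\<phi> t) x))) \<and>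
     (\<forall>x. (0, x) \<in> \<Theta> \<longrightarrow> \<phi> 0 x = \<phi>0 x)"

end

theory Submission
  imports Defs
begin

text \<open>The characteristics of the equation solve
  \<open>x' = v + (u / |p|) p\<close>, \<open>p' = (\<beta> - |p|) p - (\<nabla>v)\<^sup>T p\<close>, \<open>u' = \<beta> u\<close>, started at
  \<open>(\<xi>, \<nabla>\<phi>0 \<xi>, \<phi>0 \<xi>)\<close>.  For \<open>\<xi>\<close> on the initial surface \<open>u\<close> vanishes, so \<open>x\<close> is the trajectory of
  \<open>v\<close>, and \<open>(|p|\<^sup>2)' = 2 ((\<beta> - |p|) |p|\<^sup>2 - \<langle>(\<nabla>v) p, p\<rangle>)\<close> is nonpositive for \<open>|p| > \<beta> + \<alpha>\<close> and nonnegative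
  for \<open>|p| < \<beta> - \<alpha>\<close>; hence \<open>|p|\<close> stays in \<open>[\<beta> - \<alpha>, \<beta> + \<alpha>]\<close>, while tangency of \<open>v\<close> keeps \<open>x\<close> away from the
  boundary.  The characteristics from the surface therefore stay, on each \<open>[0, T]\<close>, in a compact part of
  the domain of the system, and nearby ones exist on \<open>[0, T]\<close> as well.

  Along the characteristic flow \<open>du = p \<cdot> dx\<close>, which holds at time \<open>0\<close>, is preserved.  It yields two things:
  on the surface the linearised equation for \<open>dx\<close> becomes homogeneous in \<open>dx\<close> alone, so that
  \<open>(t, \<xi>) \<mapsto> (t, x)\<close> is a local diffeomorphism near the surface (and injective there by compactness), and
  \<open>p\<close> is the gradient of \<open>\<phi> = e\<^bsup>\<beta>t\<^esup> \<phi>0(\<xi>)\<close> expressed in \<open>(t, x)\<close>.  As \<open>p\<close> is of class \<open>C\<^sup>1\<close>, \<open>\<phi>\<close> is of class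
  \<open>C\<^sup>2\<close>.  Uniqueness: for another solution \<open>\<psi>\<close>, Gronwall's inequality compares
  \<open>(x, \<nabla>\<psi>, \<psi>)\<close> with \<open>(x, p, u)\<close> along the characteristics of \<open>\<phi>\<close>.\<close>

section \<open>Global flows of Lipschitz fields\<close>

text \<open>The characteristic field is singular at \<open>p = 0\<close> and meaningful only for
  \<open>x\<close> in \<Omega> and \<open>t \<ge> 0\<close>, so it is not globally Lipschitz. On
  each \<open>[0, T]\<close> it is multiplied by a C1 cutoff and time is clamped; the result has a
  flow for all real times, so the inverse function theorem applies even at \<open>t = 0\<close>. The
  cutoff is invisible near the characteristics from the surface because every a priori bound
  survives multiplication of the field by a factor in \<open>[0, 1]\<close>. One neighbourhood of
  the surface need not serve for all time. Those used are made decreasing in the integer part of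
  \<open>t\<close>, which keeps \<Theta> relatively open and lets it contain every characteristic
  back to time 0. Uniqueness rests on this: a competitor \<psi> is known only on \<Theta>, and its
  own characteristics might leave \<Theta>, while those of \<phi> do not. As the latter need not be
  characteristics of \<psi>, the comparison carries a correction term, linear in the difference of
  the two velocities and hence absorbed by Gronwall's inequality.\<close>

lemma gronwall:
  fixes z :: "real \<Rightarrow> 'a::real_inner"
  assumes ab: "a \<le> b" and cont: "continuous_on {a..b} z"
    and der: "\<And>t. a < t \<Longrightarrow> t < b \<Longrightarrow> (z has_vector_derivative z' t) (at t)"
    and bnd: "\<And>t. a < t \<Longrightarrow> t < b \<Longrightarrow> norm (z' t) \<le> L * norm (z t) + e"
    and L: "0 \<le> L" and e: "0 \<le> e"
  shows "norm (z b) \<le> (norm (z a) + e * (b - a)) * exp (L * (b - a))"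
proof -
  have main: "norm (z b) \<le> (sqrt ((norm (z a))\<^sup>2 + d\<^sup>2) + e * (b - a)) * exp (L * (b - a))" if d: "d > 0" for d
  proof -
    \<comment> \<open>The norm need not be differentiable where \<open>z\<close> vanishes. Its
      majorant \<open>sqrt (|z|^2 + d^2)\<close> is, and \<open>d\<close> tends to 0 at the
      end.\<close>
    define h where "h t = sqrt (z t \<bullet> z t + d\<^sup>2)" for t
    define g where "g t = h t * exp (- (L * (t - a))) - e * (t - a)" for t
    have pos: "z t \<bullet> z t + d\<^sup>2 > 0" for t
      using d by (simp add: add_nonneg_pos)
    have hpos: "h t > 0" for t
      using pos by (simp add: h_def)
    have hz: "norm (z t) \<le> h t" for t
      unfolding h_def by (rule real_le_rsqrt) (simp add: power2_norm_eq_inner)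
    have "g b \<le> g a"
    proof (rule DERIV_nonpos_imp_decreasing_open[OF ab])
      show "continuous_on {a..b} g"
        unfolding g_def h_def by (intro continuous_intros cont)
      fix t assume t: "a < t" "t < b"
      have D: "(z has_derivative (\<lambda>r. r *\<^sub>R z' t)) (at t)"
        using der[OF t] by (simp add: has_vector_derivative_def)
      have zz: "((\<lambda>t. z t \<bullet> z t + d\<^sup>2) has_real_derivative 2 * (z t \<bullet> z' t)) (at t)"
      proof -
        have "((\<lambda>t. z t \<bullet> z t + d\<^sup>2) has_derivative (\<lambda>r. (z t \<bullet> (r *\<^sub>R z' t) + (r *\<^sub>R z' t) \<bullet> z t) + 0)) (at t)"
          by (intro has_derivative_add has_derivative_inner has_derivative_const D)
        then show ?thesis
          unfolding has_field_derivative_def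
          by (rule has_derivative_eq_rhs) (simp add: inner_commute fun_eq_iff)
      qed
      have hd: "(h has_real_derivative (z t \<bullet> z' t) / h t) (at t)"
        unfolding h_def[abs_def]
        by (rule DERIV_cong[OF DERIV_chain2[OF DERIV_real_sqrt[OF pos] zz]]) (simp add: field_simps)
      have gd: "(g has_real_derivative
          ((z t \<bullet> z' t) / h t - L * h t) * exp (- (L * (t - a))) - e) (at t)"
        unfolding g_def by (rule DERIV_cong, (rule derivative_intros hd)+) (simp add: algebra_simps)
      have "(z t \<bullet> z' t) / h t \<le> norm (z' t)"
      proof -
        have "z t \<bullet> z' t \<le> norm (z t) * norm (z' t)" by (rule norm_cauchy_schwarz)
        also have "\<dots> \<le> h t * norm (z' t)" by (rule mult_right_mono[OF hz]) simp
        finally show ?thesis using hpos[of t] by (simp add: pos_divide_le_eq mult.commute)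
      qed
      also have "\<dots> \<le> L * h t + e"
        using bnd[OF t] mult_left_mono[OF hz[of t] L] by linarith
      finally have le: "(z t \<bullet> z' t) / h t - L * h t \<le> e" by simp
      have "exp (- (L * (t - a))) \<le> 1" using L t by simp
      then have "((z t \<bullet> z' t) / h t - L * h t) * exp (- (L * (t - a))) \<le> e"
        by (metis (no_types, opaque_lifting) e exp_ge_zero le linorder_linear mult.commute mult_left_le_one_le mult_mono' mult_nonneg_nonpos order_trans)
      then show "\<exists>y. (g has_real_derivative y) (at t) \<and> y \<le> 0"
        using gd by (intro exI conjI) (assumption, simp)
    qed
    then have "h b * exp (- (L * (b - a))) \<le> h a + e * (b - a)"
      by (simp add: g_def)
    then have "h b * exp (- (L * (b - a))) * exp (L * (b - a)) \<le> (h a + e * (b - a)) * exp (L * (b - a))"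
      by (rule mult_right_mono) simp
    then have "h b \<le> (h a + e * (b - a)) * exp (L * (b - a))"
      by (simp add: mult.assoc flip: exp_add)
    then show ?thesis using hz[of b] by (simp add: h_def power2_norm_eq_inner)
  qed
  have "((\<lambda>d. (sqrt ((norm (z a))\<^sup>2 + d\<^sup>2) + e * (b - a)) * exp (L * (b - a)))
      \<longlongrightarrow> (sqrt ((norm (z a))\<^sup>2 + 0\<^sup>2) + e * (b - a)) * exp (L * (b - a))) (at_right 0)"
    by (intro tendsto_intros)
  moreover have "\<forall>\<^sub>F d in at_right (0::real). norm (z b) \<le> (sqrt ((norm (z a))\<^sup>2 + d\<^sup>2) + e * (b - a)) * exp (L * (b - a))"
    using main by (auto simp: eventually_at_right_less eventually_at_filter)
  ultimately show ?thesis
    using tendsto_lowerbound[OF _ _ trivial_limit_at_right_real] by fastforce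
qed

text \<open>The forward estimate for the reversed curve \<open>z (a + b - t)\<close>.\<close>

lemma gronwall_backward:
  fixes z :: "real \<Rightarrow> 'a::real_inner"
  assumes ab: "a \<le> b" and cont: "continuous_on {a..b} z"
    and der: "\<And>t. a < t \<Longrightarrow> t < b \<Longrightarrow> (z has_vector_derivative z' t) (at t)"
    and bnd: "\<And>t. a < t \<Longrightarrow> t < b \<Longrightarrow> norm (z' t) \<le> L * norm (z t) + e"
    and L: "0 \<le> L" and e: "0 \<le> e"
  shows "norm (z a) \<le> (norm (z b) + e * (b - a)) * exp (L * (b - a))"
proof -
  let ?w = "\<lambda>t. z (a + b - t)"
  have "norm (?w b) \<le> (norm (?w a) + e * (b - a)) * exp (L * (b - a))"
  proof (rule gronwall[OF ab _ _ _ L e, where z' = "\<lambda>t. - z' (a + b - t)"])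
    show "continuous_on {a..b} ?w"
      by (rule continuous_on_compose2[OF cont]) (auto intro!: continuous_intros)
    fix t assume t: "a < t" "t < b"
    have "((z \<circ> (\<lambda>t. a + b - t)) has_vector_derivative (-1) *\<^sub>R z' (a + b - t)) (at t)"
      by (rule vector_diff_chain_at) (auto intro!: derivative_eq_intros der simp: t)
    then show "(?w has_vector_derivative - z' (a + b - t)) (at t)" by (simp add: o_def)
    show "norm (- z' (a + b - t)) \<le> L * norm (?w t) + e" using bnd[of "a + b - t"] t by simp
  qed
  then show ?thesis by simp
qed

lemma gronwall_abs:
  fixes z :: "real \<Rightarrow> 'a::real_inner"
  assumes der: "\<And>s. \<bar>s\<bar> \<le> \<bar>t\<bar> \<Longrightarrow> (z has_vector_derivative z' s) (at s)"
    and bnd: "\<And>s. \<bar>s\<bar> \<le> \<bar>t\<bar> \<Longrightarrow> norm (z' s) \<le> L * norm (z s) + e"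
    and L: "0 \<le> L" and e: "0 \<le> e"
  shows "norm (z t) \<le> (norm (z 0) + e * \<bar>t\<bar>) * exp (L * \<bar>t\<bar>)"
proof (cases "t \<ge> 0")
  case True
  have "continuous_on {0..t} z"
    by (rule continuous_on_vector_derivative[where f'=z'], rule has_vector_derivative_at_within, rule der) auto
  with gronwall[OF True this der bnd L e] True show ?thesis by auto
next
  case False
  have "continuous_on {t..0} z"
    by (rule continuous_on_vector_derivative[where f'=z'], rule has_vector_derivative_at_within, rule der) (use False in auto)
  with gronwall_backward[OF _ this der bnd L e] False show ?thesis by auto
qed

text \<open>The zero may sit anywhere in the interval, so the estimate is run in both directions
  from it.\<close>

lemma gronwall_zero:
  fixes z :: "real \<Rightarrow> 'a::real_inner"
  assumes cont: "continuous_on {a..b} z"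
    and der: "\<And>t. a < t \<Longrightarrow> t < b \<Longrightarrow> (z has_vector_derivative z' t) (at t)"
    and bnd: "\<And>t. a < t \<Longrightarrow> t < b \<Longrightarrow> norm (z' t) \<le> L * norm (z t)"
    and L: "0 \<le> L" and c: "c \<in> {a..b}" "z c = 0" and t: "t \<in> {a..b}"
  shows "z t = 0"
proof (cases "c \<le> t")
  case True
  have "norm (z t) \<le> (norm (z c) + 0 * (t - c)) * exp (L * (t - c))"
    by (rule gronwall[OF True continuous_on_subset[OF cont] der _ L]) (use c t bnd in auto)
  then show ?thesis using c by simp
next
  case False
  have "norm (z t) \<le> (norm (z c) + 0 * (c - t)) * exp (L * (c - t))"
    by (rule gronwall_backward[OF _ continuous_on_subset[OF cont] der _ L]) (use False c t bnd in auto)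
  then show ?thesis using c by simp
qed

text \<open>A bound on \<open>f t 0\<close> that is uniform in \<open>t\<close> gives linear growth
  uniformly in time; this keeps Picard's map inside the weighted space on the whole real
  line.\<close>

locale lipschitz_field =
  fixes f :: "real \<Rightarrow> 'a::euclidean_space \<Rightarrow> 'a" and L M :: real
  assumes f_continuous: "continuous_on UNIV (\<lambda>(t, x). f t x)"
    and f_lipschitz: "norm (f t x - f t y) \<le> L * norm (x - y)"
    and f_bound: "norm (f t 0) \<le> M"
    and L_nonneg: "0 \<le> L"
begin

lemma continuous_on_f [continuous_intros]:
  assumes "continuous_on S g" "continuous_on S h"
  shows "continuous_on S (\<lambda>s. f (g s) (h s))"
  using continuous_on_compose2[OF f_continuous continuous_on_Pair[OF assms]] by simp

lemma f_growth: "norm (f t x) \<le> M + L * norm x"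
  using f_lipschitz[of t x 0] f_bound[of t] norm_triangle_sub[of "f t x" "f t 0"] by simp

lemma M_nonneg: "0 \<le> M"
  using f_bound order_trans norm_ge_zero by blast

lemma solution_unique:
  assumes "\<And>t. (x has_vector_derivative f t (x t)) (at t)"
    and "\<And>t. (y has_vector_derivative f t (y t)) (at t)"
  shows "norm (x t - y t) \<le> norm (x 0 - y 0) * exp (L * \<bar>t\<bar>)"
  using gronwall_abs[OF has_vector_derivative_diff[OF assms], where e=0 and L=L and t=t]
  by (simp add: f_lipschitz L_nonneg)

text \<open>Picard's map is a contraction for the norm \<open>sup e\<^bsup>-k|t|\<^esup> |x t|\<close> with \<open>k > L\<close>, so no continuation is needed.\<close>

lemma exists_solution: "\<exists>x. x 0 = x0 \<and> (\<forall>t. (x has_vector_derivative f t (x t)) (at t))"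
proof -
  \<comment> \<open>The choice gives \<open>L / k \<le> 1/2\<close>, the contraction constant; the
    summand 1 keeps \<open>k\<close> positive when \<open>L = 0\<close>.\<close>
  define k where "k = 2 * L + 1"
  have k: "k > 0" "L / k \<le> 1/2" "L / k \<ge> 0" using L_nonneg by (auto simp: k_def field_simps)
  \<comment> \<open>A derivative of size \<open>C exp (k|t|)\<close> integrates to at most
    \<open>C / k (exp (k|t|) - 1)\<close>: the gain of \<open>1 / k\<close> beats the Lipschitz
    constant.\<close>
  have expo: "norm (G t - G 0) \<le> C / k * (exp (k * \<bar>t\<bar>) - 1)"
    if G: "\<And>t. (G has_vector_derivative g t) (at t)"
      and g: "\<And>t. norm (g t) \<le> C * exp (k * \<bar>t\<bar>)" for G :: "real \<Rightarrow> 'a" and g C t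
  proof -
    have *: "norm (G t - G 0) \<le> C / k * (exp (k * t) - 1)"
      if G: "\<And>t. (G has_vector_derivative g t) (at t)" and t: "t > 0"
        and g: "\<And>t. t > 0 \<Longrightarrow> norm (g t) \<le> C * exp (k * t)" for G :: "real \<Rightarrow> 'a" and g t
    proof -
      have "norm (G t - G 0) \<le> C / k * exp (k * t) - C / k * exp (k * 0)"
      proof (rule differentiable_bound_general[OF t, where f'=g and \<phi>'="\<lambda>t. C * exp (k * t)"])
        show "continuous_on {0..t} G"
          by (rule continuous_on_vector_derivative[where f'=g], rule has_vector_derivative_at_within, rule G)
        show "continuous_on {0..t} (\<lambda>t. C / k * exp (k * t))" by (intro continuous_intros)
        show "((\<lambda>t. C / k * exp (k * t)) has_vector_derivative C * exp (k * s)) (at s)" for s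
          using k unfolding has_real_derivative_iff_has_vector_derivative[symmetric]
          by (auto intro!: derivative_eq_intros)
      qed (use G g in auto)
      then show ?thesis by (simp add: algebra_simps)
    qed
    consider "t = 0" | "t > 0" | "t < 0" by linarith
    then show ?thesis
    proof cases
      case 2 then show ?thesis using *[OF G 2] g by (metis abs_of_pos)
    next
      case 3
      have "((\<lambda>t. G (- t)) has_vector_derivative - g (- t)) (at t)" for t
      proof -
        have "((G \<circ> uminus) has_vector_derivative (-1) *\<^sub>R g (- t)) (at t)"
          by (rule vector_diff_chain_at) (auto intro!: derivative_eq_intros G)
        then show ?thesis by (simp add: o_def)
      qed
      from *[OF this, of "-t"] 3 show ?thesis using g
        by (metis abs_minus_cancel abs_of_neg abs_of_pos minus_minus minus_zero neg_0_less_iff_less norm_minus_cancel)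
    qed simp
  qed
  \<comment> \<open>The unknown \<open>w\<close> is the rescaled curve
    \<open>exp (- k|s|) x\<close>, so the plain sup metric on bounded continuous functions is the
    weighted one on curves.\<close>
  define rhs where "rhs w s = f s (exp (k * \<bar>s\<bar>) *\<^sub>R apply_bcontfun w s)" for w s
  have rhs_cont: "continuous_on UNIV (rhs w)" for w
    unfolding rhs_def by (intro continuous_intros continuous_on_apply_bcontfun)
  have "\<exists>G. \<forall>s. (G has_vector_derivative rhs w s) (at s)" for w
    using einterval_antiderivative[of "-\<infinity>" \<infinity> "rhs w"] rhs_cont
    by (simp add: continuous_on_eq_continuous_at)
  then obtain G where G: "(G w has_vector_derivative rhs w s) (at s)" for w s
    by metis
  define I where "I w s = x0 + (G w s - G w 0)" for w s
  have I0: "I w 0 = x0" for w by (simp add: I_def)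
  have I: "(I w has_vector_derivative rhs w s) (at s)" for w s
    unfolding I_def by (auto intro!: derivative_eq_intros G)
  have I_cont: "continuous_on UNIV (I w)" for w
    by (rule continuous_on_vector_derivative[where f'="rhs w"], rule has_vector_derivative_at_within, rule I)
  define W where "W w s = exp (- (k * \<bar>s\<bar>)) *\<^sub>R I w s" for w s
  have wbound: "norm (apply_bcontfun w s) \<le> dist w (const_bcontfun 0)" for w :: "real \<Rightarrow>\<^sub>C 'a" and s
    using dist_bounded[of w s "const_bcontfun 0"] by (simp add: const_bcontfun.rep_eq)
  have W_bcontfun: "W w \<in> bcontfun" for w
  proof -
    have rb: "norm (rhs w s) \<le> (M + L * dist w (const_bcontfun 0)) * exp (k * \<bar>s\<bar>)" for s
    proof -
      have e1: "exp (k * \<bar>s\<bar>) \<ge> 1" using k by simp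
      have "norm (rhs w s) \<le> M + L * (exp (k * \<bar>s\<bar>) * norm (apply_bcontfun w s))"
        using f_growth[of s "exp (k * \<bar>s\<bar>) *\<^sub>R apply_bcontfun w s"] by (simp add: rhs_def)
      also have "\<dots> \<le> M * exp (k * \<bar>s\<bar>) + L * (exp (k * \<bar>s\<bar>) * dist w (const_bcontfun 0))"
        using e1 M_nonneg L_nonneg wbound[of w s]
        by (intro add_mono mult_left_mono) (auto simp: mult_le_cancel_left1)
      finally show ?thesis by (simp add: algebra_simps)
    qed
    have nW: "norm (W w s) \<le> norm x0 + (M + L * dist w (const_bcontfun 0)) / k" for s
    proof -
      let ?C = "M + L * dist w (const_bcontfun 0)"
      have C: "?C \<ge> 0" using M_nonneg L_nonneg by simp
      have "norm (I w s) \<le> norm x0 + norm (I w s - I w 0)"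
        using norm_triangle_sub[of "I w s" x0] by (simp add: I0)
      also have "\<dots> \<le> norm x0 * exp (k * \<bar>s\<bar>) + ?C / k * exp (k * \<bar>s\<bar>)"
      proof (rule add_mono)
        show "norm x0 \<le> norm x0 * exp (k * \<bar>s\<bar>)" using k by (simp add: mult_le_cancel_left1)
        have "?C / k * (exp (k * \<bar>s\<bar>) - 1) \<le> ?C / k * exp (k * \<bar>s\<bar>)"
          using C k by (intro mult_left_mono) auto
        then show "norm (I w s - I w 0) \<le> ?C / k * exp (k * \<bar>s\<bar>)"
          using expo[OF I rb, of s] by linarith
      qed
      finally have "norm (I w s) \<le> (norm x0 + ?C / k) * exp (k * \<bar>s\<bar>)" by (simp add: algebra_simps)
      then have "exp (- (k * \<bar>s\<bar>)) * norm (I w s) \<le> exp (- (k * \<bar>s\<bar>)) * ((norm x0 + ?C / k) * exp (k * \<bar>s\<bar>))"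
        by (rule mult_left_mono) simp
      also have "\<dots> = norm x0 + ?C / k" by (simp add: exp_minus)
      finally show ?thesis by (simp add: W_def)
    qed
    show ?thesis
      unfolding bcontfun_def
      by (auto simp: bounded_iff W_def[abs_def] intro!: continuous_intros I_cont)
        (use nW[unfolded W_def] in auto)
  qed
  define T where "T w = Bcontfun (W w)" for w
  have T: "apply_bcontfun (T w) = W w" for w
    unfolding T_def by (rule Bcontfun_inverse[OF W_bcontfun])
  have "dist (T w1) (T w2) \<le> 1/2 * dist w1 w2" for w1 w2
  proof (rule dist_bound)
    fix s
    let ?d = "dist w1 w2"
    have "norm (rhs w1 s - rhs w2 s) \<le> L * ?d * exp (k * \<bar>s\<bar>)" for s
    proof -
      have "norm (rhs w1 s - rhs w2 s) \<le> L * norm (exp (k * \<bar>s\<bar>) *\<^sub>R (apply_bcontfun w1 s - apply_bcontfun w2 s))"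
        unfolding rhs_def by (metis f_lipschitz scaleR_diff_right)
      also have "\<dots> \<le> L * (exp (k * \<bar>s\<bar>) * ?d)"
        using L_nonneg dist_bounded[of w1 s w2] by (intro mult_left_mono) (auto simp: dist_norm)
      finally show ?thesis by (simp add: algebra_simps)
    qed
    from expo[OF has_vector_derivative_diff[OF I I] this, of s]
    have "norm (I w1 s - I w2 s) \<le> L * ?d / k * (exp (k * \<bar>s\<bar>) - 1)" by (simp add: I0)
    also have "\<dots> \<le> (1/2 * ?d) * exp (k * \<bar>s\<bar>)"
    proof (rule mult_mono)
      have "L / k * ?d \<le> 1/2 * ?d" using k by (intro mult_right_mono) auto
      then show "L * ?d / k \<le> 1/2 * ?d" by simp
    qed (use k in auto)
    finally have "exp (- (k * \<bar>s\<bar>)) * norm (I w1 s - I w2 s) \<le> exp (- (k * \<bar>s\<bar>)) * ((1/2 * ?d) * exp (k * \<bar>s\<bar>))"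
      by (rule mult_left_mono) simp
    also have "\<dots> = 1/2 * ?d" by (simp add: exp_minus)
    finally show "dist (apply_bcontfun (T w1) s) (apply_bcontfun (T w2) s) \<le> 1/2 * dist w1 w2"
      by (simp add: T W_def dist_norm flip: scaleR_diff_right)
  qed
  then have "\<exists>!w. T w = w" by (intro banach_fix_type[of "1/2"]) auto
  then obtain w where w: "T w = w" by blast
  have Iw: "exp (k * \<bar>s\<bar>) *\<^sub>R apply_bcontfun w s = I w s" for s
    using T[of w] by (simp add: w W_def exp_minus)
  have "rhs w s = f s (I w s)" for s unfolding rhs_def Iw ..
  then show ?thesis using I I0 by (metis)
qed

text \<open>The choice is made among whole curves, before evaluation at \<open>t\<close>, so that
  for fixed \<open>y\<close> all values come from one solution.\<close>

definition flw :: "real \<Rightarrow> 'a \<Rightarrow> 'a" where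
  "flw t y = (SOME x. x 0 = y \<and> (\<forall>t. (x has_vector_derivative f t (x t)) (at t))) t"

lemma flw_0 [simp]: "flw 0 y = y"
  and flw_derivative: "((\<lambda>t. flw t y) has_vector_derivative f t (flw t y)) (at t)"
proof -
  let ?x = "SOME x. x 0 = y \<and> (\<forall>t. (x has_vector_derivative f t (x t)) (at t))"
  have "(\<lambda>t. flw t y) = ?x" by (simp add: flw_def)
  with someI_ex[OF exists_solution[of y]]
  show "flw 0 y = y" "((\<lambda>t. flw t y) has_vector_derivative f t (flw t y)) (at t)"
    by metis+
qed

lemma flw_unique:
  assumes "\<And>t. (x has_vector_derivative f t (x t)) (at t)"
  shows "x t = flw t (x 0)"
  using solution_unique[OF assms flw_derivative, of t "x 0"] by simp

lemma flw_lipschitz: "norm (flw t x - flw t y) \<le> exp (L * \<bar>t\<bar>) * norm (x - y)"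
  using solution_unique[OF flw_derivative flw_derivative, of t x y] by (simp add: mult.commute)

lemma continuous_on_flw_time: "continuous_on S (\<lambda>t. flw t y)"
  by (rule continuous_on_vector_derivative, rule has_vector_derivative_at_within, rule flw_derivative)

end

section \<open>Differentiability in the initial value\<close>

text \<open>Over \<open>[-T, T]\<close> the curve stays in some ball; on the compact ball enlarged
  by 1 the function is uniformly continuous.\<close>

lemma uniform_modulus_along_curve:
  fixes g :: "real \<times> 'a::euclidean_space \<Rightarrow> 'b::metric_space"
  assumes g: "continuous_on UNIV g" and c: "continuous_on {-T..T} c" and e: "e > 0"
  shows "\<exists>d>0. \<forall>s\<in>{-T..T}. \<forall>z. norm (z - c s) \<le> d \<longrightarrow> dist (g (s, z)) (g (s, c s)) < e"
proof -
  have "bounded (c ` {-T..T})"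
    by (intro compact_imp_bounded compact_continuous_image c compact_Icc)
  then obtain R where R: "\<And>s. s \<in> {-T..T} \<Longrightarrow> norm (c s) \<le> R" unfolding bounded_iff by blast
  have "uniformly_continuous_on ({-T..T} \<times> cball 0 (R + 1)) g"
    by (intro compact_uniformly_continuous continuous_on_subset[OF g] compact_Times compact_Icc compact_cball) simp
  then obtain d where d: "d > 0" and
    D: "\<And>x x'. x \<in> {-T..T} \<times> cball 0 (R + 1) \<Longrightarrow> x' \<in> {-T..T} \<times> cball 0 (R + 1) \<Longrightarrow> dist x' x < d \<Longrightarrow> dist (g x') (g x) < e"
    using e unfolding uniformly_continuous_on_def by metis
  have "dist (g (s, z)) (g (s, c s)) < e" if s: "s \<in> {-T..T}" and z: "norm (z - c s) \<le> min 1 (d/2)" for s z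
  proof (rule D)
    have "norm z \<le> norm (c s) + norm (z - c s)" using norm_triangle_sub by blast
    then show "(s, z) \<in> {-T..T} \<times> cball 0 (R + 1)" using z R[OF s] s by auto
    show "(s, c s) \<in> {-T..T} \<times> cball 0 (R + 1)" using R[OF s] s by auto
    show "dist (s, z) (s, c s) < d" using z d by (simp add: dist_Pair_Pair dist_norm)
  qed
  then show ?thesis using d by (intro exI[of _ "min 1 (d/2)"]) auto
qed

locale C1_field =
  fixes f :: "real \<Rightarrow> 'a::euclidean_space \<Rightarrow> 'a" and Df :: "real \<Rightarrow> 'a \<Rightarrow> 'a \<Rightarrow>\<^sub>L 'a" and L M :: real
  assumes f_cont: "continuous_on UNIV (\<lambda>(t, x). f t x)"
    and f_derivative: "(f t has_derivative blinfun_apply (Df t x)) (at x)"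
    and Df_cont: "continuous_on UNIV (\<lambda>(t, x). Df t x)"
    and Df_bound: "norm (Df t x) \<le> L"
    and f_bnd: "norm (f t 0) \<le> M"
begin

lemma L_ge_0: "0 \<le> L"
  using Df_bound order_trans norm_ge_zero by blast

sublocale lipschitz_field f L M
proof
  show "norm (f t x - f t y) \<le> L * norm (x - y)" for t x y
    by (rule differentiable_bound[OF convex_UNIV, where f'="\<lambda>x. blinfun_apply (Df t x)"])
      (use f_derivative Df_bound in \<open>auto simp: norm_blinfun.rep_eq[symmetric]\<close>)
qed (use f_cont f_bnd L_ge_0 in auto)

lemma continuous_on_Df [continuous_intros]:
  assumes "continuous_on S g" "continuous_on S h"
  shows "continuous_on S (\<lambda>s. Df (g s) (h s))"
  using continuous_on_compose2[OF Df_cont continuous_on_Pair[OF assms]] by simp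

lemma norm_Df_apply: "norm (blinfun_apply (Df t x) a) \<le> L * norm a"
  by (meson Df_bound mult_right_mono norm_blinfun norm_ge_zero order_trans)

text \<open>The linearised equation along a trajectory is again a Lipschitz field, with constant 0
  at the origin because it is linear. Existence and uniqueness for it therefore need no separate
  treatment.\<close>

lemma variational_field: "lipschitz_field (\<lambda>t a. blinfun_apply (Df t (flw t y)) a) L 0"
proof
  show "continuous_on UNIV (\<lambda>(t, a). blinfun_apply (Df t (flw t y)) a)"
    unfolding case_prod_beta
    by (intro continuous_intros continuous_on_compose2[OF continuous_on_flw_time[of UNIV]]) auto
  show "norm (blinfun_apply (Df t (flw t y)) x - blinfun_apply (Df t (flw t y)) z) \<le> L * norm (x - z)" for t x z
    using norm_Df_apply by (simp flip: blinfun.diff_right)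
qed (simp_all add: L_ge_0)

definition dflw :: "real \<Rightarrow> 'a \<Rightarrow> 'a \<Rightarrow> 'a" where
  "dflw t y h = lipschitz_field.flw (\<lambda>t a. blinfun_apply (Df t (flw t y)) a) t h"

lemma dflw_0 [simp]: "dflw 0 y h = h"
  unfolding dflw_def by (rule lipschitz_field.flw_0[OF variational_field])

lemma dflw_derivative:
  "((\<lambda>t. dflw t y h) has_vector_derivative blinfun_apply (Df t (flw t y)) (dflw t y h)) (at t)"
  unfolding dflw_def by (rule lipschitz_field.flw_derivative[OF variational_field])

lemma dflw_unique:
  assumes "\<And>t. (x has_vector_derivative blinfun_apply (Df t (flw t y)) (x t)) (at t)"
  shows "x t = dflw t y (x 0)"
  unfolding dflw_def by (rule lipschitz_field.flw_unique[OF variational_field assms])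

lemma dflw_add: "dflw t y (h + k) = dflw t y h + dflw t y k"
  using dflw_unique[of "\<lambda>t. dflw t y h + dflw t y k" y t]
  by (simp add: blinfun.add_right has_vector_derivative_add dflw_derivative)

lemma dflw_scaleR: "dflw t y (r *\<^sub>R h) = r *\<^sub>R dflw t y h"
proof -
  have "((\<lambda>t. r *\<^sub>R dflw t y h) has_vector_derivative blinfun_apply (Df t (flw t y)) (r *\<^sub>R dflw t y h)) (at t)" for t
    using bounded_linear.has_vector_derivative[OF bounded_linear_scaleR_right dflw_derivative]
    by (simp add: blinfun.scaleR_right)
  from dflw_unique[OF this, of t] show ?thesis by simp
qed

lemma dflw_bound: "norm (dflw t y h) \<le> exp (L * \<bar>t\<bar>) * norm h"
proof -
  have "dflw t y 0 = 0" using dflw_scaleR[of t y 0 0] by simp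
  then show ?thesis
    using lipschitz_field.flw_lipschitz[OF variational_field[of y], of t h 0] by (simp add: dflw_def)
qed

lemma bounded_linear_dflw: "bounded_linear (dflw t y)"
  by (rule bounded_linear_intro[where K="exp (L * \<bar>t\<bar>)"])
    (simp_all add: dflw_add dflw_scaleR dflw_bound mult.commute[of "norm _"])

lemma exp_mono_time: "\<bar>s\<bar> \<le> T \<Longrightarrow> exp (L * \<bar>s\<bar>) \<le> exp (L * T)"
  by (simp add: L_ge_0 mult_left_mono)

lemma Df_modulus:
  assumes "e > 0"
  shows "\<exists>d>0. \<forall>s z. \<bar>s\<bar> \<le> T \<longrightarrow> norm (z - flw s y) \<le> d \<longrightarrow> norm (Df s z - Df s (flw s y)) \<le> e"
proof -
  obtain d where "d > 0"
    and "\<forall>s\<in>{-T..T}. \<forall>z. norm (z - flw s y) \<le> d \<longrightarrow> norm (Df s z - Df s (flw s y)) < e"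
    using uniform_modulus_along_curve[OF Df_cont continuous_on_flw_time assms, of T y]
    unfolding dist_norm prod.case by blast
  then show ?thesis by (intro exI[of _ d]) (auto intro!: less_imp_le simp: abs_le_iff)
qed

lemma flw_lipschitz_upto: "\<bar>s\<bar> \<le> T \<Longrightarrow> norm (flw s x - flw s y) \<le> exp (L * T) * norm (x - y)"
  by (rule order_trans[OF flw_lipschitz mult_right_mono[OF exp_mono_time]]) auto

lemma dflw_bound_upto: "\<bar>s\<bar> \<le> T \<Longrightarrow> norm (dflw s y h) \<le> exp (L * T) * norm h"
  by (rule order_trans[OF dflw_bound mult_right_mono[OF exp_mono_time]]) auto

text \<open>The remainder \<open>r = flw (y + k) - flw y - dflw k\<close> solves the linearised
  equation up to an error \<open>e E |k|\<close>, the Taylor remainder of \<open>f\<close> near the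
  trajectory. Since \<open>r\<close> vanishes at time 0, Gronwall's inequality makes it
  \<open>o(|k|)\<close>.\<close>

lemma flw_has_derivative: "(flw t has_derivative dflw t y) (at y)"
proof (rule has_derivativeI)
  show "bounded_linear (dflw t y)" by (rule bounded_linear_dflw)
  define T where "T = \<bar>t\<bar>"
  \<comment> \<open>Bounds both the Lipschitz constant of the flow and the norm of its linearisation
    up to time \<open>T\<close>.\<close>
  define E where "E = exp (L * T)"
  have T: "T \<ge> 0" by (simp add: T_def)
  have E: "E \<ge> 1" "E > 0" using L_ge_0 T by (simp_all add: E_def)
  have key: "\<exists>d>0. \<forall>k. norm k < d \<longrightarrow> norm (flw t (y + k) - flw t y - dflw t y k) \<le> (e * T * E * E) * norm k"
    if e: "e > 0" for e
  proof -
    obtain d where d: "d > 0" and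
      D: "\<And>s z. \<bar>s\<bar> \<le> T \<Longrightarrow> norm (z - flw s y) \<le> d \<Longrightarrow> norm (Df s z - Df s (flw s y)) \<le> e"
      using Df_modulus[OF e, of T y] by blast
    have "norm (flw t (y + k) - flw t y - dflw t y k) \<le> (e * T * E * E) * norm k" if k: "norm k < d / E" for k
    proof -
      define r where "r s = flw s (y + k) - flw s y - dflw s y k" for s
      define r' where "r' s = f s (flw s (y + k)) - f s (flw s y) - Df s (flw s y) (dflw s y k)" for s
      have r: "(r has_vector_derivative r' s) (at s)" for s
        unfolding r_def r'_def
        by (intro has_vector_derivative_diff flw_derivative dflw_derivative)
      have r'_bound: "norm (r' s) \<le> L * norm (r s) + e * E * norm k" if s: "\<bar>s\<bar> \<le> \<bar>t\<bar>" for s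
      proof -
        let ?c = "flw s y" and ?z = "flw s (y + k)"
        have s': "\<bar>s\<bar> \<le> T" using s by (auto simp: T_def)
        have zc: "norm (?z - ?c) \<le> E * norm k"
          using flw_lipschitz_upto[OF s', of "y + k" y] by (simp add: E_def)
        also have "\<dots> \<le> d" using k E by (simp add: field_simps)
        finally have zd: "norm (?z - ?c) \<le> d" .
        have "norm (f s ?z - f s ?c - Df s ?c (?z - ?c)) \<le> norm (?z - ?c) * e"
        proof (rule differentiable_bound_linearization[where S="cball ?c d" and f'="\<lambda>x. blinfun_apply (Df s x)"])
          show "?c + u *\<^sub>R (?z - ?c) \<in> cball ?c d" if "u \<in> {0..1}" for u
            using zd that mult_left_le_one_le[of "norm (?z - ?c)" u] by (auto simp: dist_norm)
          show "(f s has_derivative blinfun_apply (Df s x)) (at x within cball ?c d)" for x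
            by (rule has_derivative_at_withinI[OF f_derivative])
          show "?c \<in> cball ?c d" using d by simp
          show "onorm (blinfun_apply (Df s x) - blinfun_apply (Df s ?c)) \<le> e" if "x \<in> cball ?c d" for x
          proof -
            have "onorm (blinfun_apply (Df s x) - blinfun_apply (Df s ?c)) = norm (Df s x - Df s ?c)"
              by (simp add: norm_blinfun.rep_eq minus_blinfun.rep_eq fun_diff_def)
            also have "\<dots> \<le> e" using D[OF s', of x] that by (simp add: dist_norm norm_minus_commute)
            finally show ?thesis .
          qed
        qed
        also have "\<dots> \<le> e * (E * norm k)" using zc e by (simp add: mult.commute)
        finally have 1: "norm (f s ?z - f s ?c - Df s ?c (?z - ?c)) \<le> e * E * norm k" by simp
        have "r' s = (f s ?z - f s ?c - Df s ?c (?z - ?c)) + Df s ?c (r s)"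
          by (simp add: r'_def r_def blinfun.diff_right)
        then have "norm (r' s) \<le> norm (f s ?z - f s ?c - Df s ?c (?z - ?c)) + norm (Df s ?c (r s))"
          by (simp add: norm_triangle_ineq)
        then show ?thesis using 1 norm_Df_apply[of s ?c "r s"] by linarith
      qed
      have "norm (r t) \<le> (norm (r 0) + e * E * norm k * \<bar>t\<bar>) * exp (L * \<bar>t\<bar>)"
        by (rule gronwall_abs[OF r r'_bound L_ge_0]) (use e E in auto)
      also have "\<dots> = e * T * E * E * norm k" by (simp add: r_def T_def E_def)
      finally show ?thesis by (simp add: r_def)
    qed
    then show ?thesis using d E by (intro exI[of _ "d / E"]) auto
  qed
  show "(\<lambda>z. (flw t z - flw t y - dflw t y (z - y)) /\<^sub>R norm (z - y)) \<midarrow>y\<rightarrow> 0"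
  proof (rule tendstoI)
    fix e :: real assume e: "e > 0"
    define e' where "e' = e / (2 * (T * E * E + 1))"
    have TE: "T * E * E \<ge> 0" using T E by simp
    have e': "e' > 0" using e TE by (simp add: e'_def add_nonneg_pos)
    have lt: "e' * T * E * E < e"
    proof -
      have "e' * T * E * E = e * (T * E * E / (2 * (T * E * E + 1)))" by (simp add: e'_def)
      also have "T * E * E / (2 * (T * E * E + 1)) < 1" using TE by (simp add: field_simps add_nonneg_pos)
      finally show ?thesis using e by simp
    qed
    obtain d where d: "d > 0" and D: "\<And>k. norm k < d \<Longrightarrow> norm (flw t (y + k) - flw t y - dflw t y k) \<le> (e' * T * E * E) * norm k"
      using key[OF e'] by blast
    have "dist ((flw t z - flw t y - dflw t y (z - y)) /\<^sub>R norm (z - y)) 0 < e"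
      if z: "z \<noteq> y" "dist z y < d" for z
    proof -
      have "norm (flw t z - flw t y - dflw t y (z - y)) \<le> (e' * T * E * E) * norm (z - y)"
        using D[of "z - y"] z by (simp add: dist_norm)
      also have "\<dots> < e * norm (z - y)" using lt z by simp
      finally show ?thesis using z by (simp add: divide_simps mult.commute)
    qed
    then show "\<forall>\<^sub>F z in at y. dist ((flw t z - flw t y - dflw t y (z - y)) /\<^sub>R norm (z - y)) 0 < e"
      using d unfolding eventually_at by blast
  qed
qed

text \<open>Two linearised solutions with the same initial vector differ little because their
  coefficients are uniformly close along neighbouring trajectories. Uniformity in \<open>t\<close>
  is what allows joint continuity to be deduced from continuity in \<open>t\<close> alone.\<close>

lemma dflw_locally_uniform:
  assumes e: "e > 0"
  shows "\<exists>d>0. \<forall>y'. norm (y' - y) < d \<longrightarrow> (\<forall>t. \<bar>t\<bar> \<le> T \<longrightarrow> norm (dflw t y' h - dflw t y h) \<le> e)"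
proof (cases "T \<ge> 0")
  case T: True
  define E where "E = exp (L * T)"
  have E: "E \<ge> 1" "E > 0" using L_ge_0 T by (simp_all add: E_def)
  define e1 where "e1 = e / (E * E * T * norm h + 1)"
  have e1: "e1 > 0" using e E T by (simp add: e1_def add_nonneg_pos)
  obtain d where d: "d > 0" and
    D: "\<And>s z. \<bar>s\<bar> \<le> T \<Longrightarrow> norm (z - flw s y) \<le> d \<Longrightarrow> norm (Df s z - Df s (flw s y)) \<le> e1"
    using Df_modulus[OF e1, of T y] by blast
  have "norm (dflw t y' h - dflw t y h) \<le> e" if y': "norm (y' - y) < d / E" and t: "\<bar>t\<bar> \<le> T" for y' t
  proof -
    define r where "r s = dflw s y' h - dflw s y h" for s
    define r' where "r' s = Df s (flw s y') (dflw s y' h) - Df s (flw s y) (dflw s y h)" for s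
    have r: "(r has_vector_derivative r' s) (at s)" for s
      unfolding r_def r'_def by (intro has_vector_derivative_diff dflw_derivative)
    have r'_bound: "norm (r' s) \<le> L * norm (r s) + e1 * (E * norm h)" if s: "\<bar>s\<bar> \<le> \<bar>t\<bar>" for s
    proof -
      have s': "\<bar>s\<bar> \<le> T" using s t by auto

      have "norm (flw s y' - flw s y) \<le> E * norm (y' - y)"
        using flw_lipschitz_upto[OF s'] by (simp add: E_def)
      also have "\<dots> \<le> d" using y' E by (simp add: field_simps)
      finally have 1: "norm (Df s (flw s y') - Df s (flw s y)) \<le> e1"
        using D[OF s'] by (simp add: dist_norm less_imp_le)
      have "norm (dflw s y' h) \<le> E * norm h"
        using dflw_bound_upto[OF s'] by (simp add: E_def)
      then have 2: "norm ((Df s (flw s y') - Df s (flw s y)) (dflw s y' h)) \<le> e1 * (E * norm h)"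
        using 1 by (meson mult_mono norm_blinfun norm_ge_zero order_trans e1 less_imp_le)
      have "r' s = (Df s (flw s y') - Df s (flw s y)) (dflw s y' h) + Df s (flw s y) (r s)"
        by (simp add: r'_def r_def blinfun.diff_right blinfun.diff_left)
      then have "norm (r' s) \<le> norm ((Df s (flw s y') - Df s (flw s y)) (dflw s y' h)) + norm (Df s (flw s y) (r s))"
        by (simp add: norm_triangle_ineq)
      then show ?thesis using 2 norm_Df_apply[of s "flw s y" "r s"] by linarith
    qed
    have "norm (r t) \<le> (norm (r 0) + e1 * (E * norm h) * \<bar>t\<bar>) * exp (L * \<bar>t\<bar>)"
      by (rule gronwall_abs[OF r r'_bound L_ge_0]) (use e1 E in auto)
    also have "\<dots> \<le> (e1 * (E * norm h) * T) * E"
      using exp_mono_time[OF t] t e1 E unfolding E_def by (intro mult_mono add_nonneg_nonneg mult_nonneg_nonneg) (auto simp: r_def T mult_left_mono)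
    also have "\<dots> = e * (E * E * T * norm h / (E * E * T * norm h + 1))" by (simp add: e1_def)
    also have "\<dots> \<le> e * 1" using e E T by (intro mult_left_mono) (auto simp: divide_simps add_nonneg_pos)
    finally show ?thesis by (simp add: r_def)
  qed
  then show ?thesis using d E by (intro exI[of _ "d / E"]) auto
qed (auto intro: exI[of _ 1])

definition Dflw :: "real \<Rightarrow> 'a \<Rightarrow> 'a \<Rightarrow>\<^sub>L 'a" where
  "Dflw t y = Blinfun (dflw t y)"

lemma Dflw_apply: "blinfun_apply (Dflw t y) = dflw t y"
  unfolding Dflw_def by (rule bounded_linear_Blinfun_apply[OF bounded_linear_dflw])

lemma continuous_Dflw: "continuous_on UNIV (\<lambda>(t, y). Dflw t y)"
proof (rule continuous_on_blinfun_componentwise)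
  fix h :: 'a
  have "continuous (at (t, y)) (\<lambda>(t, y). dflw t y h)" for t y
    unfolding continuous_at
  proof (rule tendstoI)
    fix e :: real assume e: "e > 0"
    then have e2: "e / 4 > 0" by simp
    obtain d where d: "d > 0" and
      D: "\<And>s y'. norm (y' - y) < d \<Longrightarrow> \<bar>s\<bar> \<le> \<bar>t\<bar> + 1 \<Longrightarrow> norm (dflw s y' h - dflw s y h) \<le> e / 4"
      using dflw_locally_uniform[OF e2] by blast
    have "continuous (at t) (\<lambda>s. dflw s y h)"
      using dflw_derivative has_vector_derivative_continuous by blast
    then obtain d' where d': "d' > 0" and D': "\<And>s. dist s t < d' \<Longrightarrow> dist (dflw s y h) (dflw t y h) < e / 4"
      using e2 unfolding continuous_at_eps_delta by blast
    let ?d = "min (min d d') 1"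
    have "dist (dflw (fst z) (snd z) h) (dflw t y h) < e" if z: "dist z (t, y) < ?d" for z
    proof -
      have 1: "dist (fst z) t < ?d" "dist (snd z) y < ?d"
        using z dist_fst_le[of z "(t,y)"] dist_snd_le[of z "(t,y)"] by auto
      have "dist (dflw (fst z) (snd z) h) (dflw (fst z) y h) \<le> e / 4"
        using D[of "snd z" "fst z"] 1 by (simp add: dist_norm dist_real_def) (smt (verit))
      moreover have "dist (dflw (fst z) y h) (dflw t y h) < e / 4" using D' 1 by simp
      ultimately show ?thesis
        using e dist_triangle[of "dflw (fst z) (snd z) h" "dflw t y h" "dflw (fst z) y h"] by simp
    qed
    then show "\<forall>\<^sub>F z in at (t, y). dist (case z of (t, y) \<Rightarrow> dflw t y h) (case (t, y) of (t, y) \<Rightarrow> dflw t y h) < e"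
      unfolding eventually_at by (intro exI[of _ ?d]) (use d d' in \<open>auto simp: case_prod_beta\<close>)
  qed
  then show "continuous_on UNIV (\<lambda>z. blinfun_apply (case z of (t, y) \<Rightarrow> Dflw t y) h)"
    by (simp add: continuous_on_eq_continuous_at case_prod_unfold Dflw_apply split_paired_all)
qed

text \<open>Only the partial derivative in the initial value has to be jointly continuous; for the
  time derivative, existence at the point is enough.\<close>

lemma flw_has_joint_derivative:
  "((\<lambda>(t, y). flw t y) has_derivative (\<lambda>(r, h). r *\<^sub>R f t (flw t y) + dflw t y h)) (at (t, y))"
proof -
  have "((\<lambda>(t, y). flw t y) has_derivative (\<lambda>(r, h). r *\<^sub>R f t (flw t y) + Dflw t y h)) (at (t, y) within UNIV \<times> UNIV)"
  proof (rule has_derivative_partialsI)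
    show "((\<lambda>x. flw x y) has_derivative (\<lambda>r. r *\<^sub>R f t (flw t y))) (at t within UNIV)"
      using flw_derivative[of y t] by (simp add: has_vector_derivative_def)
    show "(flw x has_derivative blinfun_apply (Dflw x y)) (at y within UNIV)" for x y
      using flw_has_derivative by (simp add: Dflw_apply)
    show "continuous (at (t, y) within UNIV \<times> UNIV) (\<lambda>(x, y). Dflw x y)"
      using continuous_Dflw by (simp add: continuous_on_eq_continuous_at)
  qed auto
  then show ?thesis by (simp add: Dflw_apply)
qed

lemma continuous_flw: "continuous_on UNIV (\<lambda>(t, y). flw t y)"
  using has_derivative_continuous[OF flw_has_joint_derivative]
  by (simp add: continuous_on_eq_continuous_at split_paired_all)

end

section \<open>Cutting off a vector field\<close>

text \<open>The squared positive part is C1 across 0, which makes it a cheap source of compactly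
  supported C1 functions.\<close>

lemma has_real_derivative_pos_part_squared:
  "((\<lambda>s. (max 0 s)\<^sup>2) has_real_derivative 2 * max 0 s) (at (s::real))"
proof -
  consider "s > 0" | "s < 0" | "s = 0" by linarith
  then show ?thesis
  proof cases
    case 1
    have "((\<lambda>s. s\<^sup>2) has_real_derivative 2 * max 0 s) (at s)"
      using 1 by (auto intro!: derivative_eq_intros)
    then show ?thesis
      by (rule has_field_derivative_transform_within_open[of _ _ _ "{0<..}"]) (use 1 in auto)
  next
    case 2
    have "((\<lambda>s. 0) has_real_derivative 2 * max 0 s) (at s)"
      using 2 by auto
    then show ?thesis
      by (rule has_field_derivative_transform_within_open[of _ _ _ "{..<0}"]) (use 2 in auto)
  next
    case 3
    have "((\<lambda>h. (max 0 h)\<^sup>2 / h) \<longlongrightarrow> 0) (at (0::real))"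
    proof (rule Lim_null_comparison)
      show "\<forall>\<^sub>F h in at (0::real). norm ((max 0 h)\<^sup>2 / h) \<le> \<bar>h\<bar>"
        by (rule always_eventually) (auto simp: max_def power2_eq_square)
      show "((\<lambda>h::real. \<bar>h\<bar>) \<longlongrightarrow> 0) (at 0)" by (rule tendsto_eq_intros refl | simp)+
    qed
    then show ?thesis using 3 by (simp add: has_field_derivative_iff)
  qed
qed

text \<open>\<sigma> sums squared positive parts over a finite cover of \<open>K\<close> by balls
  inside \<open>D\<close>, so it is C1, supported in \<open>S\<close> and at least some
  \<open>m > 0\<close> on \<open>K\<close>. Composing with
  \<open>s \<mapsto> 1 - (max 0 (1 - 2 s / m))^2\<close> gives 0 at \<open>s = 0\<close> and 1 from
  \<open>s = m / 2\<close> on, hence 1 on an open set around \<open>K\<close>.\<close>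

lemma exists_C1_cutoff:
  fixes D :: "'a::euclidean_space set"
  assumes K: "compact K" "K \<subseteq> D" and D: "open D"
  obtains \<eta> :: "'a \<Rightarrow> real" and g :: "'a \<Rightarrow> 'a" and S W
  where "\<And>y. (\<eta> has_derivative (\<lambda>h. h \<bullet> g y)) (at y)" "continuous_on UNIV g"
    "\<And>y. 0 \<le> \<eta> y" "\<And>y. \<eta> y \<le> 1" "compact S" "S \<subseteq> D" "\<And>y. y \<notin> S \<Longrightarrow> \<eta> y = 0"
    "open W" "K \<subseteq> W" "W \<subseteq> D" "\<And>y. y \<in> W \<Longrightarrow> \<eta> y = 1"
proof -
  have "\<exists>r>0. cball x r \<subseteq> D" if "x \<in> K" for x
    using D K that open_contains_cball by blast
  then obtain r where r: "\<And>x. x \<in> K \<Longrightarrow> r x > 0" "\<And>x. x \<in> K \<Longrightarrow> cball x (r x) \<subseteq> D" by metis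
  obtain C where C: "C \<subseteq> K" "finite C" "K \<subseteq> (\<Union>x\<in>C. ball x (r x))"
  proof (rule compactE_image[OF K(1), of K "\<lambda>x. ball x (r x)"])
    show "K \<subseteq> (\<Union>x\<in>K. ball x (r x))" using r(1) by (intro subsetI UN_I) auto
  qed auto
  define q where "q x y = (r x)\<^sup>2 - (norm (y - x))\<^sup>2" for x y
  define \<sigma> where "\<sigma> y = (\<Sum>x\<in>C. (max 0 (q x y))\<^sup>2)" for y
  define gs where "gs y = (\<Sum>x\<in>C. (- 4 * max 0 (q x y)) *\<^sub>R (y - x))" for y
  have q: "(q x has_derivative (\<lambda>h. - 2 * (h \<bullet> (y - x)))) (at y)" for x y
  proof -
    have "((\<lambda>y. (r x)\<^sup>2 - (y - x) \<bullet> (y - x)) has_derivative (\<lambda>h. 0 - ((y - x) \<bullet> (h - 0) + (h - 0) \<bullet> (y - x)))) (at y)"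
      by (intro has_derivative_diff has_derivative_inner has_derivative_const has_derivative_ident)
    then show ?thesis
      unfolding q_def[abs_def] power2_norm_eq_inner
      by (rule has_derivative_eq_rhs) (simp add: inner_commute fun_eq_iff)
  qed
  have pq: "((\<lambda>y. (max 0 (q x y))\<^sup>2) has_derivative (\<lambda>h. h \<bullet> ((- 4 * max 0 (q x y)) *\<^sub>R (y - x)))) (at y)" for x y
    by (rule has_derivative_eq_rhs[OF DERIV_compose_FDERIV[OF has_real_derivative_pos_part_squared q]])
      (simp add: fun_eq_iff)
  have \<sigma>: "(\<sigma> has_derivative (\<lambda>h. h \<bullet> gs y)) (at y)" for y
    unfolding \<sigma>_def[abs_def] gs_def inner_sum_right by (intro has_derivative_sum pq)
  have \<sigma>_cont: "continuous_on UNIV \<sigma>"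
    by (rule has_derivative_continuous_on, rule has_derivative_at_withinI, rule \<sigma>)
  have gs_cont: "continuous_on UNIV gs"
    unfolding gs_def q_def
    by (intro continuous_on_sum continuous_on_scaleR continuous_on_mult continuous_on_max continuous_on_diff
        continuous_on_power continuous_on_norm continuous_on_const continuous_on_id)
  have \<sigma>_nonneg: "\<sigma> y \<ge> 0" for y unfolding \<sigma>_def by (intro sum_nonneg) auto
  have \<sigma>_pos: "\<sigma> y > 0" if y: "y \<in> K" for y
  proof -
    obtain x where x: "x \<in> C" "y \<in> ball x (r x)" using C(3) y by blast
    then have "norm (y - x) < r x" by (simp add: dist_norm norm_minus_commute)
    then have "(norm (y - x))\<^sup>2 < (r x)\<^sup>2" by (intro power_strict_mono) auto
    then have "0 < (max 0 (q x y))\<^sup>2" by (simp add: q_def)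
    also have "\<dots> \<le> \<sigma> y" unfolding \<sigma>_def using C x by (intro member_le_sum) auto
    finally show ?thesis .
  qed
  obtain m where m: "m > 0" "\<And>y. y \<in> K \<Longrightarrow> m \<le> \<sigma> y"
  proof (cases "K = {}")
    case False
    then obtain y where "y \<in> K" "\<And>z. z \<in> K \<Longrightarrow> \<sigma> y \<le> \<sigma> z"
      using continuous_attains_inf[OF K(1) _ continuous_on_subset[OF \<sigma>_cont]] by blast
    then show thesis using that \<sigma>_pos by blast
  qed (use that[of 1] in auto)
  define S where "S = (\<Union>x\<in>C. cball x (r x))"
  have \<sigma>_zero: "\<sigma> y = 0" if "y \<notin> S" for y
    unfolding \<sigma>_def
  proof (intro sum.neutral ballI)
    fix x assume x: "x \<in> C"
    then have "r x < norm (y - x)" using that by (auto simp: S_def dist_norm norm_minus_commute)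
    moreover have "r x > 0" using x C r by auto
    ultimately have "(r x)\<^sup>2 \<le> (norm (y - x))\<^sup>2" by (intro power_mono) auto
    then show "(max 0 (q x y))\<^sup>2 = 0" by (simp add: q_def)
  qed
  have SD: "S \<subseteq> D" unfolding S_def using r(2) C(1) by blast
  define \<eta> where "\<eta> y = 1 - (max 0 (1 - 2 * \<sigma> y / m))\<^sup>2" for y
  define g where "g y = (4 / m * max 0 (1 - 2 * \<sigma> y / m)) *\<^sub>R gs y" for y
  show thesis
  proof (rule that[of \<eta> g S "{y. \<sigma> y > m / 2}"])
    fix y
    have "((\<lambda>y. 1 - 2 * \<sigma> y / m) has_derivative (\<lambda>h. - 2 * (h \<bullet> gs y) / m)) (at y)"
      using m by (auto intro!: derivative_eq_intros \<sigma>)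
    then have "((\<lambda>y. (max 0 (1 - 2 * \<sigma> y / m))\<^sup>2) has_derivative
        (\<lambda>h. (- 2 * (h \<bullet> gs y) / m) * (2 * max 0 (1 - 2 * \<sigma> y / m)))) (at y)"
      by (rule DERIV_compose_FDERIV[OF has_real_derivative_pos_part_squared])
    from has_derivative_diff[OF has_derivative_const[of 1] this]
    show "(\<eta> has_derivative (\<lambda>h. h \<bullet> g y)) (at y)"
      unfolding \<eta>_def[abs_def] by (rule has_derivative_eq_rhs) (simp add: g_def fun_eq_iff)
    have "max 0 (1 - 2 * \<sigma> y / m) \<le> 1" using \<sigma>_nonneg m by (simp add: divide_nonneg_pos)
    then show "0 \<le> \<eta> y" unfolding \<eta>_def by (simp add: power_le_one)
    show "\<eta> y \<le> 1" by (simp add: \<eta>_def)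
    show "\<eta> y = 0" if "y \<notin> S" using \<sigma>_zero[OF that] by (simp add: \<eta>_def)
    show "\<eta> y = 1" if "y \<in> {y. \<sigma> y > m / 2}" using that m by (simp add: \<eta>_def field_simps)
  next
    show "continuous_on UNIV g" unfolding g_def using m
      by (intro continuous_intros \<sigma>_cont gs_cont) auto
    show "compact S" unfolding S_def using C by (intro compact_UN) auto
    show "S \<subseteq> D" by (rule SD)
    show "open {y. \<sigma> y > m / 2}" using \<sigma>_cont by (intro open_Collect_less continuous_intros)
    show "K \<subseteq> {y. \<sigma> y > m / 2}" using m by force
    show "{y. \<sigma> y > m / 2} \<subseteq> D"
    proof
      fix y assume "y \<in> {y. \<sigma> y > m / 2}"
      then have "y \<in> S" using \<sigma>_zero m by force
      then show "y \<in> D" using SD by blast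
    qed
  qed
qed

text \<open>The product of \<eta> and \<open>F\<close> is extended by 0 outside \<open>D\<close>. It
  and its derivative are bounded because they depend on clamped time only and vanish off the compact
  \<open>S\<close>. That \<eta> is 1 on an open \<open>W\<close>, and not merely on
  \<open>K\<close>, makes its gradient vanish there, so that the derivatives agree as well.\<close>

lemma exists_cutoff_field:
  fixes F :: "real \<Rightarrow> 'a::euclidean_space \<Rightarrow> 'a" and DF :: "real \<Rightarrow> 'a \<Rightarrow> 'a \<Rightarrow>\<^sub>L 'a"
  assumes D: "open D"
    and F: "continuous_on ({0..} \<times> D) (\<lambda>(t, y). F t y)"
    and F': "\<And>t y. t \<ge> 0 \<Longrightarrow> y \<in> D \<Longrightarrow> (F t has_derivative blinfun_apply (DF t y)) (at y)"
    and DF: "continuous_on ({0..} \<times> D) (\<lambda>(t, y). DF t y)"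
    and K: "compact K" "K \<subseteq> D" and T: "0 \<le> T"
  obtains f Df L M \<eta> S W where "C1_field f Df L M"
    "\<And>t y. t \<in> {0..T} \<Longrightarrow> y \<in> D \<Longrightarrow> f t y = \<eta> y *\<^sub>R F t y"
    "\<And>t y. t \<in> {0..T} \<Longrightarrow> y \<in> W \<Longrightarrow> Df t y = DF t y"
    "\<And>y. 0 \<le> \<eta> y" "\<And>y. \<eta> y \<le> 1" "\<And>y. y \<in> W \<Longrightarrow> \<eta> y = 1"
    "open W" "K \<subseteq> W" "W \<subseteq> S" "compact S" "S \<subseteq> D" "\<And>t y. y \<notin> S \<Longrightarrow> f t y = 0"
proof -
  obtain \<eta> :: "'a \<Rightarrow> real" and g :: "'a \<Rightarrow> 'a" and S W
    where \<eta>: "\<And>y. (\<eta> has_derivative (\<lambda>h. h \<bullet> g y)) (at y)" and g: "continuous_on UNIV g"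
    and \<eta>01: "\<And>y. 0 \<le> \<eta> y" "\<And>y. \<eta> y \<le> 1" and S: "compact S" "S \<subseteq> D" "\<And>y. y \<notin> S \<Longrightarrow> \<eta> y = 0"
    and W: "open W" "K \<subseteq> W" "W \<subseteq> D" "\<And>y. y \<in> W \<Longrightarrow> \<eta> y = 1"
    using exists_C1_cutoff[OF K D] by metis
  have \<eta>_cont: "continuous_on UNIV \<eta>"
    by (rule has_derivative_continuous_on, rule has_derivative_at_withinI, rule \<eta>)
  have g_zero: "g y = 0" if y: "open N" "y \<in> N" "\<And>z. z \<in> N \<Longrightarrow> \<eta> z = c" for y N c
  proof -
    have "((\<lambda>z. c) has_derivative (\<lambda>h. h \<bullet> g y)) (at y)"
      by (rule has_derivative_transform_within_open[OF \<eta> y(1,2)]) (use y in auto)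
    then have "(\<lambda>h. h \<bullet> g y) = (\<lambda>h. 0)" by (rule has_derivative_unique) simp
    then have "g y \<bullet> g y = 0" by meson
    then show ?thesis by simp
  qed
  have S_open: "open (- S)" using S(1) by (simp add: compact_imp_closed open_Compl)
  have gS: "g y = 0" if "y \<notin> S" for y using g_zero[OF S_open] S(3) that by auto
  have gW: "g y = 0" if "y \<in> W" for y using g_zero[OF W(1) that W(4)] by blast
  \<comment> \<open>\<open>F\<close> is controlled only for nonnegative times; clamping extends the
    field to all times and leaves it unchanged on \<open>[0, T]\<close>.\<close>
  define cl where "cl t = max 0 (min T t)" for t
  have cl: "cl t \<in> {0..T}" "cl t \<ge> 0" for t using T by (auto simp: cl_def)
  have cl_id: "cl t = t" if "t \<in> {0..T}" for t using that by (auto simp: cl_def)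
  have cl_cont: "continuous_on X cl" for X unfolding cl_def by (intro continuous_intros)
  define f where "f t y = (if y \<in> D then \<eta> y *\<^sub>R F (cl t) y else 0)" for t y
  define Df where "Df t y = (if y \<in> D then \<eta> y *\<^sub>R DF (cl t) y
      + (blinfun_scaleR_left (F (cl t) y) o\<^sub>L blinfun_inner_left (g y)) else 0)" for t y
  have f0: "f t y = 0" "Df t y = 0" if "y \<notin> S" for t y
    using that S(3) gS by (auto simp: f_def Df_def intro!: blinfun_eqI simp: blinfun.add_left blinfun.scaleR_left)
  \<comment> \<open>\<open>D\<close> and the complement of \<open>S\<close> are open and cover the
    space because \<open>S\<close> lies in \<open>D\<close>; on the second set the function is
    0.\<close>
  have open_cover: "continuous_on UNIV (\<lambda>(t, y). h t y)"
    if "continuous_on (UNIV \<times> D) (\<lambda>(t, y). h t y)" "\<And>t y. y \<notin> S \<Longrightarrow> h t y = 0"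
    for h :: "real \<Rightarrow> 'a \<Rightarrow> 'b::real_normed_vector"
  proof -
    have "continuous_on (UNIV \<times> D \<union> UNIV \<times> (- S)) (\<lambda>(t, y). h t y)"
    proof (rule continuous_on_open_Un)
      show "continuous_on (UNIV \<times> - S) (\<lambda>(t, y). h t y)"
        by (rule continuous_on_eq[where f="\<lambda>_. 0"]) (use that in auto)
    qed (use that D S_open in \<open>auto intro!: open_Times\<close>)
    moreover have "UNIV \<times> D \<union> UNIV \<times> (- S) = (UNIV :: (real \<times> 'a) set)" using S by auto
    ultimately show ?thesis by metis
  qed
  have F_cl: "continuous_on (UNIV \<times> D) (\<lambda>z. F (cl (fst z)) (snd z))"
    by (rule continuous_on_compose2[OF F[unfolded case_prod_unfold], where f="\<lambda>z. (cl (fst z), snd z)", simplified])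
      (use cl in \<open>auto intro!: continuous_intros continuous_on_compose2[OF cl_cont[of UNIV]]\<close>)
  have DF_cl: "continuous_on (UNIV \<times> D) (\<lambda>z. DF (cl (fst z)) (snd z))"
    by (rule continuous_on_compose2[OF DF[unfolded case_prod_unfold], where f="\<lambda>z. (cl (fst z), snd z)", simplified])
      (use cl in \<open>auto intro!: continuous_intros continuous_on_compose2[OF cl_cont[of UNIV]]\<close>)
  have snd_comp: "continuous_on X (\<lambda>z. k (snd z))" if "continuous_on UNIV k"
    for k :: "'a \<Rightarrow> 'b::topological_space" and X :: "(real \<times> 'a) set"
    by (rule continuous_on_compose2[OF that]) (auto intro!: continuous_intros)
  have f_cont: "continuous_on UNIV (\<lambda>(t, y). f t y)"
  proof (rule open_cover)
    have "continuous_on (UNIV \<times> D) (\<lambda>z. \<eta> (snd z) *\<^sub>R F (cl (fst z)) (snd z))"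
      by (intro continuous_intros F_cl snd_comp[OF \<eta>_cont])
    then show "continuous_on (UNIV \<times> D) (\<lambda>(t, y). f t y)"
      by (rule continuous_on_eq) (auto simp: f_def)
  qed (rule f0)
  have Df_cont: "continuous_on UNIV (\<lambda>(t, y). Df t y)"
  proof (rule open_cover)
    have "continuous_on (UNIV \<times> D) (\<lambda>z. \<eta> (snd z) *\<^sub>R DF (cl (fst z)) (snd z)
      + (blinfun_scaleR_left (F (cl (fst z)) (snd z)) o\<^sub>L blinfun_inner_left (g (snd z))))"
    proof (rule continuous_on_blinfun_componentwise)
      fix i :: 'a
      have "continuous_on (UNIV \<times> D) (\<lambda>z. \<eta> (snd z) *\<^sub>R blinfun_apply (DF (cl (fst z)) (snd z)) i
         + (i \<bullet> g (snd z)) *\<^sub>R F (cl (fst z)) (snd z))"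
        by (intro continuous_intros F_cl DF_cl snd_comp[OF \<eta>_cont] snd_comp[OF g])
      then show "continuous_on (UNIV \<times> D) (\<lambda>z. blinfun_apply (\<eta> (snd z) *\<^sub>R DF (cl (fst z)) (snd z)
      + (blinfun_scaleR_left (F (cl (fst z)) (snd z)) o\<^sub>L blinfun_inner_left (g (snd z)))) i)"
        by (simp add: blinfun.add_left blinfun.scaleR_left)
    qed
    then show "continuous_on (UNIV \<times> D) (\<lambda>(t, y). Df t y)"
      by (rule continuous_on_eq) (auto simp: Df_def)
  qed (rule f0)
  have bounded: "\<exists>B. \<forall>t y. norm (h t y) \<le> B"
    if h: "continuous_on UNIV (\<lambda>(t, y). h t y)" "\<And>t y. y \<notin> S \<Longrightarrow> h t y = 0" "\<And>t y. h t y = h (cl t) y"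
    for h :: "real \<Rightarrow> 'a \<Rightarrow> 'b::real_normed_vector"
  proof -
    have "bounded ((\<lambda>(t, y). h t y) ` ({0..T} \<times> S))"
      by (intro compact_imp_bounded compact_continuous_image continuous_on_subset[OF h(1)] compact_Times S(1) compact_Icc) auto
    then obtain B where B: "\<And>t y. t \<in> {0..T} \<Longrightarrow> y \<in> S \<Longrightarrow> norm (h t y) \<le> B"
      unfolding bounded_iff by fastforce
    have "norm (h t y) \<le> max 0 B" for t y
    proof (cases "y \<in> S")
      case True
      then show ?thesis using B[OF cl(1)[of t]] h(3)[of t y] by (simp add: max.coboundedI2)
    qed (use h(2) in auto)
    then show ?thesis by blast
  qed
  have clcl: "cl (cl t) = cl t" for t using cl_id cl(1) by blast
  have fcl: "f t y = f (cl t) y" "Df t y = Df (cl t) y" for t y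
    by (simp_all only: f_def Df_def clcl)
  obtain M where M: "\<And>t y. norm (f t y) \<le> M"
    using bounded[OF f_cont f0(1)] fcl(1) by blast
  obtain L where L: "\<And>t y. norm (Df t y) \<le> L"
    using bounded[OF Df_cont f0(2)] fcl(2) by blast
  have f': "(f t has_derivative blinfun_apply (Df t y)) (at y)" for t y
  proof (cases "y \<in> D")
    case True
    have "((\<lambda>y. \<eta> y *\<^sub>R F (cl t) y) has_derivative
        (\<lambda>h. \<eta> y *\<^sub>R blinfun_apply (DF (cl t) y) h + (h \<bullet> g y) *\<^sub>R F (cl t) y)) (at y)"
      by (rule has_derivative_scaleR[OF \<eta> F'[OF cl(2) True]])
    then have "((\<lambda>y. \<eta> y *\<^sub>R F (cl t) y) has_derivative blinfun_apply (Df t y)) (at y)"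
      by (rule has_derivative_eq_rhs) (simp add: fun_eq_iff Df_def True blinfun.add_left blinfun.scaleR_left)
    then show ?thesis
      by (rule has_derivative_transform_within_open[OF _ D True]) (simp add: f_def)
  next
    case False
    then have y: "y \<in> - S" using S by auto
    have "((\<lambda>y. 0) has_derivative blinfun_apply (Df t y)) (at y)" using f0(2) y by (simp add: zero_blinfun.rep_eq)
    then show ?thesis
      by (rule has_derivative_transform_within_open[OF _ S_open y]) (simp add: f0)
  qed
  show thesis
  proof (rule that[of f Df L M \<eta> W S])
    show "C1_field f Df L M" by unfold_locales (use f_cont f' Df_cont L M in auto)
    show "f t y = \<eta> y *\<^sub>R F t y" if "t \<in> {0..T}" "y \<in> D" for t y
      using that by (simp add: f_def cl_id)
    show "Df t y = DF t y" if "t \<in> {0..T}" "y \<in> W" for t y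
    proof -
      have "y \<in> D" "g y = 0" using that W(3) gW by auto
      then show ?thesis using that W(4)
        by (simp add: Df_def cl_id) (auto intro!: blinfun_eqI simp: blinfun.add_left)
    qed
    show "W \<subseteq> S" using W(4) S(3) by (metis subsetI zero_neq_one)
  qed (use \<eta>01 W S f0 in auto)
qed

section \<open>The characteristic system\<close>

text \<open>The spatial regularity of \<open>v\<close> is stated through partial derivatives. The
  increment is walked through one basis direction at a time, by induction over the set of directions
  already taken, with the mean value inequality on each leg.\<close>

lemma has_derivative_of_continuous_partials:
  fixes f :: "'a::euclidean_space \<Rightarrow> 'b::real_normed_vector"
  assumes S: "open S" and x: "x \<in> S"
    and partial: "\<And>y i. y \<in> S \<Longrightarrow> i \<in> Basis \<Longrightarrow>
      ((\<lambda>r. f (y + r *\<^sub>R i)) has_vector_derivative D i y) (at 0)"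
    and cont: "\<And>i. i \<in> Basis \<Longrightarrow> continuous_on S (D i)"
  shows "(f has_derivative (\<lambda>h. \<Sum>i\<in>Basis. (h \<bullet> i) *\<^sub>R D i x)) (at x)"
proof (rule has_derivativeI)
  show "bounded_linear (\<lambda>h. \<Sum>i\<in>Basis. (h \<bullet> i) *\<^sub>R D i x)"
    by (intro bounded_linear_sum bounded_linear_scaleR_const bounded_linear_inner_left bounded_linear_ident)
  let ?n = "real DIM('a)"
  have key: "\<exists>d>0. \<forall>h. norm h < d \<longrightarrow>
      norm (f (x + h) - f x - (\<Sum>i\<in>Basis. (h \<bullet> i) *\<^sub>R D i x)) \<le> (?n * e) * norm h" if e: "e > 0" for e
  proof -
    have "\<forall>i\<in>Basis. \<exists>d>0. \<forall>y. dist y x < d \<longrightarrow> dist (D i y) (D i x) < e"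
      using cont S x e by (metis continuous_at_eps_delta continuous_on_eq_continuous_at)
    then obtain d1 where d1: "\<And>i. i \<in> Basis \<Longrightarrow> d1 i > 0"
      "\<And>i y. i \<in> Basis \<Longrightarrow> dist y x < d1 i \<Longrightarrow> dist (D i y) (D i x) < e" by metis
    obtain d2 where d2: "d2 > 0" "ball x d2 \<subseteq> S" using S x open_contains_ball by blast
    define d where "d = Min (insert d2 (d1 ` Basis))"
    have d: "d > 0" using d1 d2 by (simp add: d_def)
    have "d \<le> d1 i" if "i \<in> Basis" for i unfolding d_def using that by (intro Min_le) auto
    then have dD: "norm (D i y - D i x) \<le> e" if "i \<in> Basis" "dist y x < d" for i y
      using d1(2)[of i y] that by (force simp: dist_norm)
    have "d \<le> d2" by (simp add: d_def)
    then have dS: "y \<in> S" if "dist y x < d" for y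
      using d2 that by (auto simp: dist_commute)
    have "norm (f (x + h) - f x - (\<Sum>i\<in>Basis. (h \<bullet> i) *\<^sub>R D i x)) \<le> (?n * e) * norm h"
      if h: "norm h < d / (?n + 1)" for h
    proof -
      define P where "P B = (\<Sum>i\<in>B. (h \<bullet> i) *\<^sub>R i)" for B
      \<comment> \<open>At most \<open>n\<close> completed legs and a partial one, none longer than
        \<open>|h|\<close>; hence the divisor \<open>n + 1\<close> in the bound on
        \<open>h\<close>.\<close>
      have close: "norm (P B + s *\<^sub>R i) < d" if "B \<subseteq> Basis" "i \<in> Basis" "\<bar>s\<bar> \<le> norm h" for B i s
      proof -
        have "norm (P B) \<le> (\<Sum>i\<in>B. norm h)"
          unfolding P_def using that(1) by (intro sum_norm_le) (auto simp: subset_iff Basis_le_norm)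
        also have "\<dots> \<le> ?n * norm h"
          using that(1) by (simp add: card_mono mult_right_mono)
        finally have "norm (P B + s *\<^sub>R i) \<le> ?n * norm h + norm h"
          using that norm_triangle_ineq[of "P B" "s *\<^sub>R i"] by simp
        also have "\<dots> = (?n + 1) * norm h" by (simp add: algebra_simps)
        also have "\<dots> < d" using h by (simp add: field_simps)
        finally show ?thesis .
      qed
      have "norm (f (x + P B) - f x - (\<Sum>i\<in>B. (h \<bullet> i) *\<^sub>R D i x)) \<le> (card B * e) * norm h"
        if "finite B" "B \<subseteq> Basis" for B
        using that
      proof (induction B rule: finite_induct)
        case (insert i B)
        let ?z = "x + P B" and ?c = "h \<bullet> i"
        have i: "i \<in> Basis" and c: "\<bar>?c\<bar> \<le> norm h" using insert Basis_le_norm by auto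
        define q where "q s = f (?z + s *\<^sub>R i) - s *\<^sub>R D i x" for s
        have "norm (q ?c - q 0) \<le> e * norm (?c - 0)"
        proof (rule differentiable_bound[where S="{-\<bar>?c\<bar>..\<bar>?c\<bar>}" and f'="\<lambda>s r. r *\<^sub>R (D i (?z + s *\<^sub>R i) - D i x)"])
          fix s assume s: "s \<in> {-\<bar>?c\<bar>..\<bar>?c\<bar>}"
          then have "\<bar>s\<bar> \<le> norm h" using c by auto
          then have zs: "dist (?z + s *\<^sub>R i) x < d"
            using close[of B i s] insert i by (simp add: dist_norm)
          have "((\<lambda>r. f (?z + s *\<^sub>R i + r *\<^sub>R i)) has_vector_derivative D i (?z + s *\<^sub>R i)) (at (0::real))"
            by (rule partial[OF dS[OF zs] i])
          then have "(((\<lambda>r. f (?z + s *\<^sub>R i + r *\<^sub>R i)) \<circ> (\<lambda>r. r - s)) has_vector_derivative 1 *\<^sub>R D i (?z + s *\<^sub>R i)) (at s)"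
            by (intro vector_diff_chain_at) (auto intro!: derivative_eq_intros)
          then have "((\<lambda>r. f (?z + r *\<^sub>R i)) has_vector_derivative D i (?z + s *\<^sub>R i)) (at s)"
            by (simp add: o_def algebra_simps)
          then have "(q has_vector_derivative (D i (?z + s *\<^sub>R i) - D i x)) (at s)"
            unfolding q_def by (auto intro!: derivative_eq_intros)
          then show "(q has_derivative (\<lambda>r. r *\<^sub>R (D i (?z + s *\<^sub>R i) - D i x))) (at s within {-\<bar>?c\<bar>..\<bar>?c\<bar>})"
            by (simp add: has_vector_derivative_def has_derivative_at_withinI)
          show "onorm (\<lambda>r. r *\<^sub>R (D i (?z + s *\<^sub>R i) - D i x)) \<le> e"
            by (rule onorm_le) (use mult_left_mono[OF dD[OF i zs] abs_ge_zero] in \<open>simp add: mult.commute\<close>)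
        qed auto
        also have "\<dots> \<le> e * norm h" using c e by simp
        finally have 1: "norm (f (?z + ?c *\<^sub>R i) - f ?z - ?c *\<^sub>R D i x) \<le> e * norm h"
          by (simp add: q_def algebra_simps)
        have eq: "f (x + P (insert i B)) - f x - (\<Sum>i\<in>insert i B. (h \<bullet> i) *\<^sub>R D i x)
          = (f (?z + ?c *\<^sub>R i) - f ?z - ?c *\<^sub>R D i x) + (f ?z - f x - (\<Sum>i\<in>B. (h \<bullet> i) *\<^sub>R D i x))"
          using insert by (simp add: P_def algebra_simps)
        have "norm (f ?z - f x - (\<Sum>i\<in>B. (h \<bullet> i) *\<^sub>R D i x)) \<le> (card B * e) * norm h"
          using insert by simp
        then have "norm (f (x + P (insert i B)) - f x - (\<Sum>i\<in>insert i B. (h \<bullet> i) *\<^sub>R D i x)) \<le> e * norm h + (card B * e) * norm h"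
          unfolding eq using 1 by (intro norm_triangle_le) linarith
        then show ?case using insert by (simp add: algebra_simps)
      qed (simp add: P_def)
      from this[of Basis] show ?thesis by (simp add: P_def euclidean_representation)
    qed
    then show ?thesis using d by (intro exI[of _ "d / (?n + 1)"]) auto
  qed
  show "(\<lambda>y. (f y - f x - (\<Sum>i\<in>Basis. ((y - x) \<bullet> i) *\<^sub>R D i x)) /\<^sub>R norm (y - x)) \<midarrow>x\<rightarrow> 0"
  proof (rule tendstoI)
    fix e :: real assume e: "e > 0"
    define e' where "e' = e / (?n + 1)"
    have e': "e' > 0" "?n * e' < e" using e by (auto simp: e'_def field_simps)
    obtain d where d: "d > 0" and dk: "\<And>h. norm h < d \<Longrightarrow>
      norm (f (x + h) - f x - (\<Sum>i\<in>Basis. (h \<bullet> i) *\<^sub>R D i x)) \<le> (?n * e') * norm h"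
      using key[OF e'(1)] by blast
    have "dist ((f y - f x - (\<Sum>i\<in>Basis. ((y - x) \<bullet> i) *\<^sub>R D i x)) /\<^sub>R norm (y - x)) 0 < e"
      if y: "y \<noteq> x" "dist y x < d" for y
    proof -
      have "norm (f y - f x - (\<Sum>i\<in>Basis. ((y - x) \<bullet> i) *\<^sub>R D i x)) \<le> (?n * e') * norm (y - x)"
        using dk[of "y - x"] y by (simp add: dist_norm)
      also have "\<dots> < e * norm (y - x)" using e' y by (intro mult_strict_right_mono) auto
      finally show ?thesis using y by (simp add: divide_simps mult.commute)
    qed
    then show "\<forall>\<^sub>F y in at x. dist ((f y - f x - (\<Sum>i\<in>Basis. ((y - x) \<bullet> i) *\<^sub>R D i x)) /\<^sub>R norm (y - x)) 0 < e"
      using d unfolding eventually_at by blast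
  qed
qed

lemma has_derivative_of_continuous_partials_vec:
  fixes f :: "real^'n \<Rightarrow> 'b::real_normed_vector"
  assumes S: "open S" and x: "x \<in> S"
    and partial: "\<And>y i. y \<in> S \<Longrightarrow> ((\<lambda>r. f (y + r *\<^sub>R axis i 1)) has_vector_derivative D i y) (at 0)"
    and cont: "\<And>i. continuous_on S (D i)"
  shows "(f has_derivative (\<lambda>h. \<Sum>i\<in>UNIV. (h $ i) *\<^sub>R D i x)) (at x)"
proof -
  let ?ax = "\<lambda>i::'n. axis i (1::real)"
  have inj: "inj ?ax" by (auto simp: inj_on_def axis_eq_axis)
  have Basis: "(Basis :: (real^'n) set) = range ?ax" by (auto simp: Basis_vec_def)
  have "(f has_derivative (\<lambda>h. \<Sum>b\<in>Basis. (h \<bullet> b) *\<^sub>R D (inv ?ax b) x)) (at x)"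
    by (rule has_derivative_of_continuous_partials[OF S x, where D="\<lambda>b. D (inv ?ax b)"])
      (use partial cont in \<open>auto simp: Basis inv_f_f[OF inj]\<close>)
  then show ?thesis
    by (simp add: Basis sum.reindex[OF inj] inv_f_f[OF inj] inner_axis)
qed

section \<open>The vector field of the characteristic equations and its derivative\<close>

definition comb :: "('n::finite \<Rightarrow> 'b::real_normed_vector) \<Rightarrow> real^'n \<Rightarrow> 'b" where
  "comb W h = (\<Sum>i\<in>UNIV. (h $ i) *\<^sub>R W i)"

type_synonym char_state = "(real^3) \<times> (real^3) \<times> real"

text \<open>The characteristic system of \<open>\<phi>\<^sub>t + v \<bullet> p - \<phi> (\<beta> - norm p) = 0\<close> in the variables \<open>(x, p, \<phi>)\<close>.
  \<open>w i\<close> and \<open>w2 i j\<close> are the partial derivatives of \<open>v\<close>, so \<open>comb (w _ t x)\<close> is \<open>\<nabla>v\<close>.\<close>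

locale transport_problem =
  fixes \<Omega> :: "(real^3) set" and v :: "real \<Rightarrow> real^3 \<Rightarrow> real^3"
    and w :: "3 \<Rightarrow> real \<Rightarrow> real^3 \<Rightarrow> real^3" and w2 :: "3 \<Rightarrow> 3 \<Rightarrow> real \<Rightarrow> real^3 \<Rightarrow> real^3" and \<beta> :: real
  assumes open_\<Omega>: "open \<Omega>"
    and v_cont: "continuous_on ({0..} \<times> \<Omega>) (\<lambda>(t, x). v t x)"
    and w_cont: "\<And>i. continuous_on ({0..} \<times> \<Omega>) (\<lambda>(t, x). w i t x)"
    and w2_cont: "\<And>i j. continuous_on ({0..} \<times> \<Omega>) (\<lambda>(t, x). w2 i j t x)"
    and v_partial: "\<And>t x i. 0 \<le> t \<Longrightarrow> x \<in> \<Omega> \<Longrightarrow> ((\<lambda>r. v t (x + r *\<^sub>R axis i 1)) has_vector_derivative w i t x) (at 0)"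
    and w_partial: "\<And>t x i j. 0 \<le> t \<Longrightarrow> x \<in> \<Omega> \<Longrightarrow> ((\<lambda>r. w i t (x + r *\<^sub>R axis j 1)) has_vector_derivative w2 i j t x) (at 0)"
begin

definition Dv :: "real \<Rightarrow> real^3 \<Rightarrow> real^3 \<Rightarrow> real^3" where
  "Dv t x = comb (\<lambda>i. w i t x)"

definition Dw :: "3 \<Rightarrow> real \<Rightarrow> real^3 \<Rightarrow> real^3 \<Rightarrow> real^3" where
  "Dw i t x = comb (\<lambda>j. w2 i j t x)"

definition Dv_adj :: "real \<Rightarrow> real^3 \<Rightarrow> real^3 \<Rightarrow> real^3" where
  "Dv_adj t x p = (\<Sum>i\<in>UNIV. (w i t x \<bullet> p) *\<^sub>R axis i 1)"

definition D :: "char_state set" where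
  "D = \<Omega> \<times> (- {0}) \<times> UNIV"

text \<open>Charpit's equations for \<open>H = v \<bullet> p - u (\<beta> - |p|)\<close>:
  \<open>x' = H_p\<close>, \<open>p' = - H_x - H_u p\<close>,
  \<open>u' = p \<bullet> H_p - H\<close>. In the last one the terms with \<open>|p|\<close> cancel,
  which leaves a linear equation.\<close>

definition F :: "real \<Rightarrow> char_state \<Rightarrow> char_state" where
  "F t y = (let x = fst y; p = fst (snd y); u = snd (snd y) in
     (v t x + (u / norm p) *\<^sub>R p, (\<beta> - norm p) *\<^sub>R p - Dv_adj t x p, \<beta> * u))"

text \<open>Terms such as \<open>0 - b \<bullet> sgn p\<close> are left as the differentiation rules
  produce them, so that \<open>F_has_derivative\<close> follows by introduction rules alone.\<close>

definition F' :: "real \<Rightarrow> char_state \<Rightarrow> char_state \<Rightarrow> char_state" where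
  "F' t y h = (let x = fst y; p = fst (snd y); u = snd (snd y);
        a = fst h; b = fst (snd h); c = snd (snd h) in
     (Dv t x a + ((u / norm p) *\<^sub>R b + ((c * norm p - u * (b \<bullet> sgn p)) / (norm p * norm p)) *\<^sub>R p),
      ((\<beta> - norm p) *\<^sub>R b + (0 - b \<bullet> sgn p) *\<^sub>R p)
        - (\<Sum>i\<in>UNIV. (w i t x \<bullet> b + Dw i t x a \<bullet> p) *\<^sub>R axis i 1),
      \<beta> * c))"

definition DF :: "real \<Rightarrow> char_state \<Rightarrow> char_state \<Rightarrow>\<^sub>L char_state" where
  "DF t y = Blinfun (F' t y)"

lemma open_D: "open D"
  unfolding D_def by (intro open_Times open_\<Omega> open_UNIV) auto

lemma slice_cont: "continuous_on \<Omega> (h t)"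
  if "continuous_on ({0..} \<times> \<Omega>) (\<lambda>(t, x). h t x)" "0 \<le> t" for h :: "real \<Rightarrow> real^3 \<Rightarrow> 'z::topological_space"
  by (rule continuous_on_compose2[OF that(1), where f="\<lambda>x. (t, x)", simplified]) (use that in \<open>auto intro!: continuous_intros\<close>)

lemma v_derivative: "0 \<le> t \<Longrightarrow> x \<in> \<Omega> \<Longrightarrow> (v t has_derivative Dv t x) (at x)"
  unfolding Dv_def comb_def
  by (rule has_derivative_of_continuous_partials_vec[OF open_\<Omega>]) (auto intro: v_partial slice_cont w_cont)

lemma w_derivative: "0 \<le> t \<Longrightarrow> x \<in> \<Omega> \<Longrightarrow> (w i t has_derivative Dw i t x) (at x)"
  unfolding Dw_def comb_def
  by (rule has_derivative_of_continuous_partials_vec[OF open_\<Omega>]) (auto intro: w_partial slice_cont w2_cont)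

lemma Dv_adj_inner: "Dv_adj t x p \<bullet> h = Dv t x h \<bullet> p"
  unfolding Dv_adj_def Dv_def comb_def
  by (simp add: inner_sum_left inner_commute[of "axis _ _"] inner_axis mult.commute)

lemma jacobian_v: "0 \<le> t \<Longrightarrow> x \<in> \<Omega> \<Longrightarrow> jacobian (v t) (at x) *v p = Dv t x p"
  using v_derivative[of t x] frechet_derivative_at[OF v_derivative, of t x]
  by (simp add: jacobian_def matrix_works has_derivative_linear)

lemma F_has_derivative:
  assumes t: "0 \<le> t" and y: "y \<in> D"
  shows "(F t has_derivative F' t y) (at y)"
proof -
  have x: "fst y \<in> \<Omega>" and p: "fst (snd y) \<noteq> 0" using y by (auto simp: D_def)
  have X: "(fst has_derivative fst) (at y)" by (rule bounded_linear_imp_has_derivative[OF bounded_linear_fst])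
  have P: "((\<lambda>y. fst (snd y)) has_derivative (\<lambda>h. fst (snd h))) (at y)"
    by (intro has_derivative_fst has_derivative_snd has_derivative_ident)
  have U: "((\<lambda>y. snd (snd y)) has_derivative (\<lambda>h. snd (snd h))) (at y)"
    by (intro has_derivative_snd has_derivative_ident)
  have N: "((\<lambda>y. norm (fst (snd y))) has_derivative (\<lambda>h. fst (snd h) \<bullet> sgn (fst (snd y)))) (at y)"
    by (rule has_derivative_compose[OF P has_derivative_norm[OF p]])
  have V: "((\<lambda>y. v t (fst y)) has_derivative (\<lambda>h. Dv t (fst y) (fst h))) (at y)"
    by (rule has_derivative_compose[OF X v_derivative[OF t x]])
  have W: "((\<lambda>y. w i t (fst y)) has_derivative (\<lambda>h. Dw i t (fst y) (fst h))) (at y)" for i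
    by (rule has_derivative_compose[OF X w_derivative[OF t x]])
  show ?thesis
    unfolding F_def[abs_def] F'_def[abs_def] Let_def Dv_adj_def
    by (intro has_derivative_Pair has_derivative_add has_derivative_diff has_derivative_sum
        has_derivative_scaleR has_derivative_divide' has_derivative_inner has_derivative_scaleR_left
        has_derivative_mult_right has_derivative_const X P U N V W) (use p in auto)
qed

lemma DF_apply: "0 \<le> t \<Longrightarrow> y \<in> D \<Longrightarrow> blinfun_apply (DF t y) = F' t y"
  unfolding DF_def by (rule bounded_linear_Blinfun_apply[OF has_derivative_bounded_linear[OF F_has_derivative]])

lemma D_cont:
  assumes "continuous_on ({0..} \<times> \<Omega>) (\<lambda>(t, x). h t x)"
  shows "continuous_on ({0..} \<times> D) (\<lambda>z. h (fst z) (fst (snd z)))"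
  by (rule continuous_on_compose2[OF assms, where f="\<lambda>z. (fst z, fst (snd z))", simplified])
    (auto intro!: continuous_intros simp: D_def)

lemma F_cont: "continuous_on ({0..} \<times> D) (\<lambda>(t, y). F t y)"
  unfolding F_def Let_def case_prod_unfold Dv_adj_def
  by (intro continuous_on_Pair continuous_on_add continuous_on_diff continuous_on_sum continuous_on_scaleR
      continuous_on_divide continuous_on_inner continuous_on_mult continuous_on_norm continuous_on_fst
      continuous_on_snd continuous_on_const continuous_on_id D_cont[OF v_cont] D_cont[OF w_cont])
    (auto simp: D_def)

lemma DF_cont: "continuous_on ({0..} \<times> D) (\<lambda>(t, y). DF t y)"
proof (rule continuous_on_blinfun_componentwise)
  fix h :: char_state
  have "continuous_on ({0..} \<times> D) (\<lambda>z. F' (fst z) (snd z) h)"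
    unfolding F'_def Let_def Dv_def Dw_def comb_def sgn_div_norm
    by (intro continuous_on_Pair continuous_on_add continuous_on_diff continuous_on_sum continuous_on_scaleR
        continuous_on_divide continuous_on_inner continuous_on_mult continuous_on_norm continuous_on_inverse
        continuous_on_fst continuous_on_snd continuous_on_const continuous_on_id
        D_cont[OF v_cont] D_cont[OF w_cont] D_cont[OF w2_cont])
      (auto simp: D_def)
  then show "continuous_on ({0..} \<times> D) (\<lambda>z. blinfun_apply (case z of (t, y) \<Rightarrow> DF t y) h)"
    by (rule continuous_on_eq) (auto simp: DF_apply)
qed

lemma cutoff_field:
  assumes "compact K" "K \<subseteq> D" "0 \<le> T"
  obtains f Df L M \<eta> S W where "C1_field f Df L M"
    "\<And>t y. t \<in> {0..T} \<Longrightarrow> y \<in> D \<Longrightarrow> f t y = \<eta> y *\<^sub>R F t y"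
    "\<And>t y. t \<in> {0..T} \<Longrightarrow> y \<in> W \<Longrightarrow> blinfun_apply (Df t y) = F' t y"
    "\<And>y. 0 \<le> \<eta> y" "\<And>y. \<eta> y \<le> 1" "\<And>y. y \<in> W \<Longrightarrow> \<eta> y = 1"
    "open W" "K \<subseteq> W" "W \<subseteq> S" "compact S" "S \<subseteq> D" "\<And>t y. y \<notin> S \<Longrightarrow> f t y = 0"
proof -
  have *: "(F t has_derivative blinfun_apply (DF t y)) (at y)" if "t \<ge> 0" "y \<in> D" for t y
    using F_has_derivative[OF that] DF_apply[OF that] by simp
  obtain f Df L M \<eta> S W where f: "C1_field f Df L M"
    "\<And>t y. t \<in> {0..T} \<Longrightarrow> y \<in> D \<Longrightarrow> f t y = \<eta> y *\<^sub>R F t y"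
    "\<And>t y. t \<in> {0..T} \<Longrightarrow> y \<in> W \<Longrightarrow> Df t y = DF t y"
    "\<And>y. 0 \<le> \<eta> y" "\<And>y. \<eta> y \<le> 1" "\<And>y. y \<in> W \<Longrightarrow> \<eta> y = 1"
    "open W" "K \<subseteq> W" "W \<subseteq> S" "compact S" "S \<subseteq> D" "\<And>t y. y \<notin> S \<Longrightarrow> f t y = 0"
    by (rule exists_cutoff_field[OF open_D F_cont * DF_cont assms]) blast+
  have DfF: "blinfun_apply (Df t y) = F' t y" if "t \<in> {0..T}" "y \<in> W" for t y
    using that f(3)[OF that] DF_apply[of t y] f(9,11) by auto
  show thesis by (rule that[OF f(1,2) DfF f(4-12)])
qed

end

section \<open>Characteristics issuing from the surface\<close>

lemma (in lipschitz_field) solutions_agree: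
  assumes x: "continuous_on {a..b} x" "\<And>t. a < t \<Longrightarrow> t < b \<Longrightarrow> (x has_vector_derivative f t (x t)) (at t)"
    and y: "continuous_on {a..b} y" "\<And>t. a < t \<Longrightarrow> t < b \<Longrightarrow> (y has_vector_derivative f t (y t)) (at t)"
    and c: "c \<in> {a..b}" "x c = y c" and t: "t \<in> {a..b}"
  shows "x t = y t"
proof -
  let ?z = "\<lambda>t. x t - y t"
  have z: "(?z has_vector_derivative f t (x t) - f t (y t)) (at t)" if "a < t" "t < b" for t
    by (intro has_vector_derivative_diff x y that)
  have zc: "continuous_on {a..b} ?z" by (intro continuous_on_diff x y)
  have bnd: "norm (f t (x t) - f t (y t)) \<le> L * norm (?z t)" for t using f_lipschitz by simp
  have "?z t = 0"
    by (rule gronwall_zero[OF zc z _ L_nonneg c(1) _ t]) (use bnd c(2) in auto)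
  then show ?thesis by simp
qed

lemma (in lipschitz_field) flw_inject:
  assumes "flw t x = flw t y" shows "x = y"
proof -
  have "flw 0 x = flw 0 y"
    by (rule solutions_agree[OF continuous_on_flw_time flw_derivative continuous_on_flw_time flw_derivative,
        where c=t and a="- \<bar>t\<bar>" and b="\<bar>t\<bar>"]) (use assms in auto)
  then show ?thesis by simp
qed

text \<open>A point outside \<open>S\<close> is an equilibrium at all times, so a trajectory that
  ever reaches it has always been there.\<close>

lemma (in lipschitz_field) flw_stays_in_support:
  assumes S: "\<And>t y. y \<notin> S \<Longrightarrow> f t y = 0" and y: "y \<in> S"
  shows "flw t y \<in> S"
proof (rule ccontr)
  assume n: "flw t y \<notin> S"
  have "((\<lambda>s. flw t y) has_vector_derivative f s (flw t y)) (at s)" for s using S[OF n] by simp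
  from flw_unique[OF this, of t] have "flw t (flw t y) = flw t y" by simp
  then have "flw t y = y" by (rule flw_inject)
  then show False using n y by simp
qed

lemma compact_Collect_le_Icc:
  fixes g m :: "real \<Rightarrow> real"
  assumes "continuous_on {a..b} g" "continuous_on {a..b} m"
  shows "compact {r \<in> {a..b}. g r \<le> m r}"
proof -
  have "closed ({a..b} \<inter> (\<lambda>r. g r - m r) -` {..0})"
    by (intro continuous_closed_preimage continuous_on_diff assms closed_atMost closed_real_atLeastAtMost)
  moreover have "{r \<in> {a..b}. g r \<le> m r} = {a..b} \<inter> ({a..b} \<inter> (\<lambda>r. g r - m r) -` {..0})" by auto
  ultimately show ?thesis by (metis compact_Icc compact_Int_closed)
qed

text \<open>The contingent cone offers good steps of some small lengths only, and a distance
  function need not be differentiable, so the growth condition asks for a single step from each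
  time. The comparison holds on a closed set of times; from its last element the step leads to a
  later one.\<close>

lemma dini_gronwall:
  fixes g :: "real \<Rightarrow> real"
  assumes S: "0 \<le> S" and cont: "continuous_on {0..S} g" and nonneg: "\<And>r. 0 \<le> g r" and L: "0 \<le> L"
    and dini: "\<And>r e. 0 \<le> r \<Longrightarrow> r < S \<Longrightarrow> 0 < e \<Longrightarrow> \<exists>h>0. r + h \<le> S \<and> g (r + h) \<le> g r + h * (L * g r + e)"
  shows "g S \<le> g 0 * exp (L * S)"
proof -
  have main: "g S \<le> (g 0 + e * S) * exp (L * S)" if e: "e > 0" for e
  proof (rule ccontr)
    assume n: "\<not> ?thesis"
    \<comment> \<open>Satisfies \<open>m (r + h) \<ge> m r (1 + L h) + h e\<close>, so one
      admissible step preserves \<open>g \<le> m\<close>.\<close>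
    define m where "m r = (g 0 + e * r) * exp (L * r)" for r
    define A where "A = {r \<in> {0..S}. g r \<le> m r}"
    have "compact A" unfolding A_def m_def
      by (intro compact_Collect_le_Icc cont) (intro continuous_intros)
    moreover have "0 \<in> A" using S by (simp add: A_def m_def)
    ultimately obtain r where r: "r \<in> A" "\<And>s. s \<in> A \<Longrightarrow> s \<le> r"
      using compact_attains_sup[of A] by blast
    have "S \<notin> A" using n by (simp add: A_def m_def)
    then have rS: "0 \<le> r" "r < S" using r by (auto simp: A_def less_le)
    obtain h where h: "h > 0" "r + h \<le> S" "g (r + h) \<le> g r + h * (L * g r + e)"
      using dini[OF rS e] by blast
    have "g r + h * (L * g r + e) = g r * (1 + L * h) + h * e" by (simp add: algebra_simps)
    also have "\<dots> \<le> m r * (1 + L * h) + h * e"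
      using r(1) L h by (intro add_right_mono mult_right_mono) (auto simp: A_def)
    also have "\<dots> \<le> m r * exp (L * h) + h * e * exp (L * (r + h))"
    proof (intro add_mono mult_left_mono)
      show "0 \<le> m r" using nonneg[of 0] e rS by (simp add: m_def)
      show "1 + L * h \<le> exp (L * h)" by (simp add: exp_ge_add_one_self)
      show "h * e \<le> h * e * exp (L * (r + h))"
        using mult_left_mono[of 1 "exp (L * (r + h))" "h * e"] h e rS L by simp
    qed
    also have "\<dots> = m (r + h)" by (simp add: m_def algebra_simps exp_add)
    finally have "r + h \<in> A" using h rS by (simp add: A_def)
    then show False using r(2) h by force
  qed
  have "((\<lambda>e. (g 0 + e * S) * exp (L * S)) \<longlongrightarrow> (g 0 + 0 * S) * exp (L * S)) (at_right 0)"
    by (intro tendsto_intros)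
  moreover have "\<forall>\<^sub>F e in at_right (0::real). g S \<le> (g 0 + e * S) * exp (L * S)"
    using main by (auto simp: eventually_at_filter)
  ultimately show ?thesis
    using tendsto_lowerbound[OF _ _ trivial_limit_at_right_real] by fastforce
qed

text \<open>After the last time at which \<open>g \<le> c\<close> the function is above
  \<open>c\<close>, hence nonincreasing by assumption, and cannot have risen. The sign condition
  need not be strict.\<close>

lemma upper_barrier:
  fixes g :: "real \<Rightarrow> real"
  assumes ab: "a \<le> b" and cont: "continuous_on {a..b} g"
    and der: "\<And>t. a < t \<Longrightarrow> t < b \<Longrightarrow> (g has_real_derivative g' t) (at t)"
    and neg: "\<And>t. a < t \<Longrightarrow> t < b \<Longrightarrow> g t > c \<Longrightarrow> g' t \<le> 0"
    and init: "g a \<le> c"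
  shows "g b \<le> c"
proof (rule ccontr)
  assume n: "\<not> g b \<le> c"
  define A where "A = {r \<in> {a..b}. g r \<le> c}"
  have "compact A" unfolding A_def
    by (intro compact_Collect_le_Icc cont continuous_on_const)
  moreover have "a \<in> A" using ab init by (simp add: A_def)
  ultimately obtain r where r: "r \<in> A" "\<And>s. s \<in> A \<Longrightarrow> s \<le> r"
    using compact_attains_sup[of A] by blast
  have "g r \<ge> g b"
  proof (rule DERIV_nonpos_imp_decreasing_open[where f=g])
    show "r \<le> b" using r by (simp add: A_def)
    show "continuous_on {r..b} g" using r by (intro continuous_on_subset[OF cont]) (auto simp: A_def)
    fix t assume t: "r < t" "t < b"
    then have "t \<notin> A" using r(2)[of t] by auto
    then have "g t > c" using t r by (auto simp: A_def)
    then show "\<exists>y. (g has_real_derivative y) (at t) \<and> y \<le> 0"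
      using der[of t] neg[of t] t r by (auto simp: A_def)
  qed
  then show False using r n by (simp add: A_def)
qed

text \<open>A vanishing lower limit provides arbitrarily small steps with error below
  \<open>e h\<close>, but says nothing about all small steps.\<close>

lemma contingent_coneD:
  assumes "z \<in> contingent_cone K y" "0 < e" "0 < d"
  shows "\<exists>h>0. h < d \<and> infdist (y + h *\<^sub>R z) K < e * h"
proof (rule ccontr)
  assume n: "\<not> ?thesis"
  have n': "e * h \<le> infdist (y + h *\<^sub>R z) K" if "0 < h" "h < d" for h
    using n that not_le by blast
  have "\<forall>\<^sub>F h in at_right 0. ereal e \<le> ereal (infdist (y + h *\<^sub>R z) K / h)"
    unfolding eventually_at_right_field
    using n' assms(3) by (intro exI[of _ d]) (auto simp: pos_le_divide_eq)
  then have "ereal e \<le> Liminf (at_right 0) (\<lambda>h. ereal (infdist (y + h *\<^sub>R z) K / h))"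
    by (rule Liminf_bounded)
  then show False using assms by (simp add: contingent_cone_def)
qed

section \<open>Velocity fields tangential to the boundary\<close>

locale velocity_problem = transport_problem +
  assumes bounded_\<Omega>: "bounded \<Omega>"
    and v_cont_closure: "continuous_on ({0..} \<times> closure \<Omega>) (\<lambda>(t, x). v t x)"
    and v_loc_lipschitz: "locally_Lipschitz_in_space (closure \<Omega>) v"
    and v_tangential: "velocity_tangential \<Omega> v"
begin

text \<open>Segments between points of the closure may leave it, so local constants cannot be
  chained along them. If no constant worked, pairs with quotient above \<open>n\<close> would have
  distance at most \<open>2 B / n\<close>, since \<open>v\<close> is bounded by \<open>B\<close>; a
  subsequence would converge to a single point, against the local condition there.\<close>

lemma v_lipschitz_closure:
  obtains L where "0 \<le> L"
    "\<And>t x y. t \<in> {0..T} \<Longrightarrow> x \<in> closure \<Omega> \<Longrightarrow> y \<in> closure \<Omega> \<Longrightarrow> norm (v t x - v t y) \<le> L * norm (x - y)"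
proof -
  have "\<exists>n::nat. \<forall>t x y. t \<in> {0..T} \<longrightarrow> x \<in> closure \<Omega> \<longrightarrow> y \<in> closure \<Omega> \<longrightarrow> norm (v t x - v t y) \<le> real n * norm (x - y)"
  proof (rule ccontr)
    assume "\<not> ?thesis"
    then have "\<forall>n::nat. \<exists>t x y. t \<in> {0..T} \<and> x \<in> closure \<Omega> \<and> y \<in> closure \<Omega> \<and> norm (v t x - v t y) > real n * norm (x - y)"
      by (simp add: not_le)
    then obtain t x y where txy: "\<And>n. t n \<in> {0..T}" "\<And>n. x n \<in> closure \<Omega>" "\<And>n. y n \<in> closure \<Omega>"
      "\<And>n. norm (v (t n) (x n) - v (t n) (y n)) > real n * norm (x n - y n)" by metis
    have c\<Omega>: "compact (closure \<Omega>)" using bounded_\<Omega> by simp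
    have cc: "compact ({0..T} \<times> (closure \<Omega> \<times> closure \<Omega>))"
      by (intro compact_Times compact_Icc c\<Omega>)
    have mem: "\<forall>n. (\<lambda>n. (t n, x n, y n)) n \<in> {0..T} \<times> (closure \<Omega> \<times> closure \<Omega>)"
      using txy by simp
    obtain l r where l: "l \<in> {0..T} \<times> (closure \<Omega> \<times> closure \<Omega>)" and r: "strict_mono r"
      and lim: "((\<lambda>n. (t n, x n, y n)) \<circ> r) \<longlonglongrightarrow> l"
      using cc[unfolded compact_def, THEN spec, THEN mp, OF mem] by blast
    obtain t0 x0 y0 where l_eq: "l = (t0, x0, y0)" by (metis prod.collapse)
    have lims: "(\<lambda>n. t (r n)) \<longlonglongrightarrow> t0" "(\<lambda>n. x (r n)) \<longlonglongrightarrow> x0" "(\<lambda>n. y (r n)) \<longlonglongrightarrow> y0"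
      using tendsto_fst[OF lim] tendsto_fst[OF tendsto_snd[OF lim]] tendsto_snd[OF tendsto_snd[OF lim]]
      by (simp_all add: l_eq o_def)
    have "bounded ((\<lambda>z. v (fst z) (snd z)) ` ({0..T} \<times> closure \<Omega>))"
      by (intro compact_imp_bounded compact_continuous_image continuous_on_subset[OF v_cont_closure[unfolded case_prod_unfold]]
          compact_Times compact_Icc c\<Omega>) auto
    then obtain B where B0: "\<And>z. z \<in> {0..T} \<times> closure \<Omega> \<Longrightarrow> norm (v (fst z) (snd z)) \<le> B"
      unfolding bounded_iff by blast
    have B: "norm (v s z) \<le> B" if "s \<in> {0..T}" "z \<in> closure \<Omega>" for s z
      using B0[of "(s, z)"] that by simp
    have small: "norm (x n - y n) \<le> 2 * B * inverse (real n)" if "n > 0" for n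
    proof -
      have "real n * norm (x n - y n) \<le> norm (v (t n) (x n) - v (t n) (y n))" using txy(4)[of n] by simp
      also have "\<dots> \<le> B + B"
        by (rule order_trans[OF norm_triangle_ineq4 add_mono[OF B[OF txy(1,2)] B[OF txy(1,3)]]])
      finally show ?thesis using that by (simp add: field_simps)
    qed
    have "(\<lambda>n. x (r n) - y (r n)) \<longlonglongrightarrow> 0"
    proof (rule Lim_null_comparison)
      show "\<forall>\<^sub>F n in sequentially. norm (x (r n) - y (r n)) \<le> 2 * B * inverse (real (r n))"
        using eventually_gt_at_top[of 0] by eventually_elim
          (use small r in \<open>metis seq_suble less_le_trans\<close>)
      have "(\<lambda>n. 2 * B * inverse (real (r n))) \<longlonglongrightarrow> 2 * B * 0"
        using LIMSEQ_subseq_LIMSEQ[OF lim_inverse_n r] by (intro tendsto_intros) (simp add: o_def)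
      then show "(\<lambda>n. 2 * B * inverse (real (r n))) \<longlonglongrightarrow> 0" by simp
    qed
    from LIMSEQ_unique[OF tendsto_diff[OF lims(2,3)] this] have "x0 = y0" by simp
    obtain d L where d: "d > 0" and dL: "\<And>s a b. s \<ge> 0 \<Longrightarrow> \<bar>s - t0\<bar> < d \<Longrightarrow> a \<in> closure \<Omega> \<inter> cball x0 d
        \<Longrightarrow> b \<in> closure \<Omega> \<inter> cball x0 d \<Longrightarrow> norm (v s a - v s b) \<le> L * norm (a - b)"
      using v_loc_lipschitz l unfolding locally_Lipschitz_in_space_def l_eq
      by (metis atLeastAtMost_iff mem_Sigma_iff)
    have "\<forall>\<^sub>F n in sequentially. r n \<ge> nat \<lceil>L\<rceil>"
      using filterlim_subseq[OF r] unfolding filterlim_at_top by blast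
    then have "\<forall>\<^sub>F n in sequentially. dist (t (r n)) t0 < d \<and> dist (x (r n)) x0 < d \<and> dist (y (r n)) y0 < d \<and> r n \<ge> nat \<lceil>L\<rceil>"
      using lims d by (intro eventually_conj tendstoD)
    then obtain n where n: "dist (t (r n)) t0 < d" "dist (x (r n)) x0 < d" "dist (y (r n)) x0 < d" "r n \<ge> nat \<lceil>L\<rceil>"
      unfolding \<open>x0 = y0\<close> eventually_sequentially by blast
    have "norm (v (t (r n)) (x (r n)) - v (t (r n)) (y (r n))) \<le> L * norm (x (r n) - y (r n))"
      by (rule dL) (use txy n in \<open>auto simp: dist_commute dist_real_def\<close>)
    also have "\<dots> \<le> real (r n) * norm (x (r n) - y (r n))"
      using n(4) by (intro mult_right_mono) (linarith, simp)
    finally show False using txy(4)[of "r n"] by simp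
  qed
  then show thesis using that by (metis of_nat_0_le_iff)
qed

text \<open>Going backwards in time from \<open>x s\<close> with nearest boundary point \<open>y\<close>, the field at \<open>y\<close> stays near the
  boundary to first order, so the distance grows at most at the Lipschitz rate.\<close>

lemma boundary_distance:
  assumes L: "0 \<le> L" "\<And>t x y. t \<in> {0..T} \<Longrightarrow> x \<in> closure \<Omega> \<Longrightarrow> y \<in> closure \<Omega> \<Longrightarrow> norm (v t x - v t y) \<le> L * norm (x - y)"
    and ne: "frontier \<Omega> \<noteq> {}"
    and x: "\<And>s. s \<in> {0..T} \<Longrightarrow> (x has_vector_derivative \<rho> s *\<^sub>R v s (x s)) (at s)"
    and x_in: "\<And>s. s \<in> {0..T} \<Longrightarrow> x s \<in> closure \<Omega>"
    and \<rho>: "\<And>s. 0 \<le> \<rho> s" "\<And>s. \<rho> s \<le> 1" and S: "S \<in> {0..T}"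
  shows "infdist (x 0) (frontier \<Omega>) \<le> infdist (x S) (frontier \<Omega>) * exp (L * S)"
proof -
  let ?d = "\<lambda>z. infdist z (frontier \<Omega>)"
  have xc: "continuous_on {0..T} x"
    by (rule continuous_on_vector_derivative, rule has_vector_derivative_at_within, rule x)
  have "?d (x (S - S)) \<le> ?d (x (S - 0)) * exp (L * S)"
  proof (rule dini_gronwall[where g="\<lambda>r. ?d (x (S - r))"])
    show "continuous_on {0..S} (\<lambda>r. ?d (x (S - r)))"
      by (intro continuous_intros continuous_on_compose2[OF xc]) (use S in auto)
    fix r e :: real assume r: "0 \<le> r" "r < S" and e: "0 < e"
    define s where "s = S - r"
    have s: "s \<in> {0..T}" "s > 0" using r S by (auto simp: s_def)
    obtain y where y: "y \<in> frontier \<Omega>" "?d (x s) = dist (x s) y"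
      using infdist_attains_inf[OF frontier_closed ne] by blast
    have e2: "e / 2 > 0" using e by simp
    have "(x has_derivative (\<lambda>h. h *\<^sub>R (\<rho> s *\<^sub>R v s (x s)))) (at s)"
      using x[OF s(1)] by (simp add: has_vector_derivative_def)
    then obtain d where d: "d > 0" and
      dd: "\<And>s'. norm (s' - s) < d \<Longrightarrow> norm (x s' - x s - (s' - s) *\<^sub>R (\<rho> s *\<^sub>R v s (x s))) \<le> e / 2 * norm (s' - s)"
      unfolding has_derivative_at_alt using e2 by blast
    \<comment> \<open>The cone condition is used at \<open>y\<close> for \<open>- v\<close>, as time
      runs backwards. It supplies a displacement parameter \<open>k\<close>, and
      \<open>h = k / \<rho> s\<close> is the corresponding time step for the slowed field;
      \<open>k \<le> h\<close> because the factor is at most 1. If the factor is 0, the point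
      \<open>y\<close> does not move and any small \<open>h\<close> will do.\<close>
    have "\<exists>h>0. h < min d s \<and> ?d (y - (h * \<rho> s) *\<^sub>R v s y) \<le> e / 2 * h"
    proof (cases "\<rho> s = 0")
      case True
      then show ?thesis using d s(2) y(1) e
        by (intro exI[of _ "min d s / 2"]) (auto simp: min_def)
    next
      case False
      then have \<rho>s: "\<rho> s > 0" using \<rho>(1)[of s] by linarith
      have "- v s y \<in> contingent_cone (frontier \<Omega>) y"
        using v_tangential s(2) y(1) by (simp add: velocity_tangential_def)
      then obtain k where k: "k > 0" "k < d * \<rho> s" "k < s * \<rho> s" "?d (y + k *\<^sub>R - v s y) < e / 2 * k"
        using contingent_coneD[of "- v s y" "frontier \<Omega>" y "e / 2" "min d s * \<rho> s"] e2 d s(2) \<rho>s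
        by (auto simp: min_mult_distrib_right)
      have "k \<le> k / \<rho> s" using \<rho>(2)[of s] \<rho>s k(1) by (simp add: pos_le_divide_eq mult_left_le)
      then have "e / 2 * k \<le> e / 2 * (k / \<rho> s)" using e by (intro mult_left_mono) auto
      moreover have "k / \<rho> s < min d s" using k(2,3) \<rho>s by (simp add: pos_divide_less_eq)
      ultimately show ?thesis using k \<rho>s by (intro exI[of _ "k / \<rho> s"]) auto
    qed
    then obtain h where h: "h > 0" "h < d" "h < s" and hy: "?d (y - (h * \<rho> s) *\<^sub>R v s y) \<le> e / 2 * h"
      by auto
    have "norm (x (s - h) - (y - (h * \<rho> s) *\<^sub>R v s y)) \<le> norm (x (s - h) - x s - (s - h - s) *\<^sub>R (\<rho> s *\<^sub>R v s (x s)))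
        + (norm (x s - y) + norm ((h * \<rho> s) *\<^sub>R (v s (x s) - v s y)))"
    proof -
      have "x (s - h) - (y - (h * \<rho> s) *\<^sub>R v s y) = (x (s - h) - x s - (s - h - s) *\<^sub>R (\<rho> s *\<^sub>R v s (x s)))
        + ((x s - y) - (h * \<rho> s) *\<^sub>R (v s (x s) - v s y))" by (simp add: algebra_simps)
      then show ?thesis
        by (simp only:) (rule order_trans[OF norm_triangle_ineq add_left_mono[OF norm_triangle_ineq4]])
    qed
    also have "\<dots> \<le> e / 2 * h + (?d (x s) + h * (L * ?d (x s)))"
    proof (intro add_mono)
      show "norm (x (s - h) - x s - (s - h - s) *\<^sub>R (\<rho> s *\<^sub>R v s (x s))) \<le> e / 2 * h"
        using dd[of "s - h"] h by simp
      show "norm (x s - y) \<le> ?d (x s)" using y by (simp add: dist_norm)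
      have "norm ((h * \<rho> s) *\<^sub>R (v s (x s) - v s y)) = (h * \<rho> s) * norm (v s (x s) - v s y)"
        using h \<rho> by simp
      also have "\<dots> \<le> (h * 1) * (L * norm (x s - y))"
        using h \<rho> L(2)[OF s(1) x_in[OF s(1)], of y] y(1)
        by (intro mult_mono) (auto simp: frontier_def)
      finally show "norm ((h * \<rho> s) *\<^sub>R (v s (x s) - v s y)) \<le> h * (L * ?d (x s))"
        using y by (simp add: dist_norm)
    qed
    finally have "dist (x (s - h)) (y - (h * \<rho> s) *\<^sub>R v s y) \<le> e / 2 * h + (?d (x s) + h * (L * ?d (x s)))"
      by (simp add: dist_norm)
    then have "?d (x (s - h)) \<le> ?d (x s) + h * (L * ?d (x s) + e)"
      using infdist_triangle[of "x (s - h)" "frontier \<Omega>" "y - (h * \<rho> s) *\<^sub>R v s y"] hy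
      by (simp add: algebra_simps)
    then show "\<exists>h>0. r + h \<le> S \<and> ?d (x (S - (r + h))) \<le> ?d (x (S - r)) + h * (L * ?d (x (S - r)) + e)"
      using h by (intro exI[of _ h]) (auto simp: s_def algebra_simps)
  qed (use S L in \<open>auto simp: infdist_nonneg\<close>)
  then show ?thesis by simp
qed

end

text \<open>The gradient \<open>g0\<close> and the Hessian \<open>H0\<close> are parameters pinned
  down by derivative assumptions; in this way the description operator in \<open>grad\<close> stays
  out of the argument until the end.\<close>

locale level_set_problem = velocity_problem +
  fixes \<phi>0 :: "real^3 \<Rightarrow> real" and g0 :: "real^3 \<Rightarrow> real^3" and H0 :: "real^3 \<Rightarrow> (real^3) \<Rightarrow>\<^sub>L (real^3)"
    and S0 :: "(real^3) set" and \<alpha> :: real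
  assumes compact_S0: "compact S0" and S0_sub: "S0 \<subseteq> \<Omega>"
    and S0_eq: "{x \<in> \<Omega>. \<phi>0 x = 0} = S0"
    and \<phi>0_derivative: "\<And>x. x \<in> \<Omega> \<Longrightarrow> (\<phi>0 has_derivative (\<lambda>h. h \<bullet> g0 x)) (at x)"
    and g0_derivative: "\<And>x. x \<in> \<Omega> \<Longrightarrow> (g0 has_derivative blinfun_apply (H0 x)) (at x)"
    and H0_cont: "continuous_on \<Omega> H0"
    and \<alpha>_pos: "0 < \<alpha>" and \<alpha>_less_\<beta>: "\<alpha> < \<beta>"
    and Dv_bound: "\<And>t x p. 0 \<le> t \<Longrightarrow> x \<in> \<Omega> \<Longrightarrow> \<bar>Dv t x p \<bullet> p\<bar> \<le> \<alpha> * (norm p)\<^sup>2"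
    and g0_bounds: "\<And>x. x \<in> S0 \<Longrightarrow> \<beta> - \<alpha> \<le> norm (g0 x) \<and> norm (g0 x) \<le> \<beta> + \<alpha>"
begin

definition \<iota> :: "real^3 \<Rightarrow> char_state" where
  "\<iota> \<xi> = (\<xi>, g0 \<xi>, \<phi>0 \<xi>)"

text \<open>\<open>C\<close> will be the growth factor \<open>exp (Lv * T)\<close> of
  \<open>boundary_distance\<close>; dividing it out leaves the distance \<open>c\<close> at every
  time up to \<open>T\<close>. The divisor \<open>C + 1\<close> in the witness also covers
  \<open>C = 0\<close>.\<close>

lemma boundary_gap:
  assumes "0 \<le> C"
  obtains c where "0 < c" "\<And>\<xi>. \<xi> \<in> S0 \<Longrightarrow> frontier \<Omega> \<noteq> {} \<and> c * C \<le> infdist \<xi> (frontier \<Omega>)"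
proof (cases "S0 = {}")
  case False
  then have "frontier \<Omega> \<noteq> {}"
    using S0_sub bounded_\<Omega> by (auto simp: frontier_eq_empty not_bounded_UNIV)
  have cont: "continuous_on S0 (\<lambda>\<xi>. infdist \<xi> (frontier \<Omega>))" by (intro continuous_intros)
  obtain \<xi>0 where \<xi>0: "\<xi>0 \<in> S0" "\<And>\<xi>. \<xi> \<in> S0 \<Longrightarrow> infdist \<xi>0 (frontier \<Omega>) \<le> infdist \<xi> (frontier \<Omega>)"
    using continuous_attains_inf[OF compact_S0 False cont] by blast
  have "\<xi>0 \<notin> frontier \<Omega>"
    using \<xi>0 S0_sub frontier_disjoint_eq[of \<Omega>] open_\<Omega> by blast
  then have pos: "infdist \<xi>0 (frontier \<Omega>) > 0"
    using \<open>frontier \<Omega> \<noteq> {}\<close> by (intro infdist_pos_not_in_closed frontier_closed)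
  let ?c = "infdist \<xi>0 (frontier \<Omega>) / (C + 1)"
  have "?c * C \<le> infdist \<xi>0 (frontier \<Omega>) * 1"
    using assms pos by (simp add: field_simps)
  then show thesis
    using pos \<xi>0(2) \<open>frontier \<Omega> \<noteq> {}\<close> assms by (intro that[of ?c]) (auto intro: order_trans)
qed (use that[of 1] in auto)

text \<open>The cutoff multiplies the characteristic field by a factor in \<open>[0, 1]\<close>.  All bounds along trajectories from
  \<open>S0\<close> are insensitive to such a factor, so these never leave the region where the factor is \<open>1\<close>.\<close>

lemma reference_field:
  assumes T: "0 \<le> T"
  obtains f Df L M W where "C1_field f Df L M"
    "\<And>t y. t \<in> {0..T} \<Longrightarrow> y \<in> W \<Longrightarrow> f t y = F t y"
    "\<And>t y. t \<in> {0..T} \<Longrightarrow> y \<in> W \<Longrightarrow> blinfun_apply (Df t y) = F' t y"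
    "open W" "W \<subseteq> D"
    "\<And>\<xi> t. \<xi> \<in> S0 \<Longrightarrow> t \<in> {0..T} \<Longrightarrow> lipschitz_field.flw f t (\<iota> \<xi>) \<in> W"
    "\<And>\<xi> t. \<xi> \<in> S0 \<Longrightarrow> t \<in> {0..T} \<Longrightarrow> snd (snd (lipschitz_field.flw f t (\<iota> \<xi>))) = 0"
    "\<And>\<xi> t. \<xi> \<in> S0 \<Longrightarrow> t \<in> {0..T} \<Longrightarrow> \<beta> - \<alpha> \<le> norm (fst (snd (lipschitz_field.flw f t (\<iota> \<xi>))))"
    "\<And>\<xi> t. \<xi> \<in> S0 \<Longrightarrow> t \<in> {0..T} \<Longrightarrow> norm (fst (snd (lipschitz_field.flw f t (\<iota> \<xi>)))) \<le> \<beta> + \<alpha>"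
proof -
  let ?d = "\<lambda>x. infdist x (frontier \<Omega>)"
  obtain Lv where Lv: "0 \<le> Lv"
    "\<And>t x y. t \<in> {0..T} \<Longrightarrow> x \<in> closure \<Omega> \<Longrightarrow> y \<in> closure \<Omega> \<Longrightarrow> norm (v t x - v t y) \<le> Lv * norm (x - y)"
    using v_lipschitz_closure by blast
  obtain c where c: "c > 0" "\<And>\<xi>. \<xi> \<in> S0 \<Longrightarrow> frontier \<Omega> \<noteq> {} \<and> c * exp (Lv * T) \<le> ?d \<xi>"
    using boundary_gap[of "exp (Lv * T)"] by auto
  \<comment> \<open>The region to which the estimates below confine the trajectories from
    \<open>S0\<close>. It is compact and avoids both the boundary of \<Omega> and
    \<open>p = 0\<close>, where the system breaks down.\<close>
  define K where "K = {x \<in> closure \<Omega>. c \<le> ?d x} \<times> {p :: real^3. \<beta> - \<alpha> \<le> norm p \<and> norm p \<le> \<beta> + \<alpha>} \<times> {0::real}"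
  have c\<Omega>: "compact (closure \<Omega>)" using bounded_\<Omega> by simp
  have "compact K"
  proof -
    have "closed {x. c \<le> ?d x}" by (intro closed_Collect_le continuous_intros)
    from compact_Int_closed[OF c\<Omega> this] have 1: "compact {x \<in> closure \<Omega>. c \<le> ?d x}"
      by (simp add: Collect_conj_eq)
    have "closed {p :: real^3. \<beta> - \<alpha> \<le> norm p}" by (intro closed_Collect_le continuous_intros)
    from compact_Int_closed[OF compact_cball[of "0::real^3" "\<beta> + \<alpha>"] this]
    have 2: "compact {p :: real^3. \<beta> - \<alpha> \<le> norm p \<and> norm p \<le> \<beta> + \<alpha>}"
      by (rule back_subst[where P=compact]) auto
    show ?thesis unfolding K_def by (intro compact_Times 1 2) auto
  qed
  have far: "x \<in> \<Omega>" if "x \<in> closure \<Omega>" "c \<le> ?d x" for x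
  proof (rule ccontr)
    assume "x \<notin> \<Omega>"
    then have "x \<in> frontier \<Omega>" using that(1) open_\<Omega> by (simp add: frontier_def interior_open)
    then show False using infdist_zero that(2) c(1) by fastforce
  qed
  have "K \<subseteq> D" using far \<alpha>_less_\<beta> by (auto simp: K_def D_def)
  obtain f Df L M \<eta> S W where f: "C1_field f Df L M"
    and fF: "\<And>t y. t \<in> {0..T} \<Longrightarrow> y \<in> D \<Longrightarrow> f t y = \<eta> y *\<^sub>R F t y"
    and DfF: "\<And>t y. t \<in> {0..T} \<Longrightarrow> y \<in> W \<Longrightarrow> blinfun_apply (Df t y) = F' t y"
    and \<eta>: "\<And>y. 0 \<le> \<eta> y" "\<And>y. \<eta> y \<le> 1" "\<And>y. y \<in> W \<Longrightarrow> \<eta> y = 1"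
    and W: "open W" "K \<subseteq> W" "W \<subseteq> S" and S: "compact S" "S \<subseteq> D" "\<And>t y. y \<notin> S \<Longrightarrow> f t y = 0"
    by (rule cutoff_field[OF \<open>compact K\<close> \<open>K \<subseteq> D\<close> T]) blast+
  interpret C1_field f Df L M by (rule f)
  have main: "flw t (\<iota> \<xi>) \<in> K" if \<xi>: "\<xi> \<in> S0" and t: "t \<in> {0..T}" for \<xi> t
  proof -
    define x where "x s = fst (flw s (\<iota> \<xi>))" for s
    define p where "p s = fst (snd (flw s (\<iota> \<xi>)))" for s
    define u where "u s = snd (snd (flw s (\<iota> \<xi>)))" for s
    define \<rho> where "\<rho> s = \<eta> (flw s (\<iota> \<xi>))" for s
    have \<rho>: "0 \<le> \<rho> s" "\<rho> s \<le> 1" for s using \<eta> by (simp_all add: \<rho>_def)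
    have init: "x 0 = \<xi>" "p 0 = g0 \<xi>" "u 0 = 0"
      using \<xi> S0_eq by (auto simp: x_def p_def u_def \<iota>_def)
    have "\<xi> \<in> \<Omega>" using \<xi> S0_sub by blast
    then have "\<xi> \<in> closure \<Omega>" using closure_subset by blast
    moreover have "c \<le> c * exp (Lv * T)" using c(1) Lv(1) T by simp
    ultimately have "\<iota> \<xi> \<in> K" using c(2)[OF \<xi>] g0_bounds[OF \<xi>] init \<xi> S0_eq
      by (auto simp: K_def \<iota>_def)
    then have "\<iota> \<xi> \<in> S" using W by blast
    \<comment> \<open>Before any bound is available, the support of the cutoff already keeps the
      curve in the domain of \<open>F\<close>, so the component equations below are
      legitimate.\<close>
    then have "flw s (\<iota> \<xi>) \<in> S" for s using flw_stays_in_support[of S] S(3) by blast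
    then have inD: "flw s (\<iota> \<xi>) \<in> D" for s using S by blast
    have x\<Omega>: "x s \<in> \<Omega>" and p0: "p s \<noteq> 0" for s
      using inD[of s] by (auto simp: D_def x_def p_def)
    have y': "((\<lambda>s. flw s (\<iota> \<xi>)) has_vector_derivative \<rho> s *\<^sub>R F s (flw s (\<iota> \<xi>))) (at s)" if "s \<in> {0..T}" for s
      using flw_derivative[of "\<iota> \<xi>" s] fF[OF that inD] by (simp add: \<rho>_def)
    have x': "(x has_vector_derivative \<rho> s *\<^sub>R (v s (x s) + (u s / norm (p s)) *\<^sub>R p s)) (at s)"
      and p': "(p has_vector_derivative \<rho> s *\<^sub>R ((\<beta> - norm (p s)) *\<^sub>R p s - Dv_adj s (x s) (p s))) (at s)"
      and u': "(u has_vector_derivative \<rho> s *\<^sub>R (\<beta> * u s)) (at s)" if "s \<in> {0..T}" for s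
      using bounded_linear.has_vector_derivative[OF bounded_linear_fst y'[OF that]]
        bounded_linear.has_vector_derivative[OF bounded_linear_compose[OF bounded_linear_fst bounded_linear_snd] y'[OF that]]
        bounded_linear.has_vector_derivative[OF bounded_linear_compose[OF bounded_linear_snd bounded_linear_snd] y'[OF that]]
      by (simp_all add: F_def Let_def x_def[abs_def] p_def[abs_def] u_def[abs_def])
    have cont: "continuous_on {0..T} x" "continuous_on {0..T} p" "continuous_on {0..T} u"
      by (rule continuous_on_vector_derivative[OF has_vector_derivative_at_within[OF x']]
          continuous_on_vector_derivative[OF has_vector_derivative_at_within[OF p']]
          continuous_on_vector_derivative[OF has_vector_derivative_at_within[OF u']]; assumption)+
    have u0: "u s = 0" if s: "s \<in> {0..T}" for s
    proof -
      have "norm (u s) \<le> (norm (u 0) + 0 * (s - 0)) * exp (\<bar>\<beta>\<bar> * (s - 0))"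
      proof (rule gronwall)
        show "continuous_on {0..s} u" by (rule continuous_on_subset[OF cont(3)]) (use s in auto)
        show "(u has_vector_derivative \<rho> r *\<^sub>R (\<beta> * u r)) (at r)" if "0 < r" "r < s" for r
          by (rule u') (use that s in auto)
        show "norm (\<rho> r *\<^sub>R (\<beta> * u r)) \<le> \<bar>\<beta>\<bar> * norm (u r) + 0" for r
          using mult_right_mono[OF \<rho>(2)[of r], of "\<bar>\<beta>\<bar> * \<bar>u r\<bar>"] \<rho>(1)[of r] by (simp add: abs_mult)
      qed (use s in auto)
      then show ?thesis using init by simp
    qed
    have "?d (x 0) \<le> ?d (x t) * exp (Lv * t)"
    proof (rule boundary_distance[OF Lv, where \<rho>=\<rho>])
      show "frontier \<Omega> \<noteq> {}" using c(2)[OF \<xi>] by simp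
      show "(x has_vector_derivative \<rho> s *\<^sub>R v s (x s)) (at s)" if "s \<in> {0..T}" for s
        using x'[OF that] u0[OF that] by simp
      show "x s \<in> closure \<Omega>" for s using x\<Omega> closure_subset by blast
    qed (use \<rho> t in auto)
    also have "\<dots> \<le> ?d (x t) * exp (Lv * T)"
      using t Lv(1) by (intro mult_left_mono infdist_nonneg) (auto intro: mult_left_mono)
    finally have "c * exp (Lv * T) \<le> ?d (x t) * exp (Lv * T)" using conjunct2[OF c(2)[OF \<xi>]] unfolding init(1) by (rule order_trans[rotated])
    then have dx: "c \<le> ?d (x t)" by simp
    define q where "q s = (norm (p s))\<^sup>2" for s
    define q' where "q' s = 2 * \<rho> s * ((\<beta> - norm (p s)) * (norm (p s))\<^sup>2 - Dv s (x s) (p s) \<bullet> p s)" for s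
    have q: "(q has_real_derivative q' s) (at s)" if "s \<in> {0..T}" for s
    proof -
      let ?P = "\<rho> s *\<^sub>R ((\<beta> - norm (p s)) *\<^sub>R p s - Dv_adj s (x s) (p s))"
      have D: "(p has_derivative (\<lambda>r. r *\<^sub>R ?P)) (at s)"
        using p'[OF that] by (simp add: has_vector_derivative_def)
      have "((\<lambda>s. p s \<bullet> p s) has_derivative (\<lambda>r. p s \<bullet> (r *\<^sub>R ?P) + (r *\<^sub>R ?P) \<bullet> p s)) (at s)"
        by (intro has_derivative_inner D)
      then show ?thesis
        unfolding has_field_derivative_def q_def[abs_def] power2_norm_eq_inner
        by (rule has_derivative_eq_rhs)
          (simp add: q'_def fun_eq_iff inner_diff_right inner_diff_left inner_commute[of "p s" "Dv_adj _ _ _"]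
            Dv_adj_inner power2_norm_eq_inner algebra_simps)
    qed
    have q_cont: "continuous_on {0..t} q"
      unfolding q_def by (intro continuous_intros continuous_on_subset[OF cont(2)]) (use t in auto)
    have \<alpha>\<beta>: "0 < \<beta> - \<alpha>" "0 < \<beta> + \<alpha>" using \<alpha>_pos \<alpha>_less_\<beta> by auto
    have Dvq: "\<bar>Dv s (x s) (p s) \<bullet> p s\<bar> \<le> \<alpha> * (norm (p s))\<^sup>2" if "0 \<le> s" for s
      by (rule Dv_bound[OF that x\<Omega>])
    have "q t \<le> (\<beta> + \<alpha>)\<^sup>2"
    proof (rule upper_barrier[OF _ q_cont q])
      fix s assume s: "0 < s" "s < t" and big: "q s > (\<beta> + \<alpha>)\<^sup>2"
      then have "norm (p s) > \<beta> + \<alpha>" using \<alpha>\<beta> by (auto simp: q_def intro: power2_less_imp_less)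
      then have "(\<beta> + \<alpha> - norm (p s)) * (norm (p s))\<^sup>2 \<le> 0" by (intro mult_nonpos_nonneg) auto
      then have "(\<beta> - norm (p s)) * (norm (p s))\<^sup>2 - Dv s (x s) (p s) \<bullet> p s \<le> 0"
        using Dvq[of s] s by (simp add: algebra_simps)
      then show "q' s \<le> 0" using \<rho>(1)[of s] unfolding q'_def by (intro mult_nonneg_nonpos) auto
    qed (use t init g0_bounds[OF \<xi>] in \<open>auto simp: q_def intro: power_mono\<close>)
    then have up: "norm (p t) \<le> \<beta> + \<alpha>" unfolding q_def by (rule power2_le_imp_le) (use \<alpha>\<beta> in auto)
    have "- q t \<le> - (\<beta> - \<alpha>)\<^sup>2"
    proof (rule upper_barrier[where g="\<lambda>s. - q s" and g'="\<lambda>s. - q' s" and a=0])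
      fix s assume s: "0 < s" "s < t"
      show "((\<lambda>s. - q s) has_real_derivative - q' s) (at s)"
        by (intro DERIV_minus q) (use s t in auto)
      assume "- q s > - (\<beta> - \<alpha>)\<^sup>2"
      then have "norm (p s) < \<beta> - \<alpha>" using \<alpha>\<beta> by (auto simp: q_def intro: power2_less_imp_less)
      then have "0 \<le> (\<beta> - \<alpha> - norm (p s)) * (norm (p s))\<^sup>2" by (intro mult_nonneg_nonneg) auto
      then have "0 \<le> (\<beta> - norm (p s)) * (norm (p s))\<^sup>2 - Dv s (x s) (p s) \<bullet> p s"
        using Dvq[of s] s by (simp add: algebra_simps)
      then show "- q' s \<le> 0" using \<rho>(1)[of s] unfolding q'_def by simp
    next
      show "- q 0 \<le> - (\<beta> - \<alpha>)\<^sup>2" using init g0_bounds[OF \<xi>] \<alpha>\<beta> by (auto simp: q_def intro: power_mono)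
    qed (use t q_cont in \<open>auto intro: continuous_on_minus\<close>)
    then have lo: "\<beta> - \<alpha> \<le> norm (p t)" unfolding q_def neg_le_iff_le by (rule power2_le_imp_le) (use \<alpha>\<beta> in auto)
    have "x t \<in> closure \<Omega>" using x\<Omega> closure_subset by blast
    then have "(x t, p t, u t) \<in> K" using dx up lo u0[OF t] by (simp add: K_def)
    then show ?thesis by (simp add: x_def p_def u_def)
  qed
  show thesis
  proof (rule that[OF f _ DfF W(1)])
    show "f t y = F t y" if "t \<in> {0..T}" "y \<in> W" for t y
      using fF[OF that(1), of y] \<eta>(3)[OF that(2)] that W S by auto
    show "W \<subseteq> D" using W S by blast
    fix \<xi> t assume "\<xi> \<in> S0" "t \<in> {0..T}"
    from main[OF this] show "flw t (\<iota> \<xi>) \<in> W" "snd (snd (flw t (\<iota> \<xi>))) = 0"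
      "\<beta> - \<alpha> \<le> norm (fst (snd (flw t (\<iota> \<xi>))))" "norm (fst (snd (flw t (\<iota> \<xi>)))) \<le> \<beta> + \<alpha>"
      using W(2) by (auto simp: K_def)
  qed
qed

end

text \<open>A tube lemma: an open condition that holds on the surface throughout a compact time
  interval holds on one neighbourhood of the surface for all those times.\<close>

lemma compact_Times_open_neighborhood:
  fixes K :: "'a::metric_space set" and S :: "'b::metric_space set"
  assumes "compact K" "compact S" "open G" "K \<times> S \<subseteq> G"
  obtains U where "open U" "S \<subseteq> U" "K \<times> U \<subseteq> G"
proof -
  obtain e where e: "e > 0" "(\<Union>z\<in>K \<times> S. ball z e) \<subseteq> G"
    using compact_subset_open_imp_ball_epsilon_subset[OF compact_Times[OF assms(1,2)] assms(3,4)] by blast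
  show thesis
  proof (rule that[of "\<Union>x\<in>S. ball x e"])
    show "K \<times> (\<Union>x\<in>S. ball x e) \<subseteq> G"
    proof clarify
      fix t x y assume "t \<in> K" "x \<in> S" "y \<in> ball x e"
      then have "(t, y) \<in> ball (t, x) e" by (simp add: dist_Pair_Pair)
      then show "(t, y) \<in> G" using e(2) \<open>t \<in> K\<close> \<open>x \<in> S\<close> by blast
    qed
  qed (use e(1) in auto)
qed

section \<open>Characteristic curves and their uniqueness\<close>

context transport_problem
begin

text \<open>Membership in \<open>D\<close> belongs to the notion because the characteristic system
  has no meaning where \<open>p = 0\<close> or where \<open>x\<close> is outside \<Omega>.\<close>

definition char_curve :: "real \<Rightarrow> (real \<Rightarrow> char_state) \<Rightarrow> bool" where
  "char_curve T y \<longleftrightarrow> (\<forall>t\<in>{0..T}. y t \<in> D \<and> (y has_vector_derivative F t (y t)) (at t within {0..T}))"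

lemma char_curve_subset: "char_curve T y \<Longrightarrow> T' \<le> T \<Longrightarrow> char_curve T' y"
  unfolding char_curve_def by (auto intro: has_vector_derivative_within_subset[where S="{0..T}"])

lemma char_curve_continuous: "char_curve T y \<Longrightarrow> continuous_on {0..T} y"
  unfolding char_curve_def by (intro continuous_on_vector_derivative) blast

lemma char_curve_interior:
  "char_curve T y \<Longrightarrow> 0 < t \<Longrightarrow> t < T \<Longrightarrow> (y has_vector_derivative F t (y t)) (at t)"
  unfolding char_curve_def by (drule bspec[of _ _ t]) (auto simp: at_within_Icc_at)

text \<open>\<open>F\<close> is only locally Lipschitz. Cutting it off around the compact union of
  the two curves yields one Lipschitz field that both of them solve.\<close>

lemma char_curve_unique:
  assumes y: "char_curve T y" and z: "char_curve T z" and c: "c \<in> {0..T}" "y c = z c" and t: "t \<in> {0..T}"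
  shows "y t = z t"
proof -
  let ?K = "y ` {0..T} \<union> z ` {0..T}"
  have K: "compact ?K" "?K \<subseteq> D"
    using char_curve_continuous[OF y] char_curve_continuous[OF z] y z
    by (auto intro!: compact_Un compact_continuous_image simp: char_curve_def)
  have T: "0 \<le> T" using t by auto
  obtain f Df L M \<eta> S W where f: "C1_field f Df L M"
    and fF: "\<And>t y. t \<in> {0..T} \<Longrightarrow> y \<in> D \<Longrightarrow> f t y = \<eta> y *\<^sub>R F t y"
    and \<eta>: "\<And>y. y \<in> W \<Longrightarrow> \<eta> y = 1" and W: "?K \<subseteq> W"
    by (rule cutoff_field[OF K T]) blast
  interpret C1_field f Df L M by (rule f)
  have eq: "f s a = F s a" if "s \<in> {0..T}" "a \<in> ?K" for s a
  proof -
    have "a \<in> D" "a \<in> W" using that(2) K(2) W by blast+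
    then show ?thesis using fF[OF that(1)] \<eta> by simp
  qed
  show ?thesis
  proof (rule solutions_agree[where a=0 and b=T and c=c])
    fix s assume s: "0 < s" "s < T"
    show "(y has_vector_derivative f s (y s)) (at s)"
      using char_curve_interior[OF y s] eq[of s "y s"] s by auto
    show "(z has_vector_derivative f s (z s)) (at s)"
      using char_curve_interior[OF z s] eq[of s "z s"] s by auto
  qed (rule char_curve_continuous[OF y] char_curve_continuous[OF z] c t)+
qed

end

context level_set_problem
begin

text \<open>\<open>Y t \<xi>\<close> is arbitrary unless \<open>good t \<xi>\<close>.\<close>

definition good :: "real \<Rightarrow> real^3 \<Rightarrow> bool" where
  "good T \<xi> \<longleftrightarrow> (\<exists>y. char_curve T y \<and> y 0 = \<iota> \<xi>)"

definition Y :: "real \<Rightarrow> real^3 \<Rightarrow> char_state" where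
  "Y t \<xi> = (SOME z. \<exists>y. char_curve t y \<and> y 0 = \<iota> \<xi> \<and> z = y t)"

text \<open>Neither the horizon nor a cutoff enters the value, so results obtained for different
  \<open>T\<close> concern the same \<open>Y\<close>.\<close>

lemma Y_eq:
  assumes y: "char_curve T y" "y 0 = \<iota> \<xi>" and t: "t \<in> {0..T}"
  shows "Y t \<xi> = y t"
proof -
  have "char_curve t y" using char_curve_subset[OF y(1)] t by auto
  then have "\<exists>z. \<exists>y. char_curve t y \<and> y 0 = \<iota> \<xi> \<and> z = y t" using y(2) by blast
  from someI_ex[OF this] obtain z where z: "char_curve t z" "z 0 = \<iota> \<xi>" "Y t \<xi> = z t"
    unfolding Y_def by blast
  have "z t = y t"
    by (rule char_curve_unique[OF z(1) \<open>char_curve t y\<close>, of 0]) (use z y t in auto)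
  then show ?thesis using z by simp
qed

lemma Y_char_curve:
  assumes "good T \<xi>" shows "char_curve T (\<lambda>t. Y t \<xi>)"
proof -
  obtain y where y: "char_curve T y" "y 0 = \<iota> \<xi>" using assms by (auto simp: good_def)
  have eq: "\<And>t. t \<in> {0..T} \<Longrightarrow> Y t \<xi> = y t" by (rule Y_eq[OF y])
  show ?thesis
    unfolding char_curve_def
  proof (intro ballI conjI)
    fix t assume t: "t \<in> {0..T}"
    show "Y t \<xi> \<in> D" using y(1) t eq[OF t] by (simp add: char_curve_def)
    have "(y has_vector_derivative F t (Y t \<xi>)) (at t within {0..T})"
      using y(1) t eq[OF t] by (simp add: char_curve_def)
    then show "((\<lambda>t. Y t \<xi>) has_vector_derivative F t (Y t \<xi>)) (at t within {0..T})"
      by (rule has_vector_derivative_transform[OF t, rotated]) (use eq in auto)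
  qed
qed

lemma Y_0: "good T \<xi> \<Longrightarrow> 0 \<le> T \<Longrightarrow> Y 0 \<xi> = \<iota> \<xi>"
  using Y_eq[of T _ \<xi> 0] by (auto simp: good_def)

lemma good_mono: "good T \<xi> \<Longrightarrow> T' \<le> T \<Longrightarrow> good T' \<xi>"
  unfolding good_def using char_curve_subset by blast

lemma \<iota>_cont: "continuous_on \<Omega> \<iota>"
proof -
  have "continuous_on \<Omega> g0" "continuous_on \<Omega> \<phi>0"
    by (rule has_derivative_continuous_on, rule has_derivative_at_withinI, erule g0_derivative \<phi>0_derivative)+
  then show ?thesis unfolding \<iota>_def[abs_def] by (intro continuous_intros)
qed

text \<open>The characteristics from \<open>S0\<close> run in the open set \<open>W\<close> where
  the truncated field equals \<open>F\<close>. By continuity in the initial value and compactness of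
  \<open>{0..T} \<times> S0\<close>, so do those from a whole neighbourhood
  \<open>U\<close>.\<close>

lemma local_flow:
  assumes T: "0 \<le> T"
  obtains f Df L M W U where "C1_field f Df L M"
    "\<And>t y. t \<in> {0..T} \<Longrightarrow> y \<in> W \<Longrightarrow> f t y = F t y"
    "\<And>t y. t \<in> {0..T} \<Longrightarrow> y \<in> W \<Longrightarrow> blinfun_apply (Df t y) = F' t y"
    "open W" "W \<subseteq> D" "open U" "S0 \<subseteq> U" "U \<subseteq> \<Omega>"
    "\<And>\<xi> t. \<xi> \<in> U \<Longrightarrow> t \<in> {0..T} \<Longrightarrow> lipschitz_field.flw f t (\<iota> \<xi>) \<in> W"
    "\<And>\<xi>. \<xi> \<in> U \<Longrightarrow> good T \<xi>"
    "\<And>\<xi> t. \<xi> \<in> U \<Longrightarrow> t \<in> {0..T} \<Longrightarrow> Y t \<xi> = lipschitz_field.flw f t (\<iota> \<xi>)"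
    "\<And>\<xi> t. \<xi> \<in> S0 \<Longrightarrow> t \<in> {0..T} \<Longrightarrow> snd (snd (Y t \<xi>)) = 0"
    "\<And>\<xi> t. \<xi> \<in> S0 \<Longrightarrow> t \<in> {0..T} \<Longrightarrow> \<beta> - \<alpha> \<le> norm (fst (snd (Y t \<xi>)))"
    "\<And>\<xi> t. \<xi> \<in> S0 \<Longrightarrow> t \<in> {0..T} \<Longrightarrow> norm (fst (snd (Y t \<xi>))) \<le> \<beta> + \<alpha>"
proof -
  obtain f Df L M W where f: "C1_field f Df L M"
    and fF: "\<And>t y. t \<in> {0..T} \<Longrightarrow> y \<in> W \<Longrightarrow> f t y = F t y"
    and DfF: "\<And>t y. t \<in> {0..T} \<Longrightarrow> y \<in> W \<Longrightarrow> blinfun_apply (Df t y) = F' t y"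
    and W: "open W" "W \<subseteq> D"
    and ref: "\<And>\<xi> t. \<xi> \<in> S0 \<Longrightarrow> t \<in> {0..T} \<Longrightarrow> lipschitz_field.flw f t (\<iota> \<xi>) \<in> W"
      "\<And>\<xi> t. \<xi> \<in> S0 \<Longrightarrow> t \<in> {0..T} \<Longrightarrow> snd (snd (lipschitz_field.flw f t (\<iota> \<xi>))) = 0"
      "\<And>\<xi> t. \<xi> \<in> S0 \<Longrightarrow> t \<in> {0..T} \<Longrightarrow> \<beta> - \<alpha> \<le> norm (fst (snd (lipschitz_field.flw f t (\<iota> \<xi>))))"
      "\<And>\<xi> t. \<xi> \<in> S0 \<Longrightarrow> t \<in> {0..T} \<Longrightarrow> norm (fst (snd (lipschitz_field.flw f t (\<iota> \<xi>)))) \<le> \<beta> + \<alpha>"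
    by (rule reference_field[OF T]) blast
  interpret C1_field f Df L M by (rule f)
  have "continuous_on (UNIV \<times> \<Omega>) (\<lambda>z. flw (fst z) (\<iota> (snd z)))"
    by (rule continuous_on_compose2[OF continuous_flw[unfolded case_prod_unfold], where f="\<lambda>z. (fst z, \<iota> (snd z))", simplified])
      (auto intro!: continuous_intros continuous_on_compose2[OF \<iota>_cont])
  then have G_open: "open ((UNIV \<times> \<Omega>) \<inter> (\<lambda>z. flw (fst z) (\<iota> (snd z))) -` W)"
    by (rule continuous_open_preimage) (use W open_\<Omega> in \<open>auto intro: open_Times\<close>)
  have G_sub: "{0..T} \<times> S0 \<subseteq> (UNIV \<times> \<Omega>) \<inter> (\<lambda>z. flw (fst z) (\<iota> (snd z))) -` W"
    using ref(1) S0_sub by auto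
  obtain U where U: "open U" "S0 \<subseteq> U"
    "{0..T} \<times> U \<subseteq> (UNIV \<times> \<Omega>) \<inter> (\<lambda>z. flw (fst z) (\<iota> (snd z))) -` W"
    by (rule compact_Times_open_neighborhood[OF compact_Icc compact_S0 G_open G_sub])
  have UW: "flw t (\<iota> \<xi>) \<in> W" if "\<xi> \<in> U" "t \<in> {0..T}" for t \<xi>
    using subsetD[OF U(3), of "(t, \<xi>)"] that by auto
  have U\<Omega>: "U \<subseteq> \<Omega>" using U(3) T by fastforce
  have cc: "char_curve T (\<lambda>t. flw t (\<iota> \<xi>))" if "\<xi> \<in> U" for \<xi>
    unfolding char_curve_def
  proof (intro ballI conjI)
    fix t assume t: "t \<in> {0..T}"
    show "flw t (\<iota> \<xi>) \<in> D" using UW[OF that t] W(2) by blast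
    show "((\<lambda>t. flw t (\<iota> \<xi>)) has_vector_derivative F t (flw t (\<iota> \<xi>))) (at t within {0..T})"
      using has_vector_derivative_at_within[OF flw_derivative[of "\<iota> \<xi>" t]] fF[OF t UW[OF that t]] by simp
  qed
  have good: "good T \<xi>" if "\<xi> \<in> U" for \<xi> using cc[OF that] by (auto simp: good_def)
  have Yeq: "Y t \<xi> = flw t (\<iota> \<xi>)" if "\<xi> \<in> U" "t \<in> {0..T}" for t \<xi>
    by (rule Y_eq[OF cc[OF that(1)] _ that(2)]) simp
  show thesis
    by (rule that[OF f fF DfF W U(1,2) U\<Omega> UW good Yeq])
      (use ref U(2) Yeq in \<open>auto simp: subset_iff\<close>)
qed

lemma S0_good: "\<xi> \<in> S0 \<Longrightarrow> good T \<xi>"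
proof -
  assume "\<xi> \<in> S0"
  then have "good (max 0 T) \<xi>" by (rule_tac local_flow[of "max 0 T"]) auto
  then show ?thesis by (rule good_mono) simp
qed

lemma S0_Y:
  assumes "\<xi> \<in> S0" "0 \<le> t"
  shows "snd (snd (Y t \<xi>)) = 0" "\<beta> - \<alpha> \<le> norm (fst (snd (Y t \<xi>)))" "norm (fst (snd (Y t \<xi>))) \<le> \<beta> + \<alpha>"
  using assms by (rule_tac local_flow[of t]; simp)+

lemma Y_D: "good t \<xi> \<Longrightarrow> 0 \<le> t \<Longrightarrow> Y t \<xi> \<in> D"
  using Y_char_curve[of t \<xi>] by (auto simp: char_curve_def)

lemma Y_closure: "good t \<xi> \<Longrightarrow> 0 \<le> t \<Longrightarrow> fst (Y t \<xi>) \<in> closure \<Omega>"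
  using Y_D[of t \<xi>] closure_subset[of \<Omega>] by (auto simp: D_def mem_Times_iff)

lemma Y_derivative:
  assumes "good T \<xi>" "0 \<le> t" "t < T"
  shows "((\<lambda>t. Y t \<xi>) has_vector_derivative F t (Y t \<xi>)) (at t within {0..})"
proof -
  have "((\<lambda>t. Y t \<xi>) has_vector_derivative F t (Y t \<xi>)) (at t within {0..T})"
    using Y_char_curve[OF assms(1)] assms by (simp add: char_curve_def)
  moreover have "at t within {0..T} = at t within {0..}"
    by (rule at_within_nhd[of _ "{..<T}"]) (use assms in auto)
  ultimately show ?thesis by simp
qed

lemma Y_component_derivatives:
  assumes "good T \<xi>" "0 \<le> t" "t < T"
  shows "((\<lambda>t. fst (Y t \<xi>)) has_vector_derivative fst (F t (Y t \<xi>))) (at t within {0..})"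
    "((\<lambda>t. fst (snd (Y t \<xi>))) has_vector_derivative fst (snd (F t (Y t \<xi>)))) (at t within {0..})"
    "((\<lambda>t. snd (snd (Y t \<xi>))) has_vector_derivative snd (snd (F t (Y t \<xi>)))) (at t within {0..})"
  using bounded_linear.has_vector_derivative[OF bounded_linear_fst Y_derivative[OF assms]]
    bounded_linear.has_vector_derivative[OF bounded_linear_compose[OF bounded_linear_fst bounded_linear_snd] Y_derivative[OF assms]]
    bounded_linear.has_vector_derivative[OF bounded_linear_compose[OF bounded_linear_snd bounded_linear_snd] Y_derivative[OF assms]]
  by simp_all

lemma Y_value:
  assumes "good T \<xi>" "0 \<le> t" "t \<le> T"
  shows "snd (snd (Y t \<xi>)) = exp (\<beta> * t) * \<phi>0 \<xi>"
proof -
  define z where "z s = snd (snd (Y s \<xi>)) - exp (\<beta> * s) * \<phi>0 \<xi>" for s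
  have der: "(z has_vector_derivative \<beta> * z s) (at s)" if s: "0 < s" "s < t" for s
  proof -
    have "((\<lambda>t. snd (snd (Y t \<xi>))) has_vector_derivative \<beta> * snd (snd (Y s \<xi>))) (at s within {0..})"
      using Y_component_derivatives(3)[OF assms(1), of s] s assms by (simp add: F_def Let_def)
    then have 1: "((\<lambda>t. snd (snd (Y t \<xi>))) has_vector_derivative \<beta> * snd (snd (Y s \<xi>))) (at s)"
      using s at_within_interior[of s "{0..}"] by simp
    have 2: "((\<lambda>s. exp (\<beta> * s) * \<phi>0 \<xi>) has_vector_derivative \<beta> * exp (\<beta> * s) * \<phi>0 \<xi>) (at s)"
      unfolding has_real_derivative_iff_has_vector_derivative[symmetric]
      by (auto intro!: derivative_eq_intros)
    show ?thesis
      unfolding z_def by (rule has_vector_derivative_eq_rhs[OF has_vector_derivative_diff[OF 1 2]]) (simp add: algebra_simps)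
  qed
  have "norm (z t) \<le> (norm (z 0) + 0 * (t - 0)) * exp (\<bar>\<beta>\<bar> * (t - 0))"
  proof (rule gronwall[OF assms(2) _ der])
    have "continuous_on {0..t} (\<lambda>s. Y s \<xi>)"
      using continuous_on_subset[OF char_curve_continuous[OF Y_char_curve[OF assms(1)]]] assms by auto
    then show "continuous_on {0..t} z" unfolding z_def by (intro continuous_intros)
  qed (auto simp: abs_mult)
  moreover have "z 0 = 0" using Y_0[OF assms(1)] assms by (simp add: z_def \<iota>_def)
  ultimately show ?thesis by (simp add: z_def)
qed

text \<open>The description in \<open>flow\<close> presupposes a solution: the position component of
  the characteristic is one, since \<open>u = 0\<close> turns its equation into
  \<open>x' = v\<close>. Uniqueness is Gronwall's inequality with the Lipschitz constant on the
  closure.\<close>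

lemma S0_flow:
  assumes \<xi>: "\<xi> \<in> S0" and t: "0 \<le> t"
  shows "flow \<Omega> v t 0 \<xi> = fst (Y t \<xi>)"
proof -
  let ?X = "\<lambda>s. fst (Y s \<xi>)"
  have X_in: "?X s \<in> closure \<Omega>" if "0 \<le> s" for s
    by (rule Y_closure[OF S0_good[OF \<xi>] that])
  \<comment> \<open>The horizon \<open>s + 1\<close> puts \<open>s\<close> strictly before the end,
    where the derivative within \<open>[0, T]\<close> is the one within
    \<open>[0, \<infinity>)\<close>.\<close>
  have X': "(?X has_vector_derivative v s (?X s)) (at s within {0..})" if "0 \<le> s" for s
    using Y_component_derivatives(1)[OF S0_good[OF \<xi>] that, of "s + 1"] S0_Y(1)[OF \<xi> that]
    by (simp add: F_def Let_def)
  have sol: "flow_solution \<Omega> v 0 \<xi> ?X"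
    unfolding flow_solution_def using X_in X' Y_0[OF S0_good[OF \<xi>], of 0] by (auto simp: \<iota>_def)
  show ?thesis
    unfolding flow_def
  proof (rule the_equality)
    show "\<exists>x. flow_solution \<Omega> v 0 \<xi> x \<and> ?X t = x t" using sol by blast
    fix y assume "\<exists>x. flow_solution \<Omega> v 0 \<xi> x \<and> y = x t"
    then obtain x where x: "flow_solution \<Omega> v 0 \<xi> x" and y: "y = x t" by blast
    obtain L where L: "0 \<le> L"
      "\<And>s a b. s \<in> {0..t} \<Longrightarrow> a \<in> closure \<Omega> \<Longrightarrow> b \<in> closure \<Omega> \<Longrightarrow> norm (v s a - v s b) \<le> L * norm (a - b)"
      using v_lipschitz_closure by blast
    let ?z = "\<lambda>s. x s - ?X s"
    have z: "(?z has_vector_derivative v s (x s) - v s (?X s)) (at s within {0..})" if "0 \<le> s" for s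
      by (intro has_vector_derivative_diff X'[OF that]) (use x that in \<open>auto simp: flow_solution_def\<close>)
    have "norm (?z t) \<le> (norm (?z 0) + 0 * (t - 0)) * exp (L * (t - 0))"
    proof (rule gronwall[OF t])
      show "continuous_on {0..t} ?z"
        by (rule continuous_on_vector_derivative[OF has_vector_derivative_within_subset[OF z]]) auto
      fix s assume s: "0 < s" "s < t"
      show "(?z has_vector_derivative v s (x s) - v s (?X s)) (at s)"
        using z[of s] s at_within_interior[of s "{0..}"] by simp
      have "x s \<in> closure \<Omega>" using x s by (auto simp: flow_solution_def)
      then show "norm (v s (x s) - v s (?X s)) \<le> L * norm (?z s) + 0"
        using L(2)[of s "x s" "?X s"] X_in[of s] s by simp
    qed (use L in auto)
    moreover have "?z 0 = 0" using x sol by (simp add: flow_solution_def)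
    ultimately show "y = ?X t" using y by simp
  qed
qed

text \<open>With \<open>u = 0\<close> the positions obey \<open>x' = v\<close> by themselves, so the
  initial point is recovered from the position alone by going backwards, without knowledge of
  \<open>p\<close>.\<close>

lemma S0_X_inject:
  assumes \<xi>: "\<xi> \<in> S0" "\<zeta> \<in> S0" and t: "0 \<le> t" and eq: "fst (Y t \<xi>) = fst (Y t \<zeta>)"
  shows "\<xi> = \<zeta>"
proof -
  obtain L where L: "0 \<le> L"
    "\<And>s a b. s \<in> {0..t} \<Longrightarrow> a \<in> closure \<Omega> \<Longrightarrow> b \<in> closure \<Omega> \<Longrightarrow> norm (v s a - v s b) \<le> L * norm (a - b)"
    using v_lipschitz_closure by blast
  let ?z = "\<lambda>s. fst (Y s \<xi>) - fst (Y s \<zeta>)"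
  have X': "((\<lambda>s. fst (Y s \<xi>)) has_vector_derivative v s (fst (Y s \<xi>))) (at s within {0..})"
    if "0 \<le> s" "\<xi> \<in> S0" for s \<xi>
    using Y_component_derivatives(1)[OF S0_good[OF that(2)] that(1), of "s + 1"] S0_Y(1)[OF that(2,1)]
    by (simp add: F_def Let_def)
  have z: "(?z has_vector_derivative v s (fst (Y s \<xi>)) - v s (fst (Y s \<zeta>))) (at s within {0..})" if "0 \<le> s" for s
    by (intro has_vector_derivative_diff X' that \<xi>)
  have X_in: "fst (Y s \<xi>) \<in> closure \<Omega>" if "0 \<le> s" "\<xi> \<in> S0" for s \<xi>
    by (rule Y_closure[OF S0_good[OF that(2)] that(1)])
  have "norm (?z 0) \<le> (norm (?z t) + 0 * (t - 0)) * exp (L * (t - 0))"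
  proof (rule gronwall_backward[OF t])
    show "continuous_on {0..t} ?z"
      by (rule continuous_on_vector_derivative[OF has_vector_derivative_within_subset[OF z]]) auto
    fix s assume s: "0 < s" "s < t"
    show "(?z has_vector_derivative v s (fst (Y s \<xi>)) - v s (fst (Y s \<zeta>))) (at s)"
      using z[of s] s at_within_interior[of s "{0..}"] by simp
    show "norm (v s (fst (Y s \<xi>)) - v s (fst (Y s \<zeta>))) \<le> L * norm (?z s) + 0"
      using L(2)[of s "fst (Y s \<xi>)" "fst (Y s \<zeta>)"] X_in[of s] \<xi> s by simp
  qed (use L in auto)
  then show ?thesis using eq Y_0[OF S0_good[OF \<xi>(1)], of 0] Y_0[OF S0_good[OF \<xi>(2)], of 0]
    by (simp add: \<iota>_def)
qed

end

section \<open>Inverting the characteristic flow\<close>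

text \<open>The derivative is operator-valued, continuous in norm and taken in the full space rather
  than within \<open>V\<close>. This is the form that composition and inversion work with;
  \<open>C1_open_imp_Ck_on\<close> translates back.\<close>

definition C1_open :: "'a::real_normed_vector set \<Rightarrow> ('a \<Rightarrow> 'b::real_normed_vector) \<Rightarrow> bool" where
  "C1_open V f \<longleftrightarrow> (\<exists>f'. (\<forall>z\<in>V. (f has_derivative blinfun_apply (f' z)) (at z)) \<and> continuous_on V f')"

lemma C1_open_continuous:
  assumes "C1_open V f" shows "continuous_on V f"
proof -
  obtain f' where f': "\<And>z. z \<in> V \<Longrightarrow> (f has_derivative blinfun_apply (f' z)) (at z)"
    using assms by (auto simp: C1_open_def)
  show ?thesis by (rule has_derivative_continuous_on[OF has_derivative_at_withinI[OF f']])
qed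

lemma C1_open_subset:
  assumes "C1_open V f" "V' \<subseteq> V" shows "C1_open V' f"
proof -
  obtain f' where f': "\<And>z. z \<in> V \<Longrightarrow> (f has_derivative blinfun_apply (f' z)) (at z)" "continuous_on V f'"
    using assms(1) by (auto simp: C1_open_def)
  show ?thesis
    unfolding C1_open_def
    by (intro exI[of _ f'] conjI ballI f'(1) subsetD[OF assms(2)] continuous_on_subset[OF f'(2) assms(2)])
qed

lemma C1_open_compose:
  assumes g: "C1_open V g" and f: "C1_open N f" and sub: "g ` V \<subseteq> N"
  shows "C1_open V (\<lambda>z. f (g z))"
proof -
  obtain f' where f': "\<And>z. z \<in> N \<Longrightarrow> (f has_derivative blinfun_apply (f' z)) (at z)" "continuous_on N f'"
    using f by (auto simp: C1_open_def)
  obtain g' where g': "\<And>z. z \<in> V \<Longrightarrow> (g has_derivative blinfun_apply (g' z)) (at z)" "continuous_on V g'"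
    using g by (auto simp: C1_open_def)
  have "((\<lambda>z. f (g z)) has_derivative blinfun_apply (f' (g z) o\<^sub>L g' z)) (at z)" if "z \<in> V" for z
    using has_derivative_compose[OF g'(1)[OF that] f'(1)] sub that
    by (auto simp: o_def blinfun_compose.rep_eq)
  moreover have "continuous_on V (\<lambda>z. f' (g z) o\<^sub>L g' z)"
    using sub by (intro continuous_intros continuous_on_compose2[OF f'(2)] C1_open_continuous[OF g] g'(2))
  ultimately show ?thesis
    unfolding C1_open_def by (intro exI[of _ "\<lambda>z. f' (g z) o\<^sub>L g' z"] conjI ballI)
qed

lemma C1_open_bounded_linear: "bounded_linear f \<Longrightarrow> C1_open V f"
  unfolding C1_open_def
  by (intro exI[of _ "\<lambda>_. Blinfun f"])
    (auto simp: bounded_linear_Blinfun_apply intro: bounded_linear_imp_has_derivative)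

text \<open>From \<open>B z - B z0 = B z (A z0 - A z) B z0\<close>. Once
  \<open>|A z0 - A z| |B z0| \<le> 1/2\<close>, the factor \<open>B z\<close> on the right can be
  absorbed, which gives \<open>|B z| \<le> 2 |B z0|\<close>; then the identity bounds the difference
  by a multiple of \<open>|A z - A z0|\<close>.\<close>

lemma continuous_on_blinfun_inverse:
  fixes A B :: "'z::metric_space \<Rightarrow> 'a::real_normed_vector \<Rightarrow>\<^sub>L 'a"
  assumes A: "continuous_on V A"
    and AB: "\<And>z k. z \<in> V \<Longrightarrow> blinfun_apply (A z) (blinfun_apply (B z) k) = k"
    and BA: "\<And>z k. z \<in> V \<Longrightarrow> blinfun_apply (B z) (blinfun_apply (A z) k) = k"
  shows "continuous_on V B"
  unfolding continuous_on_def
proof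
  fix z0 assume z0: "z0 \<in> V"
  define b where "b = norm (B z0)"
  have b: "b \<ge> 0" by (simp add: b_def)
  have A0: "(A \<longlongrightarrow> A z0) (at z0 within V)" using A z0 by (simp add: continuous_on_def)
  have diff: "B z - B z0 = B z o\<^sub>L ((A z0 - A z) o\<^sub>L B z0)" if "z \<in> V" for z
    by (rule blinfun_eqI) (simp add: blinfun.diff_left blinfun.diff_right AB[OF z0] BA[OF that])
  have le: "norm (B z - B z0) \<le> norm (B z) * (norm (A z0 - A z) * b)" if "z \<in> V" for z
    unfolding diff[OF that] b_def
    by (rule order_trans[OF norm_blinfun_compose mult_left_mono[OF norm_blinfun_compose]]) simp
  have "\<forall>\<^sub>F z in at z0 within V. norm (A z0 - A z) < 1 / (2 * (b + 1))"
    using tendstoD[OF A0, of "1 / (2 * (b + 1))"] b by (simp add: dist_norm norm_minus_commute)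
  then have ev: "\<forall>\<^sub>F z in at z0 within V. norm (B z - B z0) \<le> (2 * b * b) * norm (A z - A z0)"
    unfolding eventually_at_filter
  proof eventually_elim
    case (elim z)
    show ?case
    proof (intro impI)
      assume "z \<noteq> z0" and z: "z \<in> V"
      with elim have small: "norm (A z0 - A z) < 1 / (2 * (b + 1))" by simp
      have "norm (A z0 - A z) * b \<le> 1 / (2 * (b + 1)) * b" using small b by (intro mult_right_mono) auto
      also have "\<dots> \<le> 1/2" using b by (simp add: field_simps)
      finally have half: "norm (A z0 - A z) * b \<le> 1/2" .
      have "norm (B z) \<le> b + norm (B z - B z0)" unfolding b_def by (rule norm_triangle_sub)
      also have "\<dots> \<le> b + norm (B z) * (1/2)"
        using le[OF z] mult_left_mono[OF half, of "norm (B z)"] by simp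
      finally have "norm (B z) \<le> 2 * b" by simp
      then have "norm (B z) * (norm (A z0 - A z) * b) \<le> (2 * b) * (norm (A z0 - A z) * b)"
        using b by (intro mult_right_mono) auto
      with le[OF z] show "norm (B z - B z0) \<le> (2 * b * b) * norm (A z - A z0)"
        by (simp add: norm_minus_commute mult.assoc mult.left_commute mult.commute)
    qed
  qed
  have "((\<lambda>z. (2 * b * b) * norm (A z - A z0)) \<longlongrightarrow> (2 * b * b) * norm (A z0 - A z0)) (at z0 within V)"
    by (intro tendsto_intros A0)
  then have "((\<lambda>z. B z - B z0) \<longlongrightarrow> 0) (at z0 within V)"
    by (intro Lim_null_comparison[OF ev]) simp
  then show "(B \<longlongrightarrow> B z0) (at z0 within V)" by (simp add: LIM_zero_cancel)
qed

text \<open>The inverse function theorem yields a differentiable inverse; continuity of its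
  derivative is added through \<open>continuous_on_blinfun_inverse\<close>. An injective derivative
  at one point suffices because the dimension is finite.\<close>

lemma C1_local_inverse:
  fixes \<Psi> :: "'a::euclidean_space \<Rightarrow> 'a"
  assumes N0: "open N0" "z0 \<in> N0"
    and \<Psi>': "\<And>z. z \<in> N0 \<Longrightarrow> (\<Psi> has_derivative blinfun_apply (\<Psi>' z)) (at z)"
    and cont: "continuous_on N0 \<Psi>'" and inj: "inj (blinfun_apply (\<Psi>' z0))"
  obtains N V g where "open N" "z0 \<in> N" "N \<subseteq> N0" "open V" "homeomorphism N V \<Psi> g" "C1_open V g"
    "\<And>z. z \<in> N \<Longrightarrow> bij (blinfun_apply (\<Psi>' z))"
proof -
  have lin: "linear (blinfun_apply (\<Psi>' z0))" by (rule bounded_linear.linear[OF blinfun.bounded_linear_right])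
  obtain L where L: "linear L" "\<forall>x. L (blinfun_apply (\<Psi>' z0) x) = x"
    using linear_injective_isomorphism[OF lin inj] by blast
  have BL: "blinfun_apply (Blinfun L) = L"
    by (rule bounded_linear_Blinfun_apply) (use L in \<open>simp add: linear_conv_bounded_linear\<close>)
  have id: "Blinfun L o\<^sub>L \<Psi>' z0 = id_blinfun"
    by (rule blinfun_eqI) (simp add: BL L)
  obtain N V g g' where N: "open N" "N \<subseteq> N0" "z0 \<in> N" "open V" "\<Psi> z0 \<in> V" and hom: "homeomorphism N V \<Psi> g"
    and g: "\<And>y. y \<in> V \<Longrightarrow> (g has_derivative g' y) (at y)"
    and g': "\<And>y. y \<in> V \<Longrightarrow> g' y = inv (blinfun_apply (\<Psi>' (g y)))"
    and bij: "\<And>y. y \<in> V \<Longrightarrow> bij (blinfun_apply (\<Psi>' (g y)))"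
    by (rule inverse_function_theorem[OF N0(1) \<Psi>' cont N0(2) id]) blast+
  define G where "G y = Blinfun (g' y)" for y
  have G: "blinfun_apply (G y) = g' y" if "y \<in> V" for y
    unfolding G_def by (rule bounded_linear_Blinfun_apply[OF has_derivative_bounded_linear[OF g[OF that]]])
  have gN: "g y \<in> N" if "y \<in> V" for y using hom that by (auto simp: homeomorphism_def)
  have g_cont: "continuous_on V g" using hom by (simp add: homeomorphism_def)
  have A_cont: "continuous_on V (\<lambda>y. \<Psi>' (g y))"
    by (rule continuous_on_compose2[OF cont g_cont]) (use gN N in auto)
  have "continuous_on V G"
  proof (rule continuous_on_blinfun_inverse[OF A_cont])
    fix y k assume y: "y \<in> V"
    show "blinfun_apply (\<Psi>' (g y)) (blinfun_apply (G y) k) = k"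
      using bij[OF y] by (simp add: G[OF y] g'[OF y] bij_is_surj surj_f_inv_f)
    show "blinfun_apply (G y) (blinfun_apply (\<Psi>' (g y)) k) = k"
      using bij[OF y] by (simp add: G[OF y] g'[OF y] bij_is_inj inv_f_f)
  qed
  then have "C1_open V g" unfolding C1_open_def using g G by (intro exI[of _ G]) auto
  moreover have "bij (blinfun_apply (\<Psi>' z))" if "z \<in> N" for z
    using bij[of "\<Psi> z"] hom that by (auto simp: homeomorphism_def)
  ultimately show thesis using that N hom by blast
qed

lemma linear_ode_solution:
  fixes z :: "real \<Rightarrow> real"
  assumes t: "0 \<le> t" and cont: "continuous_on {0..t} z"
    and der: "\<And>s. 0 < s \<Longrightarrow> s < t \<Longrightarrow> (z has_vector_derivative b * z s) (at s)"
  shows "z t = exp (b * t) * z 0"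
proof -
  define y where "y s = z s - exp (b * s) * z 0" for s
  have "norm (y t) \<le> (norm (y 0) + 0 * (t - 0)) * exp (\<bar>b\<bar> * (t - 0))"
  proof (rule gronwall[OF t, where z'="\<lambda>s. b * y s"])
    show "continuous_on {0..t} y" unfolding y_def by (intro continuous_intros cont)
    fix s assume s: "0 < s" "s < t"
    have "((\<lambda>s. exp (b * s) * z 0) has_vector_derivative b * exp (b * s) * z 0) (at s)"
      unfolding has_real_derivative_iff_has_vector_derivative[symmetric]
      by (auto intro!: derivative_eq_intros)
    from has_vector_derivative_diff[OF der[OF s] this]
    show "(y has_vector_derivative b * y s) (at s)"
      unfolding y_def by (rule has_vector_derivative_eq_rhs) (simp add: algebra_simps)
  qed (auto simp: abs_mult)
  then show ?thesis by (simp add: y_def)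
qed

section \<open>The map from initial points to positions\<close>

locale characteristic_flow =
  level_set_problem \<Omega> v w w2 \<beta> \<phi>0 g0 H0 S0 \<alpha> + C1_field f Df L M
  for \<Omega> v w w2 \<beta> \<phi>0 g0 H0 S0 \<alpha> and f :: "real \<Rightarrow> char_state \<Rightarrow> char_state" and Df L M +
  fixes T :: real and W :: "char_state set" and U :: "(real^3) set"
  assumes T: "0 \<le> T"
    and f_F: "\<And>t y. t \<in> {0..T} \<Longrightarrow> y \<in> W \<Longrightarrow> f t y = F t y"
    and Df_F': "\<And>t y. t \<in> {0..T} \<Longrightarrow> y \<in> W \<Longrightarrow> blinfun_apply (Df t y) = F' t y"
    and W_D: "W \<subseteq> D" and open_U: "open U" and S0_U: "S0 \<subseteq> U" and U_\<Omega>: "U \<subseteq> \<Omega>"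
    and flw_W: "\<And>\<xi> t. \<xi> \<in> U \<Longrightarrow> t \<in> {0..T} \<Longrightarrow> flw t (\<iota> \<xi>) \<in> W"
    and good_U: "\<And>\<xi>. \<xi> \<in> U \<Longrightarrow> good T \<xi>"
    and Y_flw: "\<And>\<xi> t. \<xi> \<in> U \<Longrightarrow> t \<in> {0..T} \<Longrightarrow> Y t \<xi> = flw t (\<iota> \<xi>)"
begin

text \<open>Built from the truncated flow, hence defined for all real times, and equal to
  \<open>Y\<close> for times in \<open>{0..T}\<close> and points of \<open>U\<close>. Thus
  \<open>J\<close> and \<Psi> are C1 on open sets around \<open>t = 0\<close> and
  \<open>t = T\<close>, and no one-sided inverse function theorem is involved.\<close>

definition J :: "real \<times> (real^3) \<Rightarrow> char_state" where
  "J z = flw (fst z) (\<iota> (snd z))"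

definition D\<iota> :: "real^3 \<Rightarrow> real^3 \<Rightarrow> char_state" where
  "D\<iota> \<xi> k = (k, blinfun_apply (H0 \<xi>) k, k \<bullet> g0 \<xi>)"

definition J' :: "real \<times> (real^3) \<Rightarrow> real \<times> (real^3) \<Rightarrow> char_state" where
  "J' z h = fst h *\<^sub>R f (fst z) (J z) + dflw (fst z) (\<iota> (snd z)) (D\<iota> (snd z) (snd h))"

definition \<Psi> :: "real \<times> (real^3) \<Rightarrow> real \<times> (real^3)" where
  "\<Psi> z = (fst z, fst (J z))"

definition \<Psi>' :: "real \<times> (real^3) \<Rightarrow> real \<times> (real^3) \<Rightarrow> real \<times> (real^3)" where
  "\<Psi>' z h = (fst h, fst (J' z h))"

lemma \<iota>_derivative: "\<xi> \<in> \<Omega> \<Longrightarrow> (\<iota> has_derivative D\<iota> \<xi>) (at \<xi>)"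
  unfolding \<iota>_def[abs_def] D\<iota>_def[abs_def]
  by (intro has_derivative_Pair has_derivative_ident g0_derivative \<phi>0_derivative)

lemma J_derivative:
  assumes "z \<in> UNIV \<times> \<Omega>" shows "(J has_derivative J' z) (at z)"
proof -
  have "((\<lambda>z. \<iota> (snd z)) has_derivative (\<lambda>h. D\<iota> (snd z) (snd h))) (at z)"
    by (rule has_derivative_compose[OF has_derivative_snd[OF has_derivative_ident] \<iota>_derivative]) (use assms in auto)
  then have "((\<lambda>z. (fst z, \<iota> (snd z))) has_derivative (\<lambda>h. (fst h, D\<iota> (snd z) (snd h)))) (at z)"
    by (intro has_derivative_Pair has_derivative_fst has_derivative_ident)
  from has_derivative_compose[OF this flw_has_joint_derivative]
  show ?thesis
    unfolding J_def[abs_def] J'_def[abs_def] by simp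
qed

lemma \<Psi>_derivative:
  assumes "z \<in> UNIV \<times> \<Omega>" shows "(\<Psi> has_derivative \<Psi>' z) (at z)"
  unfolding \<Psi>_def[abs_def] \<Psi>'_def[abs_def]
  by (intro has_derivative_Pair has_derivative_fst has_derivative_ident J_derivative assms)

lemma J_cont: "continuous_on (UNIV \<times> \<Omega>) J"
  by (rule has_derivative_continuous_on[OF has_derivative_at_withinI[OF J_derivative]])

lemma snd_cont: "continuous_on \<Omega> q \<Longrightarrow> continuous_on (UNIV \<times> \<Omega>) (\<lambda>z. q (snd z))"
  for q :: "real^3 \<Rightarrow> 'z::topological_space"
  by (erule continuous_on_compose2) (auto intro!: continuous_intros)

lemma J'_cont: "continuous_on (UNIV \<times> \<Omega>) (\<lambda>z. J' z h)"
proof -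
  have g0_cont: "continuous_on \<Omega> g0"
    by (rule has_derivative_continuous_on[OF has_derivative_at_withinI[OF g0_derivative]])
  have 1: "continuous_on (UNIV \<times> \<Omega>) (\<lambda>z. Dflw (fst z) (\<iota> (snd z)))"
    by (rule continuous_on_compose2[OF continuous_Dflw[unfolded case_prod_unfold], where f="\<lambda>z. (fst z, \<iota> (snd z))", simplified])
      (auto intro!: continuous_intros snd_cont[OF \<iota>_cont])
  have 2: "continuous_on (UNIV \<times> \<Omega>) (\<lambda>z. f (fst z) (J z))"
    by (rule continuous_on_f[OF continuous_on_fst[OF continuous_on_id] J_cont])
  have 3: "continuous_on (UNIV \<times> \<Omega>) (\<lambda>z. D\<iota> (snd z) (snd h))"
    unfolding D\<iota>_def
    by (intro continuous_on_Pair continuous_on_const continuous_on_inner snd_cont[OF g0_cont]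
        blinfun.continuous_on snd_cont[OF H0_cont])
  show ?thesis
    unfolding J'_def Dflw_apply[symmetric]
    by (intro continuous_on_add continuous_on_scaleR continuous_on_const blinfun.continuous_on 1 2 3)
qed

definition JB :: "real \<times> (real^3) \<Rightarrow> (real \<times> (real^3)) \<Rightarrow>\<^sub>L char_state" where
  "JB z = Blinfun (J' z)"

definition \<Psi>B :: "real \<times> (real^3) \<Rightarrow> (real \<times> (real^3)) \<Rightarrow>\<^sub>L (real \<times> (real^3))" where
  "\<Psi>B z = Blinfun (\<Psi>' z)"

lemma JB_apply: "z \<in> UNIV \<times> \<Omega> \<Longrightarrow> blinfun_apply (JB z) = J' z"
  unfolding JB_def by (rule bounded_linear_Blinfun_apply[OF has_derivative_bounded_linear[OF J_derivative]])

lemma \<Psi>B_apply: "z \<in> UNIV \<times> \<Omega> \<Longrightarrow> blinfun_apply (\<Psi>B z) = \<Psi>' z"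
  unfolding \<Psi>B_def by (rule bounded_linear_Blinfun_apply[OF has_derivative_bounded_linear[OF \<Psi>_derivative]])

lemma JB_cont: "continuous_on (UNIV \<times> \<Omega>) JB"
proof (rule continuous_on_blinfun_componentwise)
  fix h :: "real \<times> (real^3)"
  show "continuous_on (UNIV \<times> \<Omega>) (\<lambda>z. blinfun_apply (JB z) h)"
    by (rule continuous_on_eq[OF J'_cont[of h]]) (simp add: JB_apply)
qed

lemma \<Psi>B_cont: "continuous_on (UNIV \<times> \<Omega>) \<Psi>B"
proof (rule continuous_on_blinfun_componentwise)
  fix h :: "real \<times> (real^3)"
  have "continuous_on (UNIV \<times> \<Omega>) (\<lambda>z. \<Psi>' z h)"
    unfolding \<Psi>'_def by (intro continuous_on_Pair continuous_on_const continuous_on_fst J'_cont)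
  then show "continuous_on (UNIV \<times> \<Omega>) (\<lambda>z. blinfun_apply (\<Psi>B z) h)"
    by (rule continuous_on_eq) (simp add: \<Psi>B_apply)
qed

lemma J_C1: "V \<subseteq> UNIV \<times> \<Omega> \<Longrightarrow> C1_open V J"
  unfolding C1_open_def
proof (intro exI[of _ JB] conjI ballI)
  fix z assume "V \<subseteq> UNIV \<times> \<Omega>" "z \<in> V"
  then have z: "z \<in> UNIV \<times> \<Omega>" by (rule subsetD)
  show "(J has_derivative blinfun_apply (JB z)) (at z)" unfolding JB_apply[OF z] by (rule J_derivative[OF z])
qed (rule continuous_on_subset[OF JB_cont])

text \<open>\<open>du - p \<cdot> dx\<close> solves the scalar linear equation \<open>w' = (\<beta> - |p|) w\<close> with \<open>w 0 = 0\<close>.\<close>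

lemma contact_relation:
  assumes \<xi>: "\<xi> \<in> U" and t: "t \<in> {0..T}"
  shows "fst (snd (flw t (\<iota> \<xi>))) \<bullet> fst (dflw t (\<iota> \<xi>) (D\<iota> \<xi> k)) = exp (\<beta> * t) * (k \<bullet> g0 \<xi>)"
    and "snd (snd (dflw t (\<iota> \<xi>) (D\<iota> \<xi> k))) = exp (\<beta> * t) * (k \<bullet> g0 \<xi>)"
proof -
  let ?y = "\<lambda>s. flw s (\<iota> \<xi>)" and ?h = "\<lambda>s. dflw s (\<iota> \<xi>) (D\<iota> \<xi> k)"
  define x where "x s = fst (?y s)" for s
  define p where "p s = fst (snd (?y s))" for s
  define u where "u s = snd (snd (?y s))" for s
  define a where "a s = fst (?h s)" for s
  define b where "b s = fst (snd (?h s))" for s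
  define c where "c s = snd (snd (?h s))" for s
  note bl = bounded_linear_fst bounded_linear_compose[OF bounded_linear_fst bounded_linear_snd]
    bounded_linear_compose[OF bounded_linear_snd bounded_linear_snd]
  have p0: "p s \<noteq> 0" if "s \<in> {0..T}" for s
    using flw_W[OF \<xi> that] W_D by (auto simp: D_def p_def)
  have y': "(?y has_vector_derivative F s (?y s)) (at s)" if "s \<in> {0..T}" for s
    using flw_derivative[of "\<iota> \<xi>" s] f_F[OF that flw_W[OF \<xi> that]] by simp
  have h': "(?h has_vector_derivative F' s (?y s) (?h s)) (at s)" if "s \<in> {0..T}" for s
    using dflw_derivative[of "\<iota> \<xi>" "D\<iota> \<xi> k" s] Df_F'[OF that flw_W[OF \<xi> that]] by simp
  have p': "(p has_vector_derivative (\<beta> - norm (p s)) *\<^sub>R p s - Dv_adj s (x s) (p s)) (at s)" if "s \<in> {0..T}" for s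
    using bounded_linear.has_vector_derivative[OF bl(2) y'[OF that]]
    by (simp add: F_def Let_def x_def p_def[abs_def])
  have a': "(a has_vector_derivative Dv s (x s) (a s) + ((u s / norm (p s)) *\<^sub>R b s
      + ((c s * norm (p s) - u s * (b s \<bullet> sgn (p s))) / (norm (p s) * norm (p s))) *\<^sub>R p s)) (at s)"
    if "s \<in> {0..T}" for s
    using bounded_linear.has_vector_derivative[OF bl(1) h'[OF that]]
    by (simp add: F'_def Let_def x_def p_def u_def a_def[abs_def] b_def c_def)
  have c': "(c has_vector_derivative \<beta> * c s) (at s)" if "s \<in> {0..T}" for s
    using bounded_linear.has_vector_derivative[OF bl(3) h'[OF that]]
    by (simp add: F'_def Let_def c_def[abs_def])
  have cont: "continuous_on {0..t} p" "continuous_on {0..t} a" "continuous_on {0..t} c"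
    by (rule continuous_on_vector_derivative[OF has_vector_derivative_at_within[OF p']]
          continuous_on_vector_derivative[OF has_vector_derivative_at_within[OF a']]
          continuous_on_vector_derivative[OF has_vector_derivative_at_within[OF c']]; use t in simp)+
  have c_val: "c t = exp (\<beta> * t) * (k \<bullet> g0 \<xi>)"
    using linear_ode_solution[OF _ cont(3) c'] t by (simp add: c_def D\<iota>_def)
  then show "snd (snd (?h t)) = exp (\<beta> * t) * (k \<bullet> g0 \<xi>)" by (simp add: c_def)
  define w where "w s = c s - p s \<bullet> a s" for s
  have w': "(w has_vector_derivative (\<beta> - norm (p s)) * w s) (at s)" if s: "s \<in> {0..T}" for s
  proof -
    let ?p' = "(\<beta> - norm (p s)) *\<^sub>R p s - Dv_adj s (x s) (p s)"
    let ?m = "(c s * norm (p s) - u s * (b s \<bullet> sgn (p s))) / (norm (p s) * norm (p s))"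
    let ?a' = "Dv s (x s) (a s) + ((u s / norm (p s)) *\<^sub>R b s + ?m *\<^sub>R p s)"
    have n0: "norm (p s) \<noteq> 0" using p0[OF s] by simp
    have "((\<lambda>s. p s \<bullet> a s) has_derivative (\<lambda>r. p s \<bullet> (r *\<^sub>R ?a') + (r *\<^sub>R ?p') \<bullet> a s)) (at s)"
      by (intro has_derivative_inner p'[OF s, unfolded has_vector_derivative_def] a'[OF s, unfolded has_vector_derivative_def])
    then have pa: "((\<lambda>s. p s \<bullet> a s) has_vector_derivative (p s \<bullet> ?a' + ?p' \<bullet> a s)) (at s)"
      unfolding has_vector_derivative_def by (rule has_derivative_eq_rhs) (simp add: fun_eq_iff algebra_simps)
    \<comment> \<open>Both terms containing \<open>b\<close>, that is \<open>dp\<close>, cancel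
      here, and the \<open>Dv\<close> terms will cancel against those from \<open>p'\<close>; hence
      the closed equation for \<open>w\<close>.\<close>
    have "p s \<bullet> ?a' = p s \<bullet> Dv s (x s) (a s) + ((u s / norm (p s)) * (p s \<bullet> b s) + ?m * (p s \<bullet> p s))"
      by (simp add: inner_add_right)
    also have "?m * (p s \<bullet> p s) = c s * norm (p s) - (u s / norm (p s)) * (p s \<bullet> b s)"
      using n0 by (simp add: sgn_div_norm inner_commute dot_square_norm power2_eq_square field_simps)
    finally have 1: "p s \<bullet> ?a' = p s \<bullet> Dv s (x s) (a s) + c s * norm (p s)" by simp
    have 2: "?p' \<bullet> a s = (\<beta> - norm (p s)) * (p s \<bullet> a s) - p s \<bullet> Dv s (x s) (a s)"
      by (simp add: inner_diff_left Dv_adj_inner) (simp add: inner_commute)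
    have "\<beta> * c s - (p s \<bullet> ?a' + ?p' \<bullet> a s) = (\<beta> - norm (p s)) * w s"
      unfolding 1 2 w_def by (simp add: algebra_simps)
    then show ?thesis
      using has_vector_derivative_diff[OF c'[OF s] pa] unfolding w_def[abs_def] by simp
  qed
  have "continuous_on {0..t} (\<lambda>s. \<beta> - norm (p s))" by (intro continuous_intros cont)
  then have "bounded ((\<lambda>s. \<beta> - norm (p s)) ` {0..t})" by (intro compact_imp_bounded compact_continuous_image compact_Icc)
  then obtain B where B: "\<And>s. s \<in> {0..t} \<Longrightarrow> \<bar>\<beta> - norm (p s)\<bar> \<le> B" unfolding bounded_iff real_norm_def by blast
  have "w t = 0"
  proof (rule gronwall_zero[where z=w and a=0 and b=t and c=0])
    show "continuous_on {0..t} w" unfolding w_def by (intro continuous_intros cont)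
    show "(w has_vector_derivative (\<beta> - norm (p s)) * w s) (at s)" if "0 < s" "s < t" for s
      by (rule w') (use that t in auto)
    show "norm ((\<beta> - norm (p s)) * w s) \<le> B * norm (w s)" if "0 < s" "s < t" for s
      using mult_right_mono[OF B[of s], of "\<bar>w s\<bar>"] that by (simp add: abs_mult)
    show "0 \<le> B" using B[of 0] t by auto
    show "w 0 = 0" by (simp add: w_def c_def p_def a_def D\<iota>_def \<iota>_def inner_commute)
  qed (use t in auto)
  then show "fst (snd (?y t)) \<bullet> fst (?h t) = exp (\<beta> * t) * (k \<bullet> g0 \<xi>)"
    using c_val by (simp add: w_def p_def a_def)
qed

text \<open>On \<open>S0\<close> we have \<open>u = 0\<close>, so the linearised equation for \<open>dx\<close> does not involve \<open>dp\<close>, and \<open>du = p \<bullet> dx\<close>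
  eliminates \<open>du\<close>: what remains is linear and homogeneous in \<open>dx\<close>.\<close>

lemma \<Psi>'_inj_S0:
  assumes \<xi>: "\<xi> \<in> S0" and t: "t \<in> {0..T}"
  shows "inj (blinfun_apply (\<Psi>B (t, \<xi>)))"
proof -
  have \<xi>U: "\<xi> \<in> U" and \<xi>\<Omega>: "\<xi> \<in> \<Omega>" using \<xi> S0_U U_\<Omega> by auto
  have "h = 0" if h: "blinfun_apply (\<Psi>B (t, \<xi>)) h = 0" for h
  proof -
    define k where "k = snd h"
    have "\<Psi>' (t, \<xi>) h = 0" using h \<Psi>B_apply[of "(t, \<xi>)"] \<xi>\<Omega> by simp
    then have h0: "fst h = 0" and a0: "fst (dflw t (\<iota> \<xi>) (D\<iota> \<xi> k)) = 0"
      by (auto simp: \<Psi>'_def J'_def k_def prod_eq_iff)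
    let ?y = "\<lambda>s. flw s (\<iota> \<xi>)" and ?h = "\<lambda>s. dflw s (\<iota> \<xi>) (D\<iota> \<xi> k)"
    \<comment> \<open>From \<open>|dx| + |du| \<le> (1 + |p|) |dx|\<close> and
      \<open>|p| \<le> \<beta> + \<alpha>\<close>.\<close>
    let ?C = "1 + (\<beta> + \<alpha>)"
    have C: "0 \<le> ?C" using \<alpha>_pos \<alpha>_less_\<beta> by simp
    have h': "((\<lambda>s. fst (?h s)) has_vector_derivative fst (F' s (?y s) (?h s))) (at s)" if "s \<in> {0..T}" for s
      using bounded_linear.has_vector_derivative[OF bounded_linear_fst dflw_derivative[of "\<iota> \<xi>" "D\<iota> \<xi> k" s]]
        Df_F'[OF that flw_W[OF \<xi>U that]] by simp
    have bnd: "norm (fst (F' s (?y s) (?h s))) \<le> (L * ?C) * norm (fst (?h s)) + 0" if s: "s \<in> {0..T}" for s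
    proof -
      have Ys: "Y s \<xi> = ?y s" by (rule Y_flw[OF \<xi>U s])
      have u0: "snd (snd (?y s)) = 0" and pn: "norm (fst (snd (?y s))) \<le> \<beta> + \<alpha>"
        using S0_Y[OF \<xi>, of s] s by (simp_all add: Ys)
      \<comment> \<open>With \<open>u = 0\<close> the position component of \<open>F'\<close> does
        not see \<open>dp\<close>, which may therefore be set to 0 before the operator bound
        \<open>L\<close> is applied.\<close>
      let ?k = "(fst (?h s), 0::real^3, snd (snd (?h s)))"
      have "norm (fst (F' s (?y s) (?h s))) = norm (fst (F' s (?y s) ?k))"
        by (simp add: F'_def Let_def u0)
      also have "\<dots> \<le> norm (F' s (?y s) ?k)"
        by (metis norm_fst_le prod.collapse)
      also have "\<dots> \<le> L * norm ?k"
        using norm_Df_apply[of s "?y s" ?k] Df_F'[OF s flw_W[OF \<xi>U s]] by simp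
      also have "\<dots> \<le> L * (norm (fst (?h s)) + \<bar>snd (snd (?h s))\<bar>)"
        using norm_Pair_le[of "fst (?h s)" "(0::real^3, snd (snd (?h s)))"]
        by (intro mult_left_mono L_ge_0) (simp add: norm_Pair)
      also have "\<dots> \<le> L * (norm (fst (?h s)) + (\<beta> + \<alpha>) * norm (fst (?h s)))"
      proof (intro mult_left_mono add_left_mono L_ge_0)
        have "snd (snd (?h s)) = fst (snd (?y s)) \<bullet> fst (?h s)"
          using contact_relation[OF \<xi>U s] by simp
        also have "\<bar>\<dots>\<bar> \<le> norm (fst (snd (?y s))) * norm (fst (?h s))" by (rule Cauchy_Schwarz_ineq2)
        also have "\<dots> \<le> (\<beta> + \<alpha>) * norm (fst (?h s))" by (rule mult_right_mono[OF pn]) simp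
        finally show "\<bar>snd (snd (?h s))\<bar> \<le> (\<beta> + \<alpha>) * norm (fst (?h s))" .
      qed
      finally show ?thesis by (simp add: algebra_simps)
    qed
    have "norm (fst (?h 0)) \<le> (norm (fst (?h t)) + 0 * (t - 0)) * exp ((L * ?C) * (t - 0))"
    proof (rule gronwall_backward[where z="\<lambda>s. fst (?h s)" and z'="\<lambda>s. fst (F' s (?y s) (?h s))"])
      show "continuous_on {0..t} (\<lambda>s. fst (?h s))"
        by (rule continuous_on_vector_derivative[OF has_vector_derivative_at_within[OF h']]) (use t in auto)
      show "0 \<le> L * ?C" using C L_ge_0 by simp
    qed (use h' bnd t in auto)
    then have "k = 0" using a0 by (simp add: D\<iota>_def)
    then show "h = 0" using h0 by (simp add: k_def prod_eq_iff)
  qed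
  then show ?thesis
    using linear_injective_0[OF bounded_linear.linear[OF blinfun.bounded_linear_right], of "\<Psi>B (t, \<xi>)"] by blast
qed

end

section \<open>Injectivity near the surface and the gradient of the solution\<close>

lemma compact_square_neighborhood:
  fixes S :: "'a::metric_space set"
  assumes "compact S" "open G" "S \<times> S \<subseteq> G"
  obtains U where "open U" "S \<subseteq> U" "U \<times> U \<subseteq> G"
proof -
  obtain e where e: "e > 0" "(\<Union>z\<in>S \<times> S. ball z e) \<subseteq> G"
    using compact_subset_open_imp_ball_epsilon_subset[OF compact_Times[OF assms(1,1)] assms(2,3)] by blast
  show thesis
  proof (rule that[of "\<Union>x\<in>S. ball x (e / 2)"])
    show "(\<Union>x\<in>S. ball x (e / 2)) \<times> (\<Union>x\<in>S. ball x (e / 2)) \<subseteq> G"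
    proof clarify
      fix x y a b assume "x \<in> S" "y \<in> S" and d: "a \<in> ball x (e / 2)" "b \<in> ball y (e / 2)"
      have "dist (x, y) (a, b) \<le> dist x a + dist y b"
        unfolding dist_Pair_Pair by (rule sqrt_sum_squares_le_sum) auto
      then have "(a, b) \<in> ball (x, y) e" using d by simp
      then show "(a, b) \<in> G" using e(2) \<open>x \<in> S\<close> \<open>y \<in> S\<close> by blast
    qed
  qed (use e(1) in auto)
qed

context characteristic_flow
begin

lemma local_inverse:
  assumes U': "open U'" "U' \<subseteq> \<Omega>" "\<xi>0 \<in> U'" and inj: "inj (blinfun_apply (\<Psi>B (t0, \<xi>0)))"
  obtains N V g where "open N" "(t0, \<xi>0) \<in> N" "N \<subseteq> UNIV \<times> U'" "open V" "homeomorphism N V \<Psi> g"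
    "C1_open V g" "\<And>z. z \<in> N \<Longrightarrow> inj (blinfun_apply (\<Psi>B z))"
proof -
  have sub: "UNIV \<times> U' \<subseteq> UNIV \<times> \<Omega>" using U' by auto
  have op: "open (UNIV \<times> U')" using U' by (intro open_Times) auto
  have mem: "(t0, \<xi>0) \<in> UNIV \<times> U'" using U' by simp
  have der: "(\<Psi> has_derivative blinfun_apply (\<Psi>B z)) (at z)" if "z \<in> UNIV \<times> U'" for z
    unfolding \<Psi>B_apply[OF subsetD[OF sub that]] by (rule \<Psi>_derivative[OF subsetD[OF sub that]])
  obtain N V g where N: "open N" "(t0, \<xi>0) \<in> N" "N \<subseteq> UNIV \<times> U'" "open V" "homeomorphism N V \<Psi> g" "C1_open V g"
    and bij: "\<And>z. z \<in> N \<Longrightarrow> bij (blinfun_apply (\<Psi>B z))"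
    by (rule C1_local_inverse[OF op mem der continuous_on_subset[OF \<Psi>B_cont sub] inj]) (assumption, rule that, assumption+)
  show thesis by (rule that[OF N]) (use bij in \<open>auto simp: bij_def\<close>)
qed

text \<open>Inverting \<Psi> expresses \<open>d\<xi>\<close> through \<open>dt\<close> and
  \<open>dx\<close>; \<open>contact_relation\<close> then replaces
  \<open>exp (\<beta> * t) * (d\<xi> \<bullet> g0 \<xi>)\<close> by \<open>p\<close> paired with the
  part of \<open>dx\<close> that is not due to \<open>dt\<close>. Hence the spatial gradient is
  \<open>p\<close>, and the coefficient of \<open>dt\<close> is what the equation demands.\<close>

lemma value_derivative:
  assumes N: "N \<subseteq> UNIV \<times> U" and V: "open V" and hom: "homeomorphism N V \<Psi> g" and g: "C1_open V g"
    and z: "z \<in> V" "fst z \<in> {0..T}"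
  shows "((\<lambda>z. exp (\<beta> * fst z) * \<phi>0 (snd (g z))) has_derivative
    (\<lambda>h. fst h * (\<beta> * (exp (\<beta> * fst z) * \<phi>0 (snd (g z)))
          - fst (snd (J (g z))) \<bullet> (v (fst z) (snd z)
              + ((exp (\<beta> * fst z) * \<phi>0 (snd (g z))) / norm (fst (snd (J (g z))))) *\<^sub>R fst (snd (J (g z)))))
      + fst (snd (J (g z))) \<bullet> snd h)) (at z)"
proof -
  define t where "t = fst z"
  define \<xi> where "\<xi> = snd (g z)"
  define p where "p = fst (snd (J (g z)))"
  define u where "u = exp (\<beta> * t) * \<phi>0 \<xi>"
  have gzN: "g z \<in> N" and \<Psi>gz: "\<Psi> (g z) = z" using hom z by (auto simp: homeomorphism_def)
  then have gz: "g z = (t, \<xi>)" by (simp add: \<Psi>_def prod_eq_iff t_def \<xi>_def)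
  have \<xi>: "\<xi> \<in> U" "\<xi> \<in> \<Omega>" using gzN N U_\<Omega> by (auto simp: gz)
  have t: "t \<in> {0..T}" using z by (simp add: t_def)
  have J: "J (g z) = flw t (\<iota> \<xi>)" by (simp add: J_def gz)
  have Jx: "fst (J (g z)) = snd z" using \<Psi>gz by (simp add: \<Psi>_def prod_eq_iff)
  have Ju: "snd (snd (J (g z))) = u"
    using Y_value[OF good_U[OF \<xi>(1)], of t] Y_flw[OF \<xi>(1) t] t by (simp add: J u_def)
  have fJ: "fst (f t (J (g z))) = v t (snd z) + (u / norm p) *\<^sub>R p"
    using f_F[OF t flw_W[OF \<xi>(1) t]] by (simp add: J[symmetric] F_def Let_def Jx Ju p_def)
  obtain G where G: "(g has_derivative G) (at z)" using g z by (auto simp: C1_open_def)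
  have inv: "\<Psi>' (g z) (G h) = h" for h
  proof -
    have "((\<lambda>z. \<Psi> (g z)) has_derivative (\<lambda>h. \<Psi>' (g z) (G h))) (at z)"
      by (rule has_derivative_compose[OF G \<Psi>_derivative]) (use gz \<xi> in auto)
    then have "((\<lambda>z. z) has_derivative (\<lambda>h. \<Psi>' (g z) (G h))) (at z)"
      by (rule has_derivative_transform_within_open[OF _ V z(1)]) (use hom in \<open>auto simp: homeomorphism_def\<close>)
    then have "(\<lambda>h. \<Psi>' (g z) (G h)) = (\<lambda>h. h)" by (rule has_derivative_unique) (rule has_derivative_ident)
    then show ?thesis by meson
  qed
  have "((\<lambda>y. exp (\<beta> * fst y) * \<phi>0 (snd y)) has_derivative
      (\<lambda>h. exp (\<beta> * fst (g z)) * (snd h \<bullet> g0 (snd (g z))) + (exp (\<beta> * fst (g z)) * (\<beta> * fst h)) * \<phi>0 (snd (g z)))) (at (g z))"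
  proof (intro has_derivative_mult)
    show "((\<lambda>y. exp (\<beta> * fst y)) has_derivative (\<lambda>h. exp (\<beta> * fst (g z)) * (\<beta> * fst h))) (at (g z))"
      by (auto intro!: derivative_eq_intros)
    show "((\<lambda>y. \<phi>0 (snd y)) has_derivative (\<lambda>h. snd h \<bullet> g0 (snd (g z)))) (at (g z))"
      by (rule has_derivative_compose[OF has_derivative_snd[OF has_derivative_ident] \<phi>0_derivative]) (use gz \<xi> in auto)
  qed
  from has_derivative_compose[OF G this]
  have "((\<lambda>z. exp (\<beta> * fst (g z)) * \<phi>0 (snd (g z))) has_derivative
      (\<lambda>h. exp (\<beta> * t) * (snd (G h) \<bullet> g0 \<xi>) + (exp (\<beta> * t) * (\<beta> * fst (G h))) * \<phi>0 \<xi>)) (at z)"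
    by (simp add: gz)
  moreover have "exp (\<beta> * t) * (snd (G h) \<bullet> g0 \<xi>) + (exp (\<beta> * t) * (\<beta> * fst (G h))) * \<phi>0 \<xi>
      = fst h * (\<beta> * u - p \<bullet> (v t (snd z) + (u / norm p) *\<^sub>R p)) + p \<bullet> snd h" for h
  proof -
    let ?k = "G h"
    have h1: "fst h = fst ?k" using inv[of h] by (simp add: \<Psi>'_def prod_eq_iff)
    have "snd h = fst (J' (g z) ?k)" using inv[of h] by (simp add: \<Psi>'_def prod_eq_iff)
    also have "\<dots> = fst ?k *\<^sub>R (v t (snd z) + (u / norm p) *\<^sub>R p) + fst (dflw t (\<iota> \<xi>) (D\<iota> \<xi> (snd ?k)))"
      by (simp add: J'_def gz flip: fJ)
    finally have "p \<bullet> snd h = fst ?k * (p \<bullet> (v t (snd z) + (u / norm p) *\<^sub>R p)) + p \<bullet> fst (dflw t (\<iota> \<xi>) (D\<iota> \<xi> (snd ?k)))"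
      by (simp only: inner_add_right inner_scaleR_right)
    also have "p \<bullet> fst (dflw t (\<iota> \<xi>) (D\<iota> \<xi> (snd ?k))) = exp (\<beta> * t) * (snd ?k \<bullet> g0 \<xi>)"
      using contact_relation(1)[OF \<xi>(1) t, of "snd ?k"] by (simp add: p_def J)
    finally show ?thesis by (simp add: h1 u_def algebra_simps)
  qed
  ultimately have "((\<lambda>z. exp (\<beta> * fst (g z)) * \<phi>0 (snd (g z))) has_derivative
      (\<lambda>h. fst h * (\<beta> * u - p \<bullet> (v t (snd z) + (u / norm p) *\<^sub>R p)) + p \<bullet> snd h)) (at z)"
    by (simp only:)
  then have "((\<lambda>z. exp (\<beta> * fst z) * \<phi>0 (snd (g z))) has_derivative
      (\<lambda>h. fst h * (\<beta> * u - p \<bullet> (v t (snd z) + (u / norm p) *\<^sub>R p)) + p \<bullet> snd h)) (at z)"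
  proof (rule has_derivative_transform_within_open[OF _ V z(1)])
    fix y assume "y \<in> V"
    then have "\<Psi> (g y) = y" using hom by (simp add: homeomorphism_def)
    then have "fst (g y) = fst y" by (metis \<Psi>_def fst_conv)
    then show "exp (\<beta> * fst (g y)) * \<phi>0 (snd (g y)) = exp (\<beta> * fst y) * \<phi>0 (snd (g y))" by simp
  qed
  then show ?thesis by (simp add: u_def p_def t_def \<xi>_def)
qed

text \<open>For injectivity consider a time together with two points of the surface. Either the
  positions differ, an open condition (\<open>G1\<close>), or the points coincide and lie in a set
  on which \<Psi> is injective (\<open>G2\<close>). The alternative persists on a neighbourhood of
  the compact set of all such triples.\<close>

lemma exists_diffeo_neighborhood:
  obtains U1 where "open U1" "S0 \<subseteq> U1" "U1 \<subseteq> U"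
    "\<And>t \<xi>. t \<in> {0..T} \<Longrightarrow> \<xi> \<in> U1 \<Longrightarrow> inj (blinfun_apply (\<Psi>B (t, \<xi>)))"
    "\<And>t. t \<in> {0..T} \<Longrightarrow> inj_on (\<lambda>\<xi>. fst (Y t \<xi>)) U1"
proof -
  define \<N> where "\<N> = {N. open N \<and> N \<subseteq> UNIV \<times> U \<and> inj_on \<Psi> N \<and> (\<forall>z\<in>N. inj (blinfun_apply (\<Psi>B z)))}"
  have loc: "\<exists>N\<in>\<N>. (t, \<xi>) \<in> N" if t: "t \<in> {0..T}" and \<xi>: "\<xi> \<in> S0" for t \<xi>
  proof -
    have "\<xi> \<in> U" using \<xi> S0_U by auto
    obtain N V g where "open N" "(t, \<xi>) \<in> N" "N \<subseteq> UNIV \<times> U" "open V" "homeomorphism N V \<Psi> g"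
      "C1_open V g" "\<And>z. z \<in> N \<Longrightarrow> inj (blinfun_apply (\<Psi>B z))"
      by (rule local_inverse[OF open_U U_\<Omega> \<open>\<xi> \<in> U\<close> \<Psi>'_inj_S0[OF \<xi> t]]) blast
    moreover from this have "inj_on \<Psi> N" unfolding homeomorphism_def by (intro inj_on_inverseI[of N g]) auto
    ultimately show ?thesis unfolding \<N>_def by blast
  qed
  have op\<N>: "open (\<Union>\<N>)" by (rule open_Union) (simp add: \<N>_def)
  have "{0..T} \<times> S0 \<subseteq> \<Union>\<N>" using loc by blast
  then obtain U2 where U2: "open U2" "S0 \<subseteq> U2" "{0..T} \<times> U2 \<subseteq> \<Union>\<N>"
    by (rule compact_Times_open_neighborhood[OF compact_Icc compact_S0 op\<N>])
  define d where "d q = fst (J (fst q, fst (snd q))) - fst (J (fst q, snd (snd q)))" for q :: "real \<times> (real^3) \<times> (real^3)"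
  define G1 where "G1 = (UNIV \<times> U \<times> U) \<inter> d -` (- {0})"
  define G2 where "G2 = (\<Union>N\<in>\<N>. (\<lambda>q. (fst q, fst (snd q))) -` N \<inter> (\<lambda>q. (fst q, snd (snd q))) -` N)"
  have UU: "open (UNIV \<times> U \<times> U)" by (intro open_Times open_UNIV open_U)
  have "continuous_on (UNIV \<times> U \<times> U) d"
    unfolding d_def using U_\<Omega>
    by (intro continuous_on_diff continuous_on_fst continuous_on_compose2[OF J_cont])
      (auto intro!: continuous_intros)
  then have G1: "open G1" unfolding G1_def by (rule continuous_open_preimage) (auto intro: UU)
  have G2: "open G2" unfolding G2_def
  proof (intro open_UN ballI open_Int)
    fix N assume "N \<in> \<N>"
    then have "open N" by (simp add: \<N>_def)
    then show "open ((\<lambda>q. (fst q, fst (snd q))) -` N :: (real \<times> (real^3) \<times> (real^3)) set)"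
      "open ((\<lambda>q. (fst q, snd (snd q))) -` N :: (real \<times> (real^3) \<times> (real^3)) set)"
      by (auto intro!: open_vimage continuous_intros)
  qed
  have "{0..T} \<times> (S0 \<times> S0) \<subseteq> G1 \<union> G2"
  proof clarify
    fix t \<xi> \<zeta> assume t: "t \<in> {0..T}" and S: "\<xi> \<in> S0" "\<zeta> \<in> S0" and n: "(t, \<xi>, \<zeta>) \<notin> G2"
    have "\<xi> \<noteq> \<zeta>" using loc[OF t S(1)] n by (auto simp: G2_def)
    then have "fst (Y t \<xi>) \<noteq> fst (Y t \<zeta>)" using S0_X_inject[OF S] t by auto
    then have "d (t, \<xi>, \<zeta>) \<noteq> 0" using Y_flw[OF subsetD[OF S0_U S(1)] t] Y_flw[OF subsetD[OF S0_U S(2)] t]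
      by (simp add: d_def J_def)
    then show "(t, \<xi>, \<zeta>) \<in> G1" using S S0_U by (auto simp: G1_def)
  qed
  then obtain U3 where U3: "open U3" "S0 \<times> S0 \<subseteq> U3" "{0..T} \<times> U3 \<subseteq> G1 \<union> G2"
    by (rule compact_Times_open_neighborhood[OF compact_Icc compact_Times[OF compact_S0 compact_S0] open_Un[OF G1 G2]])
  obtain U4 where U4: "open U4" "S0 \<subseteq> U4" "U4 \<times> U4 \<subseteq> U3"
    by (rule compact_square_neighborhood[OF compact_S0 U3(1,2)])
  show thesis
  proof (rule that[of "U \<inter> U2 \<inter> U4"])
    show "open (U \<inter> U2 \<inter> U4)" using open_U U2 U4 by auto
    show "S0 \<subseteq> U \<inter> U2 \<inter> U4" using S0_U U2 U4 by auto
    show "inj (blinfun_apply (\<Psi>B (t, \<xi>)))" if "t \<in> {0..T}" "\<xi> \<in> U \<inter> U2 \<inter> U4" for t \<xi>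
    proof -
      have "(t, \<xi>) \<in> \<Union>\<N>" using subsetD[OF U2(3), of "(t, \<xi>)"] that by blast
      then show ?thesis by (auto simp: \<N>_def)
    qed
    show "inj_on (\<lambda>\<xi>. fst (Y t \<xi>)) (U \<inter> U2 \<inter> U4)" if t: "t \<in> {0..T}" for t
    proof (rule inj_onI)
      fix \<xi> \<zeta> assume U: "\<xi> \<in> U \<inter> U2 \<inter> U4" "\<zeta> \<in> U \<inter> U2 \<inter> U4" and eq: "fst (Y t \<xi>) = fst (Y t \<zeta>)"
      have "(\<xi>, \<zeta>) \<in> U3" using U U4(3) by blast
      then have "(t, \<xi>, \<zeta>) \<in> G1 \<union> G2" using subsetD[OF U3(3), of "(t, \<xi>, \<zeta>)"] t by simp
      moreover have Jeq: "fst (J (t, \<xi>)) = fst (J (t, \<zeta>))" using eq Y_flw[OF _ t] U by (simp add: J_def)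
      then have "(t, \<xi>, \<zeta>) \<notin> G1" by (simp add: G1_def d_def)
      ultimately obtain N where N: "N \<in> \<N>" "(t, \<xi>) \<in> N" "(t, \<zeta>) \<in> N" by (auto simp: G2_def)
      have "\<Psi> (t, \<xi>) = \<Psi> (t, \<zeta>)" using Jeq by (simp add: \<Psi>_def)
      moreover have "inj_on \<Psi> N" using N(1) by (simp add: \<N>_def)
      ultimately have "(t, \<xi>) = (t, \<zeta>)" using N(2,3) by (rule_tac inj_onD)
      then show "\<xi> = \<zeta>" by simp
    qed
  qed auto
qed

end

context level_set_problem
begin

text \<open>The outcome is phrased through \<open>Y\<close> only and hides the truncated field,
  whose choice depends on \<open>T\<close>. Preimages can be kept in any smaller open
  \<open>U'\<close> because the neighbourhoods shrink again when all horizons are combined.\<close>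

lemma local_package:
  assumes T: "0 \<le> T"
  obtains U where "open U" "S0 \<subseteq> U" "U \<subseteq> \<Omega>" "\<And>\<xi>. \<xi> \<in> U \<Longrightarrow> good T \<xi>"
    "\<And>t. t \<in> {0..T} \<Longrightarrow> inj_on (\<lambda>\<xi>. fst (Y t \<xi>)) U"
    "\<And>U' t0 \<xi>0. open U' \<Longrightarrow> U' \<subseteq> U \<Longrightarrow> \<xi>0 \<in> U' \<Longrightarrow> t0 \<in> {0..T} \<Longrightarrow>
      \<exists>V q P. open V \<and> (t0, fst (Y t0 \<xi>0)) \<in> V \<and> C1_open V P \<and>
        (\<forall>z\<in>V. fst z \<in> {0..T} \<longrightarrow> q z \<in> U' \<and> fst (Y (fst z) (q z)) = snd z \<and> P z = fst (snd (Y (fst z) (q z))) \<and>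
          ((\<lambda>z. exp (\<beta> * fst z) * \<phi>0 (q z)) has_derivative
            (\<lambda>h. fst h * (\<beta> * (exp (\<beta> * fst z) * \<phi>0 (q z))
              - P z \<bullet> (v (fst z) (snd z) + ((exp (\<beta> * fst z) * \<phi>0 (q z)) / norm (P z)) *\<^sub>R P z))
             + P z \<bullet> snd h)) (at z))"
proof -
  obtain f Df L M W U where C1: "C1_field f Df L M"
    and *: "\<And>t y. t \<in> {0..T} \<Longrightarrow> y \<in> W \<Longrightarrow> f t y = F t y"
    "\<And>t y. t \<in> {0..T} \<Longrightarrow> y \<in> W \<Longrightarrow> blinfun_apply (Df t y) = F' t y"
    "W \<subseteq> D" "open U" "S0 \<subseteq> U" "U \<subseteq> \<Omega>"
    "\<And>\<xi> t. \<xi> \<in> U \<Longrightarrow> t \<in> {0..T} \<Longrightarrow> lipschitz_field.flw f t (\<iota> \<xi>) \<in> W"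
    "\<And>\<xi>. \<xi> \<in> U \<Longrightarrow> good T \<xi>"
    "\<And>\<xi> t. \<xi> \<in> U \<Longrightarrow> t \<in> {0..T} \<Longrightarrow> Y t \<xi> = lipschitz_field.flw f t (\<iota> \<xi>)"
    by (rule local_flow[OF T]) blast
  interpret C: C1_field f Df L M by (rule C1)
  interpret characteristic_flow \<Omega> v w w2 \<beta> \<phi>0 g0 H0 S0 \<alpha> f Df L M T W U
    by unfold_locales (use T * in auto)
  obtain U1 where U1: "open U1" "S0 \<subseteq> U1" "U1 \<subseteq> U"
    and inj1: "\<And>t \<xi>. t \<in> {0..T} \<Longrightarrow> \<xi> \<in> U1 \<Longrightarrow> inj (blinfun_apply (\<Psi>B (t, \<xi>)))"
    and inj2: "\<And>t. t \<in> {0..T} \<Longrightarrow> inj_on (\<lambda>\<xi>. fst (Y t \<xi>)) U1"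
    by (rule exists_diffeo_neighborhood) (rule that, assumption+)
  show thesis
  proof (rule that[OF U1(1,2) _ _ inj2])
    show "U1 \<subseteq> \<Omega>" using U1 U_\<Omega> by auto
    show "good T \<xi>" if "\<xi> \<in> U1" for \<xi> using good_U U1 that by auto
    fix U' t0 \<xi>0 assume U': "open U'" "U' \<subseteq> U1" and \<xi>0: "\<xi>0 \<in> U'" and t0: "t0 \<in> {0..T}"
    have U'\<Omega>: "U' \<subseteq> \<Omega>" and U'U: "U' \<subseteq> U" using U' U1 U_\<Omega> by auto
    obtain N V g where N: "open N" "(t0, \<xi>0) \<in> N" "N \<subseteq> UNIV \<times> U'" and V: "open V"
      and hom: "homeomorphism N V \<Psi> g" and g: "C1_open V g"
    proof (rule local_inverse[OF U'(1) U'\<Omega> \<xi>0 inj1[OF t0]])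
      show "\<xi>0 \<in> U1" using \<xi>0 U' by auto
    qed blast
    have NU: "N \<subseteq> UNIV \<times> U" using N U'U by auto
    have gN: "g z \<in> N" "\<Psi> (g z) = z" if "z \<in> V" for z using hom that by (auto simp: homeomorphism_def)
    have fg: "fst (g z) = fst z" "fst (J (g z)) = snd z" if "z \<in> V" for z
      using gN(2)[OF that] by (auto simp: \<Psi>_def prod_eq_iff)
    have gU: "snd (g z) \<in> U'" if "z \<in> V" for z using gN(1)[OF that] N(3) by auto
    have JY: "J (g z) = Y (fst z) (snd (g z))" if "z \<in> V" "fst z \<in> {0..T}" for z
      using Y_flw[of "snd (g z)" "fst z"] gU[OF that(1)] U'U that fg[OF that(1)] by (auto simp: J_def)
    have P_C1: "C1_open V (\<lambda>z. fst (snd (J (g z))))"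
    proof -
      have "C1_open V (\<lambda>z. J (g z))"
        by (rule C1_open_compose[OF g J_C1[of N]]) (use gN NU U_\<Omega> in auto)
      from C1_open_compose[OF this C1_open_bounded_linear[OF bounded_linear_compose[OF bounded_linear_fst bounded_linear_snd], of UNIV]]
      show ?thesis by simp
    qed
    show "\<exists>V q P. open V \<and> (t0, fst (Y t0 \<xi>0)) \<in> V \<and> C1_open V P \<and>
        (\<forall>z\<in>V. fst z \<in> {0..T} \<longrightarrow> q z \<in> U' \<and> fst (Y (fst z) (q z)) = snd z \<and> P z = fst (snd (Y (fst z) (q z))) \<and>
          ((\<lambda>z. exp (\<beta> * fst z) * \<phi>0 (q z)) has_derivative
            (\<lambda>h. fst h * (\<beta> * (exp (\<beta> * fst z) * \<phi>0 (q z))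
              - P z \<bullet> (v (fst z) (snd z) + ((exp (\<beta> * fst z) * \<phi>0 (q z)) / norm (P z)) *\<^sub>R P z))
             + P z \<bullet> snd h)) (at z))"
    proof (rule exI[of _ V], rule exI[of _ "\<lambda>z. snd (g z)"], rule exI[of _ "\<lambda>z. fst (snd (J (g z)))"],
        intro conjI ballI impI V P_C1)
      have "\<Psi> (t0, \<xi>0) \<in> V" using hom N(2) by (auto simp: homeomorphism_def)
      then show "(t0, fst (Y t0 \<xi>0)) \<in> V" using Y_flw[of \<xi>0 t0] \<xi>0 U'U t0 by (auto simp: \<Psi>_def J_def)
      fix z assume z: "z \<in> V" "fst z \<in> {0..T}"
      show "snd (g z) \<in> U'" by (rule gU[OF z(1)])
      show "fst (Y (fst z) (snd (g z))) = snd z" using fg(2)[OF z(1)] JY[OF z] by simp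
      show "fst (snd (J (g z))) = fst (snd (Y (fst z) (snd (g z))))" using JY[OF z] by simp
      show "((\<lambda>z. exp (\<beta> * fst z) * \<phi>0 (snd (g z))) has_derivative
            (\<lambda>h. fst h * (\<beta> * (exp (\<beta> * fst z) * \<phi>0 (snd (g z)))
              - fst (snd (J (g z))) \<bullet> (v (fst z) (snd z) + ((exp (\<beta> * fst z) * \<phi>0 (snd (g z))) / norm (fst (snd (J (g z))))) *\<^sub>R fst (snd (J (g z)))))
             + fst (snd (J (g z))) \<bullet> snd h)) (at z)"
        by (rule value_derivative[OF NU V hom g z])
    qed
  qed
qed

end

section \<open>Differentiability on relatively open sets\<close>

lemma Ck_on_subset: "Ck_on k S f \<Longrightarrow> T \<subseteq> S \<Longrightarrow> Ck_on k T f"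
proof (induction k arbitrary: f)
  case 0
  then show ?case using continuous_on_subset[of S f T] by simp
next
  case (Suc k)
  then obtain f' where "\<forall>z\<in>S. (f has_derivative f' z) (at z within S)" "\<forall>h. Ck_on k S (\<lambda>z. f' z h)" by auto
  then have "\<forall>z\<in>T. (f has_derivative f' z) (at z within T)" "\<forall>h. Ck_on k T (\<lambda>z. f' z h)"
    using Suc by (auto intro: has_derivative_subset)
  then show ?case by auto
qed

lemma Ck_on_cong: "Ck_on k S f \<Longrightarrow> (\<And>z. z \<in> S \<Longrightarrow> f z = g z) \<Longrightarrow> Ck_on k S g"
proof (induction k arbitrary: f g)
  case 0
  then show ?case using continuous_on_eq[of S f g] by simp
next
  case (Suc k)
  then obtain f' where f': "\<forall>z\<in>S. (f has_derivative f' z) (at z within S)" "\<forall>h. Ck_on k S (\<lambda>z. f' z h)" by auto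
  have "(g has_derivative f' z) (at z within S)" if "z \<in> S" for z
    by (rule has_derivative_transform[OF that, of g f]) (use f' Suc that in auto)
  then show ?case using f' by auto
qed

lemma Ck_on_1_iff:
  "Ck_on 1 S f \<longleftrightarrow> (\<exists>f'. (\<forall>z\<in>S. (f has_derivative f' z) (at z within S)) \<and> (\<forall>h. continuous_on S (\<lambda>z. f' z h)))"
  unfolding One_nat_def Ck_on.simps ..

lemma Ck_on_2_iff:
  "Ck_on 2 S f \<longleftrightarrow> (\<exists>f'. (\<forall>z\<in>S. (f has_derivative f' z) (at z within S)) \<and> (\<forall>h. Ck_on 1 S (\<lambda>z. f' z h)))"
  unfolding numeral_2_eq_2 One_nat_def Ck_on.simps ..

lemma Ck_on_1_continuous: "Ck_on 1 S f \<Longrightarrow> continuous_on S f"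
  unfolding Ck_on_1_iff by (elim exE conjE) (rule has_derivative_continuous_on, blast)

lemma C1_open_imp_Ck_on:
  assumes "C1_open V f" shows "Ck_on 1 V f"
proof -
  obtain f' where f': "\<And>z. z \<in> V \<Longrightarrow> (f has_derivative blinfun_apply (f' z)) (at z)" "continuous_on V f'"
    using assms by (auto simp: C1_open_def)
  show ?thesis unfolding Ck_on_1_iff
    by (intro exI[of _ "\<lambda>z. blinfun_apply (f' z)"] conjI ballI allI has_derivative_at_withinI[OF f'(1)]
        blinfun.continuous_on f'(2) continuous_on_const)
qed

lemma Ck_on_1_const: "Ck_on 1 S (\<lambda>z. c)"
  unfolding Ck_on_1_iff by (intro exI[of _ "\<lambda>_ _. 0"]) auto

lemma Ck_on_1_add:
  assumes "Ck_on 1 S f" "Ck_on 1 S g" shows "Ck_on 1 S (\<lambda>z. f z + g z)"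
proof -
  obtain f' g' where f': "\<And>z. z \<in> S \<Longrightarrow> (f has_derivative f' z) (at z within S)" "\<And>h. continuous_on S (\<lambda>z. f' z h)"
    and g': "\<And>z. z \<in> S \<Longrightarrow> (g has_derivative g' z) (at z within S)" "\<And>h. continuous_on S (\<lambda>z. g' z h)"
    using assms unfolding Ck_on_1_iff by blast
  show ?thesis unfolding Ck_on_1_iff
    by (intro exI[of _ "\<lambda>z h. f' z h + g' z h"] conjI ballI allI has_derivative_add continuous_on_add f' g')
qed

lemma Ck_on_1_bilinear:
  assumes b: "bounded_bilinear b" and "Ck_on 1 S f" "Ck_on 1 S g"
  shows "Ck_on 1 S (\<lambda>z. b (f z) (g z))"
proof -
  obtain f' g' where f': "\<And>z. z \<in> S \<Longrightarrow> (f has_derivative f' z) (at z within S)" "\<And>h. continuous_on S (\<lambda>z. f' z h)"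
    and g': "\<And>z. z \<in> S \<Longrightarrow> (g has_derivative g' z) (at z within S)" "\<And>h. continuous_on S (\<lambda>z. g' z h)"
    using assms unfolding Ck_on_1_iff by blast
  have fc: "continuous_on S f" "continuous_on S g"
    by (rule Ck_on_1_continuous[OF assms(2)], rule Ck_on_1_continuous[OF assms(3)])
  show ?thesis unfolding Ck_on_1_iff
    by (intro exI[of _ "\<lambda>z h. b (f z) (g' z h) + b (f' z h) (g z)"] conjI ballI allI
        bounded_bilinear.FDERIV[OF b] continuous_on_add bounded_bilinear.continuous_on[OF b] f' g' fc)
qed

lemmas Ck_on_1_inner = Ck_on_1_bilinear[OF bounded_bilinear_inner]
lemmas Ck_on_1_mult = Ck_on_1_bilinear[OF bounded_bilinear_mult]
lemmas Ck_on_1_scaleR = Ck_on_1_bilinear[OF bounded_bilinear_scaleR]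

lemma Ck_on_1_diff:
  fixes f g :: "'a::euclidean_space \<Rightarrow> 'b::real_normed_vector"
  assumes "Ck_on 1 S f" "Ck_on 1 S g" shows "Ck_on 1 S (\<lambda>z. f z - g z)"
  using Ck_on_1_add[OF assms(1) Ck_on_1_scaleR[OF Ck_on_1_const[of S "- 1"] assms(2)]] by simp

lemma Ck_on_1_inverse_norm:
  fixes f :: "'a::euclidean_space \<Rightarrow> 'b::real_inner"
  assumes "Ck_on 1 S f" and nz: "\<And>z. z \<in> S \<Longrightarrow> f z \<noteq> 0"
  shows "Ck_on 1 S (\<lambda>z. inverse (norm (f z)))"
proof -
  obtain f' where f': "\<And>z. z \<in> S \<Longrightarrow> (f has_derivative f' z) (at z within S)" "\<And>h. continuous_on S (\<lambda>z. f' z h)"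
    using assms unfolding Ck_on_1_iff by blast
  have fc: "continuous_on S f" by (rule Ck_on_1_continuous[OF assms(1)])
  have N: "((\<lambda>z. norm (f z)) has_derivative (\<lambda>h. f' z h \<bullet> sgn (f z))) (at z within S)" if "z \<in> S" for z
    by (rule has_derivative_compose[OF f'(1)[OF that] has_derivative_norm[OF nz[OF that]]])
  show ?thesis unfolding Ck_on_1_iff
  proof (intro exI[of _ "\<lambda>z h. - (inverse (norm (f z)) * (f' z h \<bullet> sgn (f z)) * inverse (norm (f z)))"] conjI ballI allI)
    fix z assume z: "z \<in> S"
    show "((\<lambda>z. inverse (norm (f z))) has_derivative
        (\<lambda>h. - (inverse (norm (f z)) * (f' z h \<bullet> sgn (f z)) * inverse (norm (f z))))) (at z within S)"
      by (rule Deriv.has_derivative_inverse[OF _ N[OF z]]) (use nz[OF z] in simp)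
  next
    fix h
    show "continuous_on S (\<lambda>z. - (inverse (norm (f z)) * (f' z h \<bullet> sgn (f z)) * inverse (norm (f z))))"
      unfolding sgn_div_norm
      by (intro continuous_on_minus continuous_on_mult continuous_on_inner continuous_on_inverse
          continuous_on_norm continuous_on_scaleR f' fc) (use nz in auto)
  qed
qed

definition time_open :: "(real \<times> 'a::euclidean_space) set \<Rightarrow> bool" where
  "time_open S \<longleftrightarrow> openin (top_of_set ({0..} \<times> UNIV)) S"

lemma time_open_subset: "time_open S \<Longrightarrow> S \<subseteq> {0..} \<times> UNIV"
  unfolding time_open_def by (simp add: openin_imp_subset)

lemma time_open_ball:
  assumes "time_open S" "z \<in> S"
  obtains r where "r > 0" "\<And>y. dist y z < r \<Longrightarrow> 0 \<le> fst y \<Longrightarrow> y \<in> S"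
proof -
  obtain U where U: "open U" "S = ({0..} \<times> UNIV) \<inter> U" using assms(1) by (auto simp: time_open_def openin_open)
  then have "z \<in> U" using assms(2) by simp
  then obtain r where "r > 0" "ball z r \<subseteq> U" using U(1) open_contains_ball by blast
  then show thesis using U(2) by (intro that[of r]) (auto simp: dist_commute mem_Times_iff)
qed

text \<open>Even at \<open>t = 0\<close>, small positive multiples of each basis vector lead from
  the point into \<open>S\<close>, and these directions determine the derivative.\<close>

lemma time_open_derivative_unique:
  fixes f :: "real \<times> 'a::euclidean_space \<Rightarrow> 'b::real_normed_vector"
  assumes S: "time_open S" "z \<in> S"
    and f: "(f has_derivative f1) (at z within S)" "(f has_derivative f2) (at z within S)"
  shows "f1 = f2"
proof (rule frechet_derivative_unique_within[OF f])
  fix i :: "real \<times> 'a" and e :: real assume i: "i \<in> Basis" and e: "e > 0"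
  obtain r where r: "r > 0" "\<And>y. dist y z < r \<Longrightarrow> 0 \<le> fst y \<Longrightarrow> y \<in> S"
    using time_open_ball[OF S] by blast
  let ?d = "min e r / 2"
  have "fst i \<ge> 0" using i by (auto simp: Basis_prod_def)
  moreover have "fst z \<ge> 0" using time_open_subset[OF S(1)] S(2) by auto
  ultimately have "0 \<le> fst (z + ?d *\<^sub>R i)" using e r(1) by simp
  moreover have "dist (z + ?d *\<^sub>R i) z < r" using i e r(1) by (simp add: dist_norm)
  ultimately have "z + ?d *\<^sub>R i \<in> S" by (intro r(2))
  then show "\<exists>d. 0 < \<bar>d\<bar> \<and> \<bar>d\<bar> < e \<and> z + d *\<^sub>R i \<in> S" using e r(1) by (intro exI[of _ ?d]) auto
qed

lemma at_within_Int_open: "open V \<Longrightarrow> z \<in> V \<Longrightarrow> at z within (S \<inter> V) = at z within S"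
  by (rule at_within_nhd[of _ V]) auto

text \<open>Local derivatives are chosen point by point. Uniqueness makes the choices agree on
  overlaps, so the diagonal \<open>f' y y\<close> is one derivative on all of \<open>S\<close> with
  the regularity of each piece.\<close>

lemma Ck_on_local:
  fixes f :: "real \<times> 'a::euclidean_space \<Rightarrow> 'b::real_normed_vector"
  assumes "time_open S" "\<And>z. z \<in> S \<Longrightarrow> \<exists>V. open V \<and> z \<in> V \<and> Ck_on k (S \<inter> V) f"
  shows "Ck_on k S f"
  using assms
proof (induction k arbitrary: f)
  case 0
  have "continuous (at z within S) f" if z: "z \<in> S" for z
  proof -
    obtain V where "open V" "z \<in> V" "continuous_on (S \<inter> V) f" using 0(2)[OF z] by auto
    then show ?thesis using z at_within_Int_open[of V z S]
      by (metis IntI continuous_on_eq_continuous_within)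
  qed
  then show ?case by (simp add: continuous_on_eq_continuous_within)
next
  case (Suc k)
  have "\<forall>z\<in>S. \<exists>V f'. open V \<and> z \<in> V \<and> (\<forall>y\<in>S \<inter> V. (f has_derivative f' y) (at y within S \<inter> V)) \<and>
      (\<forall>h. Ck_on k (S \<inter> V) (\<lambda>y. f' y h))"
    using Suc.prems(2) by simp
  then obtain V f' where V: "\<And>z. z \<in> S \<Longrightarrow> open (V z)" "\<And>z. z \<in> S \<Longrightarrow> z \<in> V z"
    and f': "\<And>z y. z \<in> S \<Longrightarrow> y \<in> S \<inter> V z \<Longrightarrow> (f has_derivative f' z y) (at y within S \<inter> V z)"
      "\<And>z h. z \<in> S \<Longrightarrow> Ck_on k (S \<inter> V z) (\<lambda>y. f' z y h)" by metis
  have der: "(f has_derivative f' z y) (at y within S)" if "z \<in> S" "y \<in> S \<inter> V z" for z y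
    using f'(1)[OF that] at_within_Int_open[of "V z" y S] V that by auto
  have eq: "f' y y = f' z y" if "z \<in> S" "y \<in> S \<inter> V z" for z y
    by (rule time_open_derivative_unique[OF Suc.prems(1) _ der der]) (use V that in auto)
  show ?case unfolding Ck_on.simps
  proof (intro exI[of _ "\<lambda>y. f' y y"] conjI ballI allI)
    show "(f has_derivative f' z z) (at z within S)" if "z \<in> S" for z using der[of z z] V that by auto
    fix h
    show "Ck_on k S (\<lambda>z. f' z z h)"
    proof (rule Suc.IH[OF Suc.prems(1)])
      fix z assume z: "z \<in> S"
      have "Ck_on k (S \<inter> V z) (\<lambda>y. f' y y h)"
        by (rule Ck_on_cong[OF f'(2)[OF z, of h]]) (use eq[OF z] in simp)
      then show "\<exists>V. open V \<and> z \<in> V \<and> Ck_on k (S \<inter> V) (\<lambda>z. f' z z h)" using V z by blast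
    qed
  qed
qed

lemma GDERIV_imp_grad: "GDERIV f x :> D \<Longrightarrow> grad f x = D"
  unfolding grad_def
proof (rule the_equality)
  fix E assume "GDERIV f x :> D" "GDERIV f x :> E"
  then have "(\<lambda>h. h \<bullet> E) = (\<lambda>h. h \<bullet> D)" unfolding gderiv_def by (rule has_derivative_unique[rotated])
  then have "(E - D) \<bullet> E = (E - D) \<bullet> D" by (rule fun_cong)
  then have "(E - D) \<bullet> (E - D) = 0" by (simp add: inner_diff_right)
  then show "E = D" by simp
qed

lemma linear_slice:
  fixes d :: "'b::real_normed_vector \<times> 'a::real_normed_vector \<Rightarrow> 'c::real_normed_vector"
  assumes "bounded_linear d" shows "linear (\<lambda>h. d (0, h))"
  by (intro bounded_linear.linear bounded_linear_compose[OF assms] bounded_linear_Pair bounded_linear_zero bounded_linear_ident)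

lemma linear_slice_inner:
  fixes d :: "real \<times> 'a::euclidean_space \<Rightarrow> real"
  assumes d: "bounded_linear d"
  shows "d (0, h) = h \<bullet> (\<Sum>b\<in>Basis. d (0, b) *\<^sub>R b)"
proof -
  note lin = linear_slice[OF d]
  have "d (0, \<Sum>b\<in>Basis. (h \<bullet> b) *\<^sub>R b) = (\<Sum>b\<in>Basis. (h \<bullet> b) *\<^sub>R d (0, b))"
    using linear_sum[OF lin, of "\<lambda>b. (h \<bullet> b) *\<^sub>R b" Basis] linear_scale[OF lin] by simp
  then show ?thesis
    by (simp add: euclidean_representation inner_sum_right mult.commute)
qed

text \<open>Translates a joint derivative within \<open>S\<close> into the two derivatives that
  \<open>C2_solution\<close> mentions: in time it is one-sided at \<open>t = 0\<close>, in space it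
  is full because the time slices of \<open>S\<close> are open.\<close>

lemma slice_derivatives:
  fixes \<psi> :: "real \<Rightarrow> 'a::euclidean_space \<Rightarrow> real"
  assumes S: "time_open S" "(t, x) \<in> S" and der: "((\<lambda>(t, x). \<psi> t x) has_derivative d) (at (t, x) within S)"
  shows "vector_derivative (\<lambda>s. \<psi> s x) (at t within {0..}) = d (1, 0)"
    and "GDERIV (\<psi> t) x :> (\<Sum>b\<in>Basis. d (0, b) *\<^sub>R b)"
proof -
  have d: "bounded_linear d" by (rule has_derivative_bounded_linear[OF der])
  obtain r where r: "r > 0" "\<And>y. dist y (t, x) < r \<Longrightarrow> 0 \<le> fst y \<Longrightarrow> y \<in> S"
    using time_open_ball[OF S] by blast
  have t: "0 \<le> t" using time_open_subset[OF S(1)] S(2) by auto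
  have 1: "((\<lambda>s. (s, x)) has_derivative (\<lambda>h. (h, 0))) (at t within {0..} \<inter> ball t r)"
    by (intro has_derivative_Pair has_derivative_ident has_derivative_const)
  have 2: "(\<lambda>s. (s, x)) ` ({0..} \<inter> ball t r) \<subseteq> S"
    using r(2) by (auto simp: dist_Pair_Pair dist_commute)
  from has_derivative_in_compose[OF 1 has_derivative_subset[OF der 2]]
  have "((\<lambda>s. case (s, x) of (t, x) \<Rightarrow> \<psi> t x) has_derivative (\<lambda>h. d (h, 0))) (at t within {0..} \<inter> ball t r)" .
  then have "((\<lambda>s. \<psi> s x) has_derivative (\<lambda>h. d (h, 0))) (at t within {0..})"
    using at_within_Int_open[of "ball t r" t "{0..}"] r(1) by simp
  moreover have "(\<lambda>h. d (h, 0)) = (\<lambda>h. h *\<^sub>R d (1, 0))"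
  proof
    show "d (h, 0) = h *\<^sub>R d (1, 0)" for h
      using linear_scale[OF bounded_linear.linear[OF d], of h "(1, 0)"] by simp
  qed
  ultimately have "((\<lambda>s. \<psi> s x) has_vector_derivative d (1, 0)) (at t within {0..})"
    unfolding has_vector_derivative_def by (simp only:)
  then show "vector_derivative (\<lambda>s. \<psi> s x) (at t within {0..}) = d (1, 0)"
  proof (rule vector_derivative_within[rotated])
    have "at_right t \<le> at t within {0..}" by (rule at_le) (use t in auto)
    then show "at t within {0..} \<noteq> bot" using trivial_limit_at_right_real[of t] bot.extremum_uniqueI by fastforce
  qed
  have 3: "((\<lambda>y. (t, y)) has_derivative (\<lambda>h. (0, h))) (at x within ball x r)"
    by (rule has_derivative_Pair[OF has_derivative_const has_derivative_ident])
  have 4: "(\<lambda>y. (t, y)) ` ball x r \<subseteq> S"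
    using r(2) t by (auto simp: dist_Pair_Pair dist_commute)
  from has_derivative_in_compose[OF 3 has_derivative_subset[OF der 4]] have "((\<lambda>y. case (t, y) of (t, x) \<Rightarrow> \<psi> t x) has_derivative (\<lambda>h. d (0, h))) (at x within ball x r)" .
  then have "(\<psi> t has_derivative (\<lambda>h. d (0, h))) (at x)"
    using at_within_open[of x "ball x r"] r(1) by simp
  moreover have "(\<lambda>h. d (0, h)) = (\<lambda>h. h \<bullet> (\<Sum>b\<in>Basis. d (0, b) *\<^sub>R b))"
    by (rule ext) (rule linear_slice_inner[OF d])
  ultimately show "GDERIV (\<psi> t) x :> (\<Sum>b\<in>Basis. d (0, b) *\<^sub>R b)"
    unfolding gderiv_def by (simp only:)
qed

section \<open>Symmetry of second derivatives\<close>

lemma second_difference_limit: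
  fixes f :: "'a::real_normed_vector \<Rightarrow> real"
  assumes V: "open V" "z \<in> V"
    and f': "\<And>y. y \<in> V \<Longrightarrow> (f has_derivative f' y) (at y)"
    and f'': "\<And>y. y \<in> V \<Longrightarrow> ((\<lambda>y. f' y h) has_derivative f'' y) (at y)"
    and cont: "continuous_on V (\<lambda>y. f'' y k)" and e: "e > 0"
  shows "\<exists>r>0. \<forall>s. 0 < s \<longrightarrow> s < r \<longrightarrow>
    \<bar>(f (z + s *\<^sub>R h + s *\<^sub>R k) - f (z + s *\<^sub>R h) - f (z + s *\<^sub>R k) + f z) / s\<^sup>2 - f'' z k\<bar> < e"
proof -
  obtain r1 where r1: "r1 > 0" "ball z r1 \<subseteq> V" using V open_contains_ball by blast
  have "isCont (\<lambda>y. f'' y k) z" using cont V by (simp add: continuous_on_eq_continuous_at)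
  then obtain r2 where r2: "r2 > 0" "\<And>y. dist y z < r2 \<Longrightarrow> dist (f'' y k) (f'' z k) < e"
    unfolding continuous_at_eps_delta using e by blast
  define r where "r = min r1 r2 / (norm h + norm k + 1)"
  have n: "norm h + norm k + 1 > 0" by (simp add: add_nonneg_pos)
  have r: "r > 0" using r1 r2 n by (simp add: r_def)
  have near: "dist (z + a *\<^sub>R h + b *\<^sub>R k) z < min r1 r2" if "0 \<le> a" "a \<le> s" "0 \<le> b" "b \<le> s" "s < r" for a b s
  proof -
    have "dist (z + a *\<^sub>R h + b *\<^sub>R k) z \<le> a * norm h + b * norm k"
      using that norm_triangle_ineq[of "a *\<^sub>R h" "b *\<^sub>R k"] by (simp add: dist_norm algebra_simps)
    also have "\<dots> \<le> s * norm h + s * norm k" using that by (intro add_mono mult_right_mono) auto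
    also have "\<dots> \<le> s * (norm h + norm k + 1)" using that by (simp add: algebra_simps)
    also have "\<dots> < r * (norm h + norm k + 1)" using that n by (intro mult_strict_right_mono)
    also have "\<dots> = min r1 r2" using n by (simp add: r_def)
    finally show ?thesis .
  qed
  have nearV: "z + a *\<^sub>R h + b *\<^sub>R k \<in> V" if "0 \<le> a" "a \<le> s" "0 \<le> b" "b \<le> s" "s < r" for a b s
    using near[OF that] r1(2) by (auto simp: dist_commute)
  have "\<bar>(f (z + s *\<^sub>R h + s *\<^sub>R k) - f (z + s *\<^sub>R h) - f (z + s *\<^sub>R k) + f z) / s\<^sup>2 - f'' z k\<bar> < e"
    if s: "0 < s" "s < r" for s
  proof -
    \<comment> \<open>The increment in direction \<open>k\<close> as a function of the position
      along \<open>h\<close>. The mean value theorem in \<open>a\<close> and then in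
      \<open>b\<close> turns the second difference into \<open>s^2\<close> times \<open>f''\<close>
      at a nearby point.\<close>
    define g where "g a = f (z + a *\<^sub>R h + s *\<^sub>R k) - f (z + a *\<^sub>R h + 0 *\<^sub>R k)" for a
    have fa: "((\<lambda>a. f (z + a *\<^sub>R h + b *\<^sub>R k)) has_real_derivative f' (z + a *\<^sub>R h + b *\<^sub>R k) h) (at a)"
      if "0 \<le> a" "a \<le> s" "0 \<le> b" "b \<le> s" for a b
    proof -
      have "((\<lambda>a. z + a *\<^sub>R h + b *\<^sub>R k) has_derivative (\<lambda>c. c *\<^sub>R h)) (at a)"
        by (auto intro!: derivative_eq_intros)
      from has_derivative_compose[OF this f'[OF nearV[OF that s(2)]]]
      have "((\<lambda>a. f (z + a *\<^sub>R h + b *\<^sub>R k)) has_derivative (\<lambda>c. f' (z + a *\<^sub>R h + b *\<^sub>R k) (c *\<^sub>R h))) (at a)" .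
      moreover have "f' (z + a *\<^sub>R h + b *\<^sub>R k) (c *\<^sub>R h) = f' (z + a *\<^sub>R h + b *\<^sub>R k) h * c" for c
        using linear_scale[OF has_derivative_linear[OF f'[OF nearV[OF that s(2)]]]] by simp
      ultimately show ?thesis by (simp add: has_field_derivative_def)
    qed
    have g': "(g has_real_derivative f' (z + a *\<^sub>R h + s *\<^sub>R k) h - f' (z + a *\<^sub>R h + 0 *\<^sub>R k) h) (at a)"
      if "0 \<le> a" "a \<le> s" for a
      unfolding g_def[abs_def] by (intro DERIV_diff fa) (use s that in auto)
    obtain a where a: "0 < a" "a < s" "g s - g 0 = (s - 0) * (f' (z + a *\<^sub>R h + s *\<^sub>R k) h - f' (z + a *\<^sub>R h + 0 *\<^sub>R k) h)"
      using MVT2[OF s(1) g'] by blast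
    have fb: "((\<lambda>b. f' (z + a *\<^sub>R h + b *\<^sub>R k) h) has_real_derivative f'' (z + a *\<^sub>R h + b *\<^sub>R k) k) (at b)"
      if "0 \<le> b" "b \<le> s" for b
    proof -
      have zV: "z + a *\<^sub>R h + b *\<^sub>R k \<in> V" by (rule nearV[of a s b]) (use a s that in auto)
      have "((\<lambda>b. z + a *\<^sub>R h + b *\<^sub>R k) has_derivative (\<lambda>c. c *\<^sub>R k)) (at b)"
        by (auto intro!: derivative_eq_intros)
      from has_derivative_compose[OF this f''[OF zV]]
      have "((\<lambda>b. f' (z + a *\<^sub>R h + b *\<^sub>R k) h) has_derivative (\<lambda>c. f'' (z + a *\<^sub>R h + b *\<^sub>R k) (c *\<^sub>R k))) (at b)" .
      moreover have "f'' (z + a *\<^sub>R h + b *\<^sub>R k) (c *\<^sub>R k) = f'' (z + a *\<^sub>R h + b *\<^sub>R k) k * c" for c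
        using linear_scale[OF has_derivative_linear[OF f''[OF zV]]] by simp
      ultimately show ?thesis by (simp add: has_field_derivative_def)
    qed
    obtain b where b: "0 < b" "b < s" "f' (z + a *\<^sub>R h + s *\<^sub>R k) h - f' (z + a *\<^sub>R h + 0 *\<^sub>R k) h
        = (s - 0) * f'' (z + a *\<^sub>R h + b *\<^sub>R k) k"
      using MVT2[OF s(1) fb] by blast
    have "f (z + s *\<^sub>R h + s *\<^sub>R k) - f (z + s *\<^sub>R h) - f (z + s *\<^sub>R k) + f z = g s - g 0" by (simp add: g_def)
    also have "\<dots> = s\<^sup>2 * f'' (z + a *\<^sub>R h + b *\<^sub>R k) k" unfolding a(3) b(3) by (simp add: power2_eq_square)
    finally have "(f (z + s *\<^sub>R h + s *\<^sub>R k) - f (z + s *\<^sub>R h) - f (z + s *\<^sub>R k) + f z) / s\<^sup>2 = f'' (z + a *\<^sub>R h + b *\<^sub>R k) k"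
      using s by simp
    moreover have "dist (z + a *\<^sub>R h + b *\<^sub>R k) z < r2" using near[of a s b] a b s by simp
    ultimately show ?thesis using r2(2) by (simp add: dist_real_def)
  qed
  then show ?thesis using r by blast
qed

text \<open>The second difference is symmetric in \<open>h\<close> and \<open>k\<close>, and both
  iterated derivatives are its limit. The fact has to be proved because \<open>Ck_on 2\<close>
  differentiates each directional derivative separately.\<close>

lemma second_derivative_symmetric:
  fixes f :: "'a::real_normed_vector \<Rightarrow> real"
  assumes V: "open V" "z \<in> V"
    and f': "\<And>y. y \<in> V \<Longrightarrow> (f has_derivative f' y) (at y)"
    and f'': "\<And>y h. y \<in> V \<Longrightarrow> ((\<lambda>y. f' y h) has_derivative f'' y h) (at y)"
    and cont: "\<And>h k. continuous_on V (\<lambda>y. f'' y h k)"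
  shows "f'' z h k = f'' z k h"
proof (rule ccontr)
  assume "f'' z h k \<noteq> f'' z k h"
  then have e: "\<bar>f'' z h k - f'' z k h\<bar> / 2 > 0" by simp
  let ?\<Delta> = "\<lambda>h k s. (f (z + s *\<^sub>R h + s *\<^sub>R k) - f (z + s *\<^sub>R h) - f (z + s *\<^sub>R k) + f z) / s\<^sup>2"
  obtain r1 where r1: "r1 > 0" "\<And>s. 0 < s \<Longrightarrow> s < r1 \<Longrightarrow> \<bar>?\<Delta> h k s - f'' z h k\<bar> < \<bar>f'' z h k - f'' z k h\<bar> / 2"
    using second_difference_limit[OF V f' f'' cont e, of h k] by blast
  obtain r2 where r2: "r2 > 0" "\<And>s. 0 < s \<Longrightarrow> s < r2 \<Longrightarrow> \<bar>?\<Delta> k h s - f'' z k h\<bar> < \<bar>f'' z h k - f'' z k h\<bar> / 2"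
    using second_difference_limit[OF V f' f'' cont e, of k h] by blast
  let ?s = "min r1 r2 / 2"
  have key: False if "\<bar>a - A\<bar> < \<bar>A - B\<bar> / 2" "\<bar>a - B\<bar> < \<bar>A - B\<bar> / 2" for a A B :: real
    using that by (auto simp: abs_if split: if_splits)
  have 1: "\<bar>?\<Delta> h k ?s - f'' z h k\<bar> < \<bar>f'' z h k - f'' z k h\<bar> / 2"
    by (rule r1(2)) (use r1(1) r2(1) in auto)
  have 2: "\<bar>?\<Delta> k h ?s - f'' z k h\<bar> < \<bar>f'' z h k - f'' z k h\<bar> / 2"
    by (rule r2(2)) (use r1(1) r2(1) in auto)
  have eq: "?\<Delta> k h ?s = ?\<Delta> h k ?s" by (simp add: algebra_simps)
  show False by (rule key[OF 1 2[unfolded eq]])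
qed

section \<open>Uniqueness and existence\<close>

context level_set_problem
begin

text \<open>Along the curve, \<open>z = (x, grad \<psi>, \<psi>)\<close> satisfies
  \<open>z' = F z + M \<delta>\<close> with \<delta> the position component of
  \<open>F Y - F z\<close>; so \<open>|z' - Y'|\<close> is at most a multiple of
  \<open>|z - Y|\<close> where \<open>F\<close> is Lipschitz. The Hessian of \<psi> enters only as a
  factor in \<open>M\<close>, for which continuity is enough.\<close>

lemma solution_equals_characteristic:
  assumes \<Theta>: "time_open \<Theta>" "\<Theta> \<subseteq> {0..} \<times> \<Omega>" and sol: "C2_solution v \<beta> \<phi>0 \<Theta> \<psi>"
    and good: "good t \<xi>" and t: "0 \<le> t" and curve: "\<And>s. s \<in> {0..t} \<Longrightarrow> (s, fst (Y s \<xi>)) \<in> \<Theta>"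
  shows "\<psi> t (fst (Y t \<xi>)) = snd (snd (Y t \<xi>))"
proof -
  define f where "f = (\<lambda>(t, x). \<psi> t x)"
  have "Ck_on 2 \<Theta> f" using sol by (simp add: C2_solution_def f_def)
  then obtain d where d: "\<And>z. z \<in> \<Theta> \<Longrightarrow> (f has_derivative d z) (at z within \<Theta>)"
    and d1: "\<And>h. Ck_on 1 \<Theta> (\<lambda>z. d z h)" unfolding Ck_on_2_iff by blast
  have "\<forall>h. \<exists>f'. (\<forall>z\<in>\<Theta>. ((\<lambda>z. d z h) has_derivative f' z) (at z within \<Theta>)) \<and> (\<forall>k. continuous_on \<Theta> (\<lambda>z. f' z k))"
    using d1 unfolding Ck_on_1_iff by blast
  then obtain dd where dd: "\<And>h z. z \<in> \<Theta> \<Longrightarrow> ((\<lambda>z. d z h) has_derivative dd h z) (at z within \<Theta>)"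
    and dd_cont: "\<And>h k. continuous_on \<Theta> (\<lambda>z. dd h z k)" by metis
  define G :: "real \<times> (real^3) \<Rightarrow> real^3" where "G z = (\<Sum>b\<in>Basis. d z (0, b) *\<^sub>R b)" for z
  have bl_d: "bounded_linear (d z)" if "z \<in> \<Theta>" for z by (rule has_derivative_bounded_linear[OF d[OF that]])
  have bl_dd: "bounded_linear (dd h z)" if "z \<in> \<Theta>" for z h by (rule has_derivative_bounded_linear[OF dd[OF that]])
  have dG: "d z (0, h) = h \<bullet> G z" if "z \<in> \<Theta>" for z h
    unfolding G_def by (rule linear_slice_inner[OF bl_d[OF that]])
  have grad: "GDERIV (\<psi> s) x :> G (s, x)" if "(s, x) \<in> \<Theta>" for s x
    unfolding G_def by (rule slice_derivatives(2)[OF \<Theta>(1) that d[OF that, unfolded f_def]])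
  have pde: "d (s, x) (1, 0) = \<psi> s x * (\<beta> - norm (G (s, x))) - v s x \<bullet> G (s, x)" if "(s, x) \<in> \<Theta>" for s x
  proof -
    have "vector_derivative (\<lambda>s. \<psi> s x) (at s within {0..}) + v s x \<bullet> grad (\<psi> s) x
          = \<psi> s x * (\<beta> - norm (grad (\<psi> s) x))"
      using sol that by (auto simp: C2_solution_def)
    then show ?thesis
      unfolding GDERIV_imp_grad[OF grad[OF that]] slice_derivatives(1)[OF \<Theta>(1) that d[OF that, unfolded f_def]]
      by simp
  qed
  have f_cont: "continuous_on \<Theta> f" by (rule has_derivative_continuous_on[OF d])
  have d_cont: "continuous_on \<Theta> (\<lambda>z. d z h)" for h by (rule Ck_on_1_continuous[OF d1])
  have G_cont: "continuous_on \<Theta> G" unfolding G_def by (intro continuous_intros d_cont)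
  \<comment> \<open>At positive times \<Theta> is open, so derivatives are two-sided and second
    derivatives symmetric. Gronwall's inequality asks for the equation only there; continuity covers
    time 0.\<close>
  define V where "V = \<Theta> \<inter> ({0<..} \<times> UNIV)"
  have V: "open V"
  proof -
    obtain U where "open U" "\<Theta> = ({0..} \<times> UNIV) \<inter> U" using \<Theta>(1) by (auto simp: time_open_def openin_open)
    then have "V = U \<inter> ({0<..} \<times> UNIV)" by (auto simp: V_def)
    then show ?thesis using \<open>open U\<close> by (simp add: open_Int open_Times)
  qed
  have V\<Theta>: "V \<subseteq> \<Theta>" by (auto simp: V_def)
  have dV: "(f has_derivative d z) (at z)" if "z \<in> V" for z
    using d[of z] that V\<Theta> at_within_open_subset[OF that V V\<Theta>] by auto
  have ddV: "((\<lambda>z. d z h) has_derivative dd h z) (at z)" if "z \<in> V" for z h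
    using dd[of z h] that V\<Theta> at_within_open_subset[OF that V V\<Theta>] by auto
  have sym: "dd h z k = dd k z h" if "z \<in> V" for z h k
    by (rule second_derivative_symmetric[OF V that dV ddV continuous_on_subset[OF dd_cont V\<Theta>]])
  have G_der: "(G has_derivative (\<lambda>k. \<Sum>b\<in>Basis. dd (0, b) z k *\<^sub>R b)) (at z)" if "z \<in> V" for z
    unfolding G_def[abs_def] by (intro has_derivative_sum has_derivative_scaleR_left ddV that)
  have hess: "(\<Sum>b\<in>Basis. dd (0, b) z (0, k) *\<^sub>R b) \<bullet> h = dd (0, k) z (0, h)" if z: "z \<in> V" for z h k
  proof -
    have "(\<Sum>b\<in>Basis. dd (0, b) z (0, k) *\<^sub>R b) = (\<Sum>b\<in>Basis. dd (0, k) z (0, b) *\<^sub>R b)"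
      by (intro sum.cong refl) (simp add: sym[OF z])
    then show ?thesis
      using linear_slice_inner[OF bl_dd, of z "(0, k)" h] z V\<Theta> by (auto simp: inner_commute)
  qed
  \<comment> \<open>The equation differentiated in \<open>x\<close>.\<close>
  have mixed: "dd (1, 0) (s, x) (0, k) = (k \<bullet> G (s, x)) * (\<beta> - norm (G (s, x))) - Dv s x k \<bullet> G (s, x)
      - dd (0, k) (s, x) (0, v s x + (\<psi> s x / norm (G (s, x))) *\<^sub>R G (s, x))"
    if z: "(s, x) \<in> V" and nz: "G (s, x) \<noteq> 0" for s x k
  proof -
    let ?z = "(s, x)" and ?Gk = "\<lambda>k. \<Sum>b\<in>Basis. dd (0, b) (s, x) (0, k) *\<^sub>R b"
    have s: "0 \<le> s" and x: "x \<in> \<Omega>" and z\<Theta>: "?z \<in> \<Theta>" using z \<Theta>(2) V\<Theta> by (auto simp: V_def)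
    have emb: "((\<lambda>y. (s, y)) has_derivative (\<lambda>k. (0, k))) (at x)"
      by (rule has_derivative_Pair[OF has_derivative_const has_derivative_ident])
    have 1: "((\<lambda>y. d (s, y) (1, 0)) has_derivative (\<lambda>k. dd (1, 0) ?z (0, k))) (at x)"
      by (rule has_derivative_compose[OF emb ddV[OF z]])
    have Gx: "((\<lambda>y. G (s, y)) has_derivative ?Gk) (at x)"
      by (rule has_derivative_compose[OF emb G_der[OF z]])
    have \<psi>x: "(\<psi> s has_derivative (\<lambda>k. k \<bullet> G ?z)) (at x)" using grad[OF z\<Theta>] by (simp add: gderiv_def)
    have N: "((\<lambda>y. norm (G (s, y))) has_derivative (\<lambda>k. ?Gk k \<bullet> sgn (G ?z))) (at x)"
      by (rule has_derivative_compose[OF Gx has_derivative_norm[OF nz]])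
    have 2: "((\<lambda>y. \<psi> s y * (\<beta> - norm (G (s, y))) - v s y \<bullet> G (s, y)) has_derivative
        (\<lambda>k. (\<psi> s x * (0 - ?Gk k \<bullet> sgn (G ?z)) + (k \<bullet> G ?z) * (\<beta> - norm (G ?z)))
            - (v s x \<bullet> ?Gk k + Dv s x k \<bullet> G ?z))) (at x)"
      by (intro has_derivative_diff has_derivative_mult has_derivative_inner has_derivative_const \<psi>x N Gx
          v_derivative[OF s x])
    have op: "open ((\<lambda>y. (s, y)) -` V)" by (intro open_vimage V continuous_intros)
    have "((\<lambda>y. d (s, y) (1, 0)) has_derivative
        (\<lambda>k. (\<psi> s x * (0 - ?Gk k \<bullet> sgn (G ?z)) + (k \<bullet> G ?z) * (\<beta> - norm (G ?z)))
            - (v s x \<bullet> ?Gk k + Dv s x k \<bullet> G ?z))) (at x)"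
      by (rule has_derivative_transform_within_open[OF 2 op]) (use z pde V\<Theta> in auto)
    from fun_cong[OF has_derivative_unique[OF 1 this], of k]
    have "dd (1, 0) ?z (0, k) = (\<psi> s x * (0 - ?Gk k \<bullet> sgn (G ?z)) + (k \<bullet> G ?z) * (\<beta> - norm (G ?z)))
            - (v s x \<bullet> ?Gk k + Dv s x k \<bullet> G ?z)" .
    also have "v s x \<bullet> ?Gk k = dd (0, k) ?z (0, v s x)"
      using hess[OF z, of k "v s x"] by (simp add: inner_commute)
    also have "?Gk k \<bullet> sgn (G ?z) = dd (0, k) ?z (0, G ?z) / norm (G ?z)"
      using hess[OF z, of k "G ?z"] by (simp add: sgn_div_norm divide_inverse_commute)
    finally have eq: "dd (1, 0) ?z (0, k) = (\<psi> s x * (0 - dd (0, k) ?z (0, G ?z) / norm (G ?z)) + (k \<bullet> G ?z) * (\<beta> - norm (G ?z)))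
            - (dd (0, k) ?z (0, v s x) + Dv s x k \<bullet> G ?z)" .
    let ?l = "\<lambda>h. dd (0, k) ?z (0, h)"
    have "?l (v s x + (\<psi> s x / norm (G ?z)) *\<^sub>R G ?z) = ?l (v s x) + (\<psi> s x / norm (G ?z)) * ?l (G ?z)"
      using linear_add[OF linear_slice[OF bl_dd[OF z\<Theta>]], of "(0, k)" "v s x" "(\<psi> s x / norm (G ?z)) *\<^sub>R G ?z"]
        linear_scale[OF linear_slice[OF bl_dd[OF z\<Theta>]], of "(0, k)" "\<psi> s x / norm (G ?z)" "G ?z"] by simp
    then show ?thesis unfolding eq by (simp add: algebra_simps)
  qed
  define x where "x s = fst (Y s \<xi>)" for s
  define c where "c s = (s, x s)" for s
  have Y_cont: "continuous_on {0..t} (\<lambda>s. Y s \<xi>)" by (rule char_curve_continuous[OF Y_char_curve[OF good]])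
  have c_cont: "continuous_on {0..t} c" unfolding c_def x_def by (intro continuous_intros Y_cont)
  have c\<Theta>: "c s \<in> \<Theta>" if "s \<in> {0..t}" for s using curve[OF that] by (simp add: c_def x_def)
  have comp_cont: "continuous_on {0..t} (\<lambda>s. q (c s))" if "continuous_on \<Theta> q" for q :: "real \<times> (real^3) \<Rightarrow> 'z::topological_space"
    by (rule continuous_on_compose2[OF that c_cont]) (use c\<Theta> in auto)
  define z where "z s = (x s, G (c s), f (c s))" for s
  have z_cont: "continuous_on {0..t} z"
    unfolding z_def by (intro continuous_on_Pair comp_cont G_cont f_cont) (simp add: x_def continuous_on_fst Y_cont)
  \<comment> \<open>The derivative of \<open>x \<mapsto> (x, \<nabla>\<psi>, \<psi>)\<close>: it accounts for \<open>x\<close> not being a characteristic of \<open>\<psi>\<close> a priori.\<close>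
  define M where "M s h = (h, (\<Sum>b\<in>Basis. dd (0, b) (c s) (0, h) *\<^sub>R b), h \<bullet> G (c s))" for s h
  obtain C where C: "0 \<le> C" "\<And>s h. s \<in> {0..t} \<Longrightarrow> norm (M s h) \<le> C * norm h"
  proof -
    define m where "m s = 1 + (\<Sum>b\<in>Basis. norm (\<Sum>b'\<in>Basis. dd (0, b) (c s) (0, b') *\<^sub>R b')) + norm (G (c s))" for s
    have "continuous_on {0..t} m"
      unfolding m_def by (intro continuous_intros comp_cont dd_cont G_cont)
    then have "bounded (m ` {0..t})" by (intro compact_imp_bounded compact_continuous_image compact_Icc)
    then obtain B where B: "\<And>s. s \<in> {0..t} \<Longrightarrow> \<bar>m s\<bar> \<le> B" unfolding bounded_iff real_norm_def by blast
    have "norm (M s h) \<le> B * norm h" if s: "s \<in> {0..t}" for s h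
    proof -
      have "norm (\<Sum>b\<in>Basis. dd (0, b) (c s) (0, h) *\<^sub>R b) \<le> (\<Sum>b\<in>Basis. norm h * norm (\<Sum>b'\<in>Basis. dd (0, b) (c s) (0, b') *\<^sub>R b'))"
      proof (rule sum_norm_le)
        fix b :: "real^3" assume b: "b \<in> Basis"
        have "norm (dd (0, b) (c s) (0, h) *\<^sub>R b) = \<bar>h \<bullet> (\<Sum>b'\<in>Basis. dd (0, b) (c s) (0, b') *\<^sub>R b')\<bar>"
          using b linear_slice_inner[OF bl_dd[OF c\<Theta>[OF s]], of "(0, b)" h] by simp
        then show "norm (dd (0, b) (c s) (0, h) *\<^sub>R b) \<le> norm h * norm (\<Sum>b'\<in>Basis. dd (0, b) (c s) (0, b') *\<^sub>R b')"
          using Cauchy_Schwarz_ineq2 by simp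
      qed
      also have "\<dots> = norm h * (\<Sum>b\<in>Basis. norm (\<Sum>b'\<in>Basis. dd (0, b) (c s) (0, b') *\<^sub>R b'))"
        by (simp add: sum_distrib_left)
      finally have "norm (M s h) \<le> norm h + (norm h * (\<Sum>b\<in>Basis. norm (\<Sum>b'\<in>Basis. dd (0, b) (c s) (0, b') *\<^sub>R b')) + norm h * norm (G (c s)))"
        unfolding M_def
        by (intro order_trans[OF norm_Pair_le] add_mono order_refl) (auto simp: Cauchy_Schwarz_ineq2)
      also have "\<dots> = m s * norm h" by (simp add: m_def algebra_simps)
      also have "\<dots> \<le> B * norm h" using B[OF s] by (intro mult_right_mono) auto
      finally show ?thesis .
    qed
    moreover have "0 \<le> B" using B[of 0] t by auto
    ultimately show thesis using that by blast
  qed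
  have z': "(z has_vector_derivative F s (z s) + M s (fst (F s (Y s \<xi>)) - fst (F s (z s)))) (at s)"
    if s: "0 < s" "s < t" and nz: "G (c s) \<noteq> 0" for s
  proof -
    let ?x' = "fst (F s (Y s \<xi>))" and ?G = "G (c s)"
    \<comment> \<open>The actual velocity minus the characteristic velocity of \<psi> at the same
      point. If it vanished, \<open>z\<close> would solve the characteristic system exactly.\<close>
    define \<delta> where "\<delta> = ?x' - fst (F s (z s))"
    have sI: "s \<in> {0..t}" using s by simp
    have cV: "c s \<in> V" using c\<Theta>[OF sI] s by (auto simp: V_def c_def)
    have x: "x s \<in> \<Omega>" using c\<Theta>[OF sI] \<Theta>(2) by (auto simp: c_def)
    have x': "(x has_vector_derivative ?x') (at s)"
      unfolding x_def[abs_def]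
      by (rule bounded_linear.has_vector_derivative[OF bounded_linear_fst char_curve_interior[OF Y_char_curve[OF good] s]])
    have c': "(c has_derivative (\<lambda>r. r *\<^sub>R (1, ?x'))) (at s)"
      using has_derivative_Pair[OF has_derivative_ident x'[unfolded has_vector_derivative_def]]
      unfolding c_def[abs_def] by simp
    have along: "((\<lambda>s. q (c s)) has_vector_derivative q' (1, ?x')) (at s)"
      if "(q has_derivative q') (at (c s))" for q :: "real \<times> (real^3) \<Rightarrow> real" and q'
    proof -
      have "(\<lambda>r. q' (r *\<^sub>R (1, ?x'))) = (\<lambda>r. r *\<^sub>R q' (1, ?x'))"
        by (rule ext) (rule linear_scale[OF has_derivative_linear[OF that]])
      with has_derivative_compose[OF c' that] show ?thesis
        unfolding has_vector_derivative_def by (simp only:)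
    qed
    have split: "l (1, h) = l (1, 0) + l (0, h)" if "bounded_linear l" for l :: "real \<times> (real^3) \<Rightarrow> real" and h
      using linear_add[OF bounded_linear.linear[OF that], of "(1, 0)" "(0, h)"] by simp
    have Fz1: "fst (F s (z s)) = v s (x s) + (\<psi> s (x s) / norm ?G) *\<^sub>R ?G"
      by (simp add: F_def Let_def z_def f_def c_def)
    have \<psi>': "((\<lambda>s. f (c s)) has_vector_derivative \<beta> * f (c s) + \<delta> \<bullet> ?G) (at s)"
    proof -
      have "d (c s) (1, ?x') = (\<psi> s (x s) * (\<beta> - norm ?G) - v s (x s) \<bullet> ?G) + ?x' \<bullet> ?G"
        using split[OF bl_d[OF c\<Theta>[OF sI]], of ?x'] dG[OF c\<Theta>[OF sI], of ?x'] pde[of s "x s"] c\<Theta>[OF sI] by (simp add: c_def)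
      also have "\<dots> = \<beta> * f (c s) + \<delta> \<bullet> ?G"
        using nz by (simp add: \<delta>_def Fz1 f_def c_def inner_diff_left inner_add_left dot_square_norm power2_eq_square algebra_simps)
      finally show ?thesis using along[OF dV[OF cV]] by simp
    qed
    have G': "((\<lambda>s. G (c s)) has_vector_derivative
        ((\<beta> - norm ?G) *\<^sub>R ?G - Dv_adj s (x s) ?G) + (\<Sum>b\<in>Basis. dd (0, b) (c s) (0, \<delta>) *\<^sub>R b)) (at s)"
    proof -
      \<comment> \<open>By symmetry the mixed derivative can be taken from the equation
        differentiated in \<open>x\<close>; the second derivatives along the characteristic velocity
        of \<psi> combine with those along the actual one, leaving only the direction
        \<delta>.\<close>
      have val: "dd (0, b) (c s) (1, ?x') = ((\<beta> - norm ?G) *\<^sub>R ?G - Dv_adj s (x s) ?G) \<bullet> b + dd (0, b) (c s) (0, \<delta>)" for b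
      proof -
        have "dd (0, b) (c s) (1, ?x') = dd (1, 0) (c s) (0, b) + dd (0, b) (c s) (0, ?x')"
          using split[OF bl_dd[OF c\<Theta>[OF sI]], of "(0, b)" ?x'] sym[OF cV, of "(0, b)" "(1, 0)"] by simp
        also have "dd (1, 0) (c s) (0, b) = (b \<bullet> ?G) * (\<beta> - norm ?G) - Dv s (x s) b \<bullet> ?G - dd (0, b) (c s) (0, fst (F s (z s)))"
          using mixed[of s "x s" b] cV nz by (simp add: c_def Fz1)
        finally have "dd (0, b) (c s) (1, ?x') = (b \<bullet> ?G) * (\<beta> - norm ?G) - Dv s (x s) b \<bullet> ?G
            + (dd (0, b) (c s) (0, ?x') - dd (0, b) (c s) (0, fst (F s (z s))))" by simp
        also have "dd (0, b) (c s) (0, ?x') - dd (0, b) (c s) (0, fst (F s (z s))) = dd (0, b) (c s) (0, \<delta>)"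
          unfolding \<delta>_def by (rule linear_diff[OF linear_slice[OF bl_dd[OF c\<Theta>[OF sI]]], symmetric])
        finally show ?thesis
          by (simp add: inner_diff_left Dv_adj_inner inner_commute[of b] mult.commute)
      qed
      have "((\<lambda>s. G (c s)) has_vector_derivative (\<Sum>b\<in>Basis. dd (0, b) (c s) (1, ?x') *\<^sub>R b)) (at s)"
        unfolding G_def
        by (intro has_vector_derivative_sum bounded_linear.has_vector_derivative[OF bounded_linear_scaleR_left] along ddV cV)
      then show ?thesis
        by (rule has_vector_derivative_eq_rhs)
          (simp add: val scaleR_add_left sum.distrib euclidean_representation)
    qed
    have "(z has_vector_derivative (?x', ((\<beta> - norm ?G) *\<^sub>R ?G - Dv_adj s (x s) ?G) + (\<Sum>b\<in>Basis. dd (0, b) (c s) (0, \<delta>) *\<^sub>R b),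
        \<beta> * f (c s) + \<delta> \<bullet> ?G)) (at s)"
      unfolding z_def[abs_def] by (intro has_vector_derivative_Pair x' G' \<psi>')
    then show ?thesis
      by (rule has_vector_derivative_eq_rhs) (simp add: M_def \<delta>_def[symmetric] prod_eq_iff F_def Let_def z_def,
        simp add: \<delta>_def F_def Let_def z_def)
  qed
  \<comment> \<open>Nothing says beforehand that the gradient of \<psi> is nonzero along the curve,
    and \<open>F\<close> is singular at 0. On \<open>E\<close> it equals \<open>p\<close>, which is
    nonzero, so the comparison can be run near each point of \<open>E\<close>; connectedness of the
    interval does the rest.\<close>
  define E where "E = {s \<in> {0..t}. z s - Y s \<xi> = 0}"
  have YD: "Y s \<xi> \<in> D" if "s \<in> {0..t}" for s
    using Y_char_curve[OF good] that by (simp add: char_curve_def)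
  have "closedin (top_of_set {0..t}) E"
    unfolding E_def by (intro continuous_closedin_preimage_constant continuous_on_diff z_cont Y_cont)
  moreover have "openin (top_of_set {0..t}) E"
    unfolding openin_euclidean_subtopology_iff
  proof (intro conjI ballI)
    show "E \<subseteq> {0..t}" by (auto simp: E_def)
    fix s0 assume s0: "s0 \<in> E"
    then have s0t: "s0 \<in> {0..t}" and z0: "z s0 = Y s0 \<xi>" by (auto simp: E_def)
    have "G (c s0) = fst (snd (Y s0 \<xi>))" using z0 by (metis fst_conv snd_conv z_def)
    then have "norm (G (c s0)) > 0" using YD[OF s0t] by (auto simp: D_def)
    then obtain e where e: "e > 0" and eG: "\<And>s. s \<in> {0..t} \<Longrightarrow> dist s s0 < e \<Longrightarrow> dist (G (c s)) (G (c s0)) < norm (G (c s0))"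
      using comp_cont[OF G_cont] s0t unfolding continuous_on_iff by metis
    have nz: "G (c s) \<noteq> 0" if "s \<in> {0..t}" "dist s s0 < e" for s using eG[OF that] by auto
    \<comment> \<open>Half the radius keeps the closed interval \<open>{a..b}\<close> inside the
      region where \<open>G\<close> is nonzero; truncation to \<open>{0..t}\<close> handles the
      ends.\<close>
    define a where "a = max 0 (s0 - e / 2)"
    define b where "b = min t (s0 + e / 2)"
    have ab: "{a..b} \<subseteq> {0..t}" by (auto simp: a_def b_def)
    have near: "dist s s0 < e" if "s \<in> {a..b}" for s using that e by (auto simp: a_def b_def dist_real_def abs_if)
    have s0ab: "s0 \<in> {a..b}" using s0t e by (auto simp: a_def b_def)
    let ?K = "z ` {a..b} \<union> (\<lambda>s. Y s \<xi>) ` {a..b}"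
    have "compact ?K"
      by (intro compact_Un compact_continuous_image compact_Icc continuous_on_subset[OF z_cont ab] continuous_on_subset[OF Y_cont ab])
    moreover have "?K \<subseteq> D"
    proof -
      have "z s \<in> D" if "s \<in> {a..b}" for s
      proof -
        have st: "s \<in> {0..t}" using ab that by blast
        show ?thesis using YD[OF st] nz[OF st near[OF that]] by (auto simp: D_def z_def x_def mem_Times_iff)
      qed
      then show ?thesis using YD ab by auto
    qed
    ultimately obtain fc Df L M' \<eta> S W where fc: "C1_field fc Df L M'"
      and fF: "\<And>t' y. t' \<in> {0..t} \<Longrightarrow> y \<in> D \<Longrightarrow> fc t' y = \<eta> y *\<^sub>R F t' y"
      and \<eta>: "\<And>y. y \<in> W \<Longrightarrow> \<eta> y = 1" and W: "?K \<subseteq> W" "W \<subseteq> S" "S \<subseteq> D"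
      by (rule cutoff_field[OF _ _ t]) blast
    interpret C: C1_field fc Df L M' by (rule fc)
    have F_lip: "norm (F s (Y s \<xi>) - F s (z s)) \<le> L * norm (Y s \<xi> - z s)" if s: "s \<in> {a..b}" for s
    proof -
      have "z s \<in> W" "Y s \<xi> \<in> W" using W(1) s by auto
      then have "fc s (z s) = F s (z s)" "fc s (Y s \<xi>) = F s (Y s \<xi>)"
        using fF[of s "z s"] fF[of s "Y s \<xi>"] \<eta> W ab s by auto
      then show ?thesis using C.f_lipschitz[of s "Y s \<xi>" "z s"] by simp
    qed
    \<comment> \<open>The constant consists of \<open>L\<close> for the difference of the fields and
      \<open>C * L\<close> for the correction \<open>M\<close>.\<close>
    have zero: "z s - Y s \<xi> = 0" if "s \<in> {a..b}" for s
    proof (rule gronwall_zero[where a=a and b=b and c=s0 and L="(1 + C) * L"])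
      show "continuous_on {a..b} (\<lambda>s. z s - Y s \<xi>)"
        by (intro continuous_on_diff continuous_on_subset[OF z_cont ab] continuous_on_subset[OF Y_cont ab])
      show "0 \<le> (1 + C) * L" using C.L_ge_0 C(1) by simp
      fix s assume s: "a < s" "s < b"
      then have st: "0 < s" "s < t" and sab: "s \<in> {a..b}" and sI: "s \<in> {0..t}" by (auto simp: a_def b_def)
      let ?\<delta> = "fst (F s (Y s \<xi>)) - fst (F s (z s))"
      show "((\<lambda>s. z s - Y s \<xi>) has_vector_derivative (F s (z s) + M s ?\<delta>) - F s (Y s \<xi>)) (at s)"
        by (intro has_vector_derivative_diff z' st nz sI near sab char_curve_interior[OF Y_char_curve[OF good]])
      have "norm ((F s (z s) + M s ?\<delta>) - F s (Y s \<xi>)) \<le> norm (F s (Y s \<xi>) - F s (z s)) + norm (M s ?\<delta>)"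
      proof -
        have "(F s (z s) + M s ?\<delta>) - F s (Y s \<xi>) = M s ?\<delta> - (F s (Y s \<xi>) - F s (z s))" by simp
        then show ?thesis using norm_triangle_ineq4[of "M s ?\<delta>" "F s (Y s \<xi>) - F s (z s)"] by (simp only: add.commute)
      qed
      also have "norm (M s ?\<delta>) \<le> C * norm (F s (Y s \<xi>) - F s (z s))"
      proof -
        have "norm ?\<delta> \<le> norm (F s (Y s \<xi>) - F s (z s))"
          using norm_fst_le[of "fst (F s (Y s \<xi>) - F s (z s))" "snd (F s (Y s \<xi>) - F s (z s))"]
          unfolding prod.collapse unfolding fst_diff .
        from order_trans[OF C(2)[OF sI] mult_left_mono[OF this C(1)]] show ?thesis .
      qed
      also have "norm (F s (Y s \<xi>) - F s (z s)) + C * norm (F s (Y s \<xi>) - F s (z s)) = (1 + C) * norm (F s (Y s \<xi>) - F s (z s))"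
        by (simp add: algebra_simps)
      also have "\<dots> \<le> (1 + C) * (L * norm (Y s \<xi> - z s))"
        using F_lip[OF sab] C(1) by (intro mult_left_mono) auto
      finally show "norm ((F s (z s) + M s ?\<delta>) - F s (Y s \<xi>)) \<le> (1 + C) * L * norm (z s - Y s \<xi>)"
        by (simp add: norm_minus_commute mult.assoc)
    qed (use s0ab z0 that in auto)
    show "\<exists>e>0. \<forall>x'\<in>{0..t}. dist x' s0 < e \<longrightarrow> x' \<in> E"
    proof (intro exI[of _ "e / 2"] conjI ballI impI)
      fix s assume s: "s \<in> {0..t}" "dist s s0 < e / 2"
      then have "s \<in> {a..b}" by (auto simp: a_def b_def dist_real_def abs_if split: if_splits)
      then show "s \<in> E" using zero s by (simp add: E_def)
    qed (use e in simp)
  qed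
  moreover have "0 \<in> E"
  proof -
    have Y0: "Y 0 \<xi> = \<iota> \<xi>" by (rule Y_0[OF good t])
    have x0: "x 0 = \<xi>" by (simp add: x_def Y0 \<iota>_def)
    have in0: "(0, \<xi>) \<in> \<Theta>" using c\<Theta>[of 0] t by (simp add: c_def x0)
    then have \<xi>: "\<xi> \<in> \<Omega>" using \<Theta>(2) by auto
    have init: "\<psi> 0 y = \<phi>0 y" if "(0, y) \<in> \<Theta>" for y using sol that by (simp add: C2_solution_def)
    \<comment> \<open>The slice of \<Theta> at time 0 is open in space, so the initial condition
      determines the gradient at \<xi> together with the value.\<close>
    obtain r where r: "r > 0" "\<And>y. dist y (0, \<xi>) < r \<Longrightarrow> 0 \<le> fst y \<Longrightarrow> y \<in> \<Theta>"
      using time_open_ball[OF \<Theta>(1) in0] by blast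
    have "(\<psi> 0 has_derivative (\<lambda>h. h \<bullet> G (0, \<xi>))) (at \<xi>)" using grad[OF in0] by (simp add: gderiv_def)
    then have "(\<phi>0 has_derivative (\<lambda>h. h \<bullet> G (0, \<xi>))) (at \<xi>)"
      by (rule has_derivative_transform_within_open[of _ _ _ _ "ball \<xi> r"])
        (use r init in \<open>auto simp: dist_Pair_Pair dist_commute\<close>)
    then have "GDERIV \<phi>0 \<xi> :> G (0, \<xi>)" by (simp add: gderiv_def)
    moreover have "GDERIV \<phi>0 \<xi> :> g0 \<xi>" using \<phi>0_derivative[OF \<xi>] by (simp add: gderiv_def)
    ultimately have "G (0, \<xi>) = g0 \<xi>" using GDERIV_imp_grad by metis
    then have "z 0 = Y 0 \<xi>" using init[OF in0] by (simp add: z_def c_def x0 Y0 \<iota>_def f_def)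
    then show ?thesis using t by (simp add: E_def)
  qed
  ultimately have "E = {0..t}"
    using connected_clopen[of "{0..t}"] connected_Icc[of 0 t] by blast
  then have "t \<in> E" using t by simp
  then have "z t = Y t \<xi>" by (simp add: E_def)
  then have "f (c t) = snd (snd (Y t \<xi>))" by (metis snd_conv z_def)
  then show ?thesis by (simp add: f_def c_def x_def)
qed

section \<open>Assembling the local solutions over all time\<close>

lemma S0_trajectories_continuous:
  assumes T: "0 \<le> T"
  shows "continuous_on ({0..T} \<times> S0) (\<lambda>z. (fst z, fst (Y (fst z) (snd z))))"
proof -
  obtain f Df L M U where C1: "C1_field f Df L M" and U: "S0 \<subseteq> U"
    and Yf: "\<And>\<xi> t. \<xi> \<in> U \<Longrightarrow> t \<in> {0..T} \<Longrightarrow> Y t \<xi> = lipschitz_field.flw f t (\<iota> \<xi>)"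
    by (rule local_flow[OF T]) blast
  interpret C1_field f Df L M by (rule C1)
  have \<iota>S0: "continuous_on S0 \<iota>" by (rule continuous_on_subset[OF \<iota>_cont S0_sub])
  have 1: "continuous_on ({0..T} \<times> S0) (\<lambda>z. (fst z, \<iota> (snd z)))"
    by (intro continuous_on_Pair continuous_on_fst continuous_on_id
        continuous_on_compose2[OF \<iota>S0 continuous_on_snd[OF continuous_on_id]]) auto
  have "continuous_on ({0..T} \<times> S0) (\<lambda>z. flw (fst z) (\<iota> (snd z)))"
    using continuous_on_compose2[OF continuous_flw 1] by simp
  then have "continuous_on ({0..T} \<times> S0) (\<lambda>z. (fst z, fst (flw (fst z) (\<iota> (snd z)))))"
    by (intro continuous_on_Pair continuous_on_fst continuous_on_id)
  then show ?thesis
    by (rule continuous_on_eq) (use Yf U in auto)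
qed

text \<open>Compactness of the trajectories over \<open>[0, T]\<close> yields one radius for the
  whole interval; the nonincreasing radius function is assembled from these.\<close>

lemma uniform_tube:
  assumes \<Theta>: "time_open \<Theta>" and sub: "\<And>t \<xi>. 0 \<le> t \<Longrightarrow> \<xi> \<in> S0 \<Longrightarrow> (t, fst (Y t \<xi>)) \<in> \<Theta>" and T: "0 \<le> T"
  shows "\<exists>e>0. \<forall>t\<in>{0..T}. \<forall>\<xi>\<in>S0. \<forall>y. norm (fst (Y t \<xi>) - y) < e \<longrightarrow> (t, y) \<in> \<Theta>"
proof -
  obtain O' where O': "open O'" "\<Theta> = ({0..} \<times> UNIV) \<inter> O'" using \<Theta> by (auto simp: time_open_def openin_open)
  let ?K = "(\<lambda>z. (fst z, fst (Y (fst z) (snd z)))) ` ({0..T} \<times> S0)"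
  have "compact ?K"
    by (intro compact_continuous_image S0_trajectories_continuous T compact_Times compact_Icc compact_S0)
  moreover have "?K \<subseteq> O'" using sub O' by auto
  ultimately obtain e where e: "e > 0" "(\<Union>z\<in>?K. ball z e) \<subseteq> O'"
    using compact_subset_open_imp_ball_epsilon_subset[OF _ O'(1)] by blast
  have "(t, y) \<in> \<Theta>" if "t \<in> {0..T}" "\<xi> \<in> S0" "norm (fst (Y t \<xi>) - y) < e" for t \<xi> y
  proof -
    have "(t, fst (Y t \<xi>)) \<in> ?K" using that by force
    moreover have "(t, y) \<in> ball (t, fst (Y t \<xi>)) e" using that by (simp add: dist_Pair_Pair dist_norm)
    ultimately have "(t, y) \<in> O'" using e(2) by blast
    then show ?thesis using O'(2) that by auto
  qed
  then show ?thesis using e(1) by blast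
qed

lemma global_solution:
  assumes v_C1: "Ck_on 1 ({0..} \<times> \<Omega>) (\<lambda>(t, x). v t x)"
    and \<Sigma>: "\<And>t. 0 \<le> t \<Longrightarrow> \<Sigma> t = (\<lambda>\<xi>. fst (Y t \<xi>)) ` S0"
  shows "\<exists>\<Theta>. tubular_neighborhood \<Omega> \<Sigma> \<Theta> \<and>
           openin (top_of_set ({0..} \<times> \<Omega>)) \<Theta> \<and>
           (\<exists>\<phi>. C2_solution v \<beta> \<phi>0 \<Theta> \<phi> \<and>
              (\<forall>\<psi>. C2_solution v \<beta> \<phi>0 \<Theta> \<psi> \<longrightarrow> (\<forall>(t, x)\<in>\<Theta>. \<psi> t x = \<phi> t x)) \<and>
              (\<forall>t\<ge>0. {x. (t, x) \<in> \<Theta> \<and> \<phi> t x = 0} = \<Sigma> t) \<and>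
              (\<forall>t\<ge>0. \<forall>x\<in>\<Sigma> t. \<beta> - \<alpha> \<le> norm (grad (\<phi> t) x) \<and> norm (grad (\<phi> t) x) \<le> \<beta> + \<alpha>))"
proof -
  define pack where "pack n U z0 V q P \<longleftrightarrow> open V \<and> z0 \<in> V \<and> C1_open V P \<and>
        (\<forall>z\<in>V. fst z \<in> {0..real n + 1} \<longrightarrow> q z \<in> U \<and> fst (Y (fst z) (q z)) = snd z \<and> P z = fst (snd (Y (fst z) (q z))) \<and>
          ((\<lambda>z. exp (\<beta> * fst z) * \<phi>0 (q z)) has_derivative
            (\<lambda>h. fst h * (\<beta> * (exp (\<beta> * fst z) * \<phi>0 (q z))
              - P z \<bullet> (v (fst z) (snd z) + ((exp (\<beta> * fst z) * \<phi>0 (q z)) / norm (P z)) *\<^sub>R P z))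
             + P z \<bullet> snd h)) (at z))"
    for n :: nat and U and z0 and V :: "(real \<times> (real^3)) set" and q P
  \<comment> \<open>The horizon is \<open>n + 1\<close> because this neighbourhood serves the times
    in \<open>[n, n + 1)\<close>, all strictly before the end.\<close>
  define nbhd where "nbhd n U \<longleftrightarrow> open U \<and> S0 \<subseteq> U \<and> U \<subseteq> \<Omega> \<and> (\<forall>\<xi>\<in>U. good (real n + 1) \<xi>) \<and>
    (\<forall>t\<in>{0..real n + 1}. inj_on (\<lambda>\<xi>. fst (Y t \<xi>)) U) \<and>
    (\<forall>U' t0 \<xi>0. open U' \<longrightarrow> U' \<subseteq> U \<longrightarrow> \<xi>0 \<in> U' \<longrightarrow> t0 \<in> {0..real n + 1} \<longrightarrow>
      (\<exists>V q P. pack n U' (t0, fst (Y t0 \<xi>0)) V q P))" for n :: nat and U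
  have "\<forall>n. \<exists>U. nbhd n U"
  proof
    fix n :: nat
    have T: "0 \<le> real n + 1" by simp
    show "\<exists>U. nbhd n U"
    proof (rule local_package[OF T])
      fix U
      assume 1: "open U" "S0 \<subseteq> U" "U \<subseteq> \<Omega>" "\<And>\<xi>. \<xi> \<in> U \<Longrightarrow> good (real n + 1) \<xi>"
        "\<And>t. t \<in> {0..real n + 1} \<Longrightarrow> inj_on (\<lambda>\<xi>. fst (Y t \<xi>)) U"
      assume 2: "\<And>U' t0 \<xi>0. open U' \<Longrightarrow> U' \<subseteq> U \<Longrightarrow> \<xi>0 \<in> U' \<Longrightarrow> t0 \<in> {0..real n + 1} \<Longrightarrow>
        \<exists>V q P. open V \<and> (t0, fst (Y t0 \<xi>0)) \<in> V \<and> C1_open V P \<and>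
        (\<forall>z\<in>V. fst z \<in> {0..real n + 1} \<longrightarrow> q z \<in> U' \<and> fst (Y (fst z) (q z)) = snd z \<and> P z = fst (snd (Y (fst z) (q z))) \<and>
          ((\<lambda>z. exp (\<beta> * fst z) * \<phi>0 (q z)) has_derivative
            (\<lambda>h. fst h * (\<beta> * (exp (\<beta> * fst z) * \<phi>0 (q z))
              - P z \<bullet> (v (fst z) (snd z) + ((exp (\<beta> * fst z) * \<phi>0 (q z)) / norm (P z)) *\<^sub>R P z))
             + P z \<bullet> snd h)) (at z))"
      have "nbhd n U" unfolding nbhd_def pack_def by (intro conjI allI impI ballI 1 2)
      then show ?thesis ..
    qed
  qed
  from choice[OF this] obtain W where nb: "nbhd n (W n)" for n by auto
  have W: "open (W n)" "S0 \<subseteq> W n" "W n \<subseteq> \<Omega>" for n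
    using nb[of n] by (simp_all add: nbhd_def)
  have W_good: "good (real n + 1) \<xi>" if "\<xi> \<in> W n" for n \<xi>
    using nb[of n] that by (simp add: nbhd_def)
  have W_inj: "inj_on (\<lambda>\<xi>. fst (Y t \<xi>)) (W n)" if "t \<in> {0..real n + 1}" for n t
    using nb[of n] that by (simp add: nbhd_def)
  have W_pack: "\<exists>V q P. pack n U' (t0, fst (Y t0 \<xi>0)) V q P"
    if "open U'" "U' \<subseteq> W n" "\<xi>0 \<in> U'" "t0 \<in> {0..real n + 1}" for n U' t0 \<xi>0
    using nb[of n] that unfolding nbhd_def by blast
  \<comment> \<open>Decreasing in \<open>n\<close>, so that a characteristic ending in \<open>\<Theta>\<close> lies in \<open>\<Theta>\<close> from time \<open>0\<close> on.\<close>
  define U where "U n = (\<Inter>k\<le>n. W k)" for n :: nat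
  have U: "open (U n)" "S0 \<subseteq> U n" "U n \<subseteq> W n" for n
    unfolding U_def using W by (auto intro!: open_INT)
  have U_mono: "U n \<subseteq> U m" if "m \<le> n" for m n unfolding U_def using that by auto
  define N where "N t = nat \<lfloor>t\<rfloor>" for t :: real
  have N: "real (N t) \<le> t" "t < real (N t) + 1" if "0 \<le> t" for t
    using that by (simp_all add: N_def)
  have N_mono: "N s \<le> N t" if "s \<le> t" for s t using that by (simp add: N_def nat_mono floor_mono)
  have NI: "t \<in> {0..real (N t) + 1}" if "0 \<le> t" for t using N[OF that] that by simp
  have goodU: "good t \<xi>" if "0 \<le> t" "\<xi> \<in> U (N t)" for t \<xi>
    using good_mono[OF W_good[of \<xi> "N t"]] U(3) that N(2)[OF that(1)] by (meson less_imp_le subsetD)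
  define \<Theta> where "\<Theta> = {z. 0 \<le> fst z \<and> (\<exists>\<xi>\<in>U (N (fst z)). fst (Y (fst z) \<xi>) = snd z)}"
  \<comment> \<open>By injectivity of the position map there is only one candidate. This identifies
    \<open>q\<close> with every local inverse, from which regularity is inherited.\<close>
  define q where "q z = (SOME \<xi>. \<xi> \<in> U (N (fst z)) \<and> fst (Y (fst z) \<xi>) = snd z)" for z
  define \<phi> where "\<phi> t x = exp (\<beta> * t) * \<phi>0 (q (t, x))" for t x
  define p where "p z = fst (snd (Y (fst z) (q z)))" for z
  have q: "q z \<in> U (N (fst z))" "fst (Y (fst z) (q z)) = snd z" if "z \<in> \<Theta>" for z
  proof -
    have "\<exists>\<xi>. \<xi> \<in> U (N (fst z)) \<and> fst (Y (fst z) \<xi>) = snd z" using that by (auto simp: \<Theta>_def)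
    from someI_ex[OF this] show "q z \<in> U (N (fst z))" "fst (Y (fst z) (q z)) = snd z"
      by (simp_all add: q_def)
  qed
  have \<Theta>I: "(t, fst (Y t \<xi>)) \<in> \<Theta>" if "0 \<le> t" "\<xi> \<in> U (N t)" for t \<xi>
    using that by (auto simp: \<Theta>_def)
  have q_eq: "q (t, fst (Y t \<xi>)) = \<xi>" if t: "0 \<le> t" and \<xi>: "\<xi> \<in> U (N t)" for t \<xi>
  proof (rule inj_onD[OF W_inj[OF NI[OF t]]])
    note qz = q[OF \<Theta>I[OF t \<xi>]]
    show "fst (Y t (q (t, fst (Y t \<xi>)))) = fst (Y t \<xi>)" using qz(2) by simp
    show "q (t, fst (Y t \<xi>)) \<in> W (N t)" using qz(1) U(3) by auto
    show "\<xi> \<in> W (N t)" using \<xi> U(3) by blast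
  qed
  have \<Theta>\<Omega>: "\<Theta> \<subseteq> {0..} \<times> \<Omega>" and p0: "\<And>z. z \<in> \<Theta> \<Longrightarrow> p z \<noteq> 0"
  proof -
    have YD: "0 \<le> fst z \<and> Y (fst z) (q z) \<in> D" if "z \<in> \<Theta>" for z
      using Y_D[OF goodU[of "fst z" "q z"]] q(1)[OF that] that by (auto simp: \<Theta>_def)
    have *: "0 \<le> fst z" "snd z \<in> \<Omega>" "p z \<noteq> 0" if "z \<in> \<Theta>" for z
      using q(2)[OF that] YD[OF that] by (auto simp: D_def p_def mem_Times_iff)
    show "\<Theta> \<subseteq> {0..} \<times> \<Omega>" using * by (auto simp: mem_Times_iff)
    show "p z \<noteq> 0" if "z \<in> \<Theta>" for z using *(3)[OF that] .
  qed
  define d where "d z h = fst h * (\<beta> * \<phi> (fst z) (snd z)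
      - p z \<bullet> (v (fst z) (snd z) + (\<phi> (fst z) (snd z) / norm (p z)) *\<^sub>R p z)) + p z \<bullet> snd h"
    for z h :: "real \<times> (real^3)"
  have loc: "\<exists>V P. open V \<and> z0 \<in> V \<and> ({0..} \<times> UNIV) \<inter> V \<subseteq> \<Theta> \<and> C1_open V P \<and>
      (\<forall>z\<in>\<Theta> \<inter> V. p z = P z \<and> ((\<lambda>z. \<phi> (fst z) (snd z)) has_derivative d z) (at z within \<Theta> \<inter> V))"
    if z0: "z0 \<in> \<Theta>" for z0
  proof -
    define n where "n = N (fst z0)"
    have t0: "0 \<le> fst z0" using z0 by (auto simp: \<Theta>_def)
    obtain V Q P where pk: "pack n (U n) (fst z0, fst (Y (fst z0) (q z0))) V Q P"
      using W_pack[OF U(1,3), of "q z0" n "fst z0"] q(1)[OF z0] NI[OF t0] by (auto simp: n_def)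
    have V: "open V" "C1_open V P" and V0: "(fst z0, fst (Y (fst z0) (q z0))) \<in> V"
      and VQ: "\<And>z. z \<in> V \<Longrightarrow> fst z \<in> {0..real n + 1} \<Longrightarrow> Q z \<in> U n \<and> fst (Y (fst z) (Q z)) = snd z \<and> P z = fst (snd (Y (fst z) (Q z)))"
      and V': "\<And>z. z \<in> V \<Longrightarrow> fst z \<in> {0..real n + 1} \<Longrightarrow> ((\<lambda>z. exp (\<beta> * fst z) * \<phi>0 (Q z)) has_derivative
            (\<lambda>h. fst h * (\<beta> * (exp (\<beta> * fst z) * \<phi>0 (Q z))
              - P z \<bullet> (v (fst z) (snd z) + ((exp (\<beta> * fst z) * \<phi>0 (Q z)) / norm (P z)) *\<^sub>R P z))
             + P z \<bullet> snd h)) (at z)"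
      using pk unfolding pack_def by blast+
    \<comment> \<open>Before time \<open>n + 1\<close> the index \<open>N\<close> is at most
      \<open>n\<close>, so by monotonicity \<open>U n\<close> lies in the neighbourhood used at that
      time. That the index increases only when \<open>n + 1\<close> is reached is what makes
      \<Theta> relatively open.\<close>
    define V1 where "V1 = V \<inter> ({..<real n + 1} \<times> UNIV)"
    have V1: "open V1" unfolding V1_def using V(1) by (intro open_Int open_Times) auto
    have z0V1: "z0 \<in> V1" using V0 q(2)[OF z0] N(2)[OF t0] by (auto simp: V1_def n_def mem_Times_iff)
    have in\<Theta>: "z \<in> \<Theta> \<and> q z = Q z \<and> p z = P z" if z: "z \<in> V1" "0 \<le> fst z" for z
    proof -
      have zV: "z \<in> V" and zt: "fst z \<in> {0..real n + 1}" "fst z < real n + 1" using z by (auto simp: V1_def)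
      have "real (N (fst z)) < real n + 1" using N(1)[OF z(2)] zt(2) by linarith
      then have "N (fst z) \<le> n" by linarith
      then have QU: "Q z \<in> U (N (fst z))" using VQ[OF zV zt(1)] U_mono by blast
      have Qz: "(fst z, fst (Y (fst z) (Q z))) = z" using VQ[OF zV zt(1)] by simp
      have "q z = Q z" using q_eq[OF z(2) QU] Qz by simp
      then show ?thesis using \<Theta>I[OF z(2) QU] Qz VQ[OF zV zt(1)] by (simp add: p_def)
    qed
    show ?thesis
    proof (intro exI conjI ballI)
      show "open V1" "z0 \<in> V1" by fact+
      show "({0..} \<times> UNIV) \<inter> V1 \<subseteq> \<Theta>" using in\<Theta> by auto
      show "C1_open V1 P" by (rule C1_open_subset[OF V(2)]) (simp add: V1_def)
      fix z assume z: "z \<in> \<Theta> \<inter> V1"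
      then have t: "0 \<le> fst z" and zV: "z \<in> V" and zt: "fst z \<in> {0..real n + 1}" by (auto simp: \<Theta>_def V1_def)
      have zQ: "q z = Q z" "p z = P z" using in\<Theta>[of z] z t by auto
      show "p z = P z" by fact
      have \<phi>z: "\<phi> (fst y) (snd y) = exp (\<beta> * fst y) * \<phi>0 (Q y)" if "y \<in> \<Theta> \<inter> V1" for y
        using in\<Theta>[of y] that by (auto simp: \<phi>_def \<Theta>_def)
      have "d z = (\<lambda>h. fst h * (\<beta> * (exp (\<beta> * fst z) * \<phi>0 (Q z))
              - P z \<bullet> (v (fst z) (snd z) + ((exp (\<beta> * fst z) * \<phi>0 (Q z)) / norm (P z)) *\<^sub>R P z))
             + P z \<bullet> snd h)"
        unfolding d_def[abs_def] \<phi>z[OF z] zQ(2) ..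
      then have "((\<lambda>z. exp (\<beta> * fst z) * \<phi>0 (Q z)) has_derivative d z) (at z within \<Theta> \<inter> V1)"
        using V'[OF zV zt] by (simp add: has_derivative_at_withinI)
      then show "((\<lambda>z. \<phi> (fst z) (snd z)) has_derivative d z) (at z within \<Theta> \<inter> V1)"
        by (rule has_derivative_transform[OF z, rotated]) (rule \<phi>z)
    qed
  qed
  have to: "time_open \<Theta>"
    unfolding time_open_def
  proof (subst openin_subopen, intro ballI)
    fix z assume z: "z \<in> \<Theta>"
    then obtain V where V: "open V" "z \<in> V" "({0..} \<times> UNIV) \<inter> V \<subseteq> \<Theta>" using loc by blast
    have "z \<in> {0..} \<times> UNIV" using z by (auto simp: \<Theta>_def mem_Times_iff)
    then show "\<exists>T. openin (top_of_set ({0..} \<times> UNIV)) T \<and> z \<in> T \<and> T \<subseteq> \<Theta>"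
      using V by (intro exI[of _ "({0..} \<times> UNIV) \<inter> V"]) (auto simp: openin_open)
  qed
  have \<phi>': "((\<lambda>z. \<phi> (fst z) (snd z)) has_derivative d z) (at z within \<Theta>)" if z: "z \<in> \<Theta>" for z
  proof -
    obtain V where "open V" "z \<in> V" "((\<lambda>z. \<phi> (fst z) (snd z)) has_derivative d z) (at z within \<Theta> \<inter> V)"
      using loc[OF z] z by blast
    then show ?thesis using at_within_Int_open[of V z \<Theta>] by simp
  qed
  have p_C1: "Ck_on 1 \<Theta> p"
  proof (rule Ck_on_local[OF to])
    fix z assume z: "z \<in> \<Theta>"
    from loc[OF z] obtain V P where V: "open V" "z \<in> V" "C1_open V P"
      and VP: "\<forall>z\<in>\<Theta> \<inter> V. p z = P z \<and> ((\<lambda>z. \<phi> (fst z) (snd z)) has_derivative d z) (at z within \<Theta> \<inter> V)"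
      by (elim exE conjE) (rule that)
    have "Ck_on 1 (\<Theta> \<inter> V) p"
      by (rule Ck_on_cong[OF Ck_on_subset[OF C1_open_imp_Ck_on[OF V(3)]]]) (use VP in simp_all)
    then show "\<exists>V. open V \<and> z \<in> V \<and> Ck_on 1 (\<Theta> \<inter> V) p" using V(1,2) by (intro exI[of _ V] conjI)
  qed
  have v_C1': "Ck_on 1 \<Theta> (\<lambda>z. v (fst z) (snd z))"
    using Ck_on_subset[OF v_C1 \<Theta>\<Omega>] by (simp add: case_prod_unfold)
  have \<phi>_cont: "continuous_on \<Theta> (\<lambda>z. \<phi> (fst z) (snd z))" by (rule has_derivative_continuous_on[OF \<phi>'])
  have \<phi>_C1: "Ck_on 1 \<Theta> (\<lambda>z. \<phi> (fst z) (snd z))"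
    unfolding Ck_on_1_iff
  proof (intro exI conjI ballI allI)
    show "((\<lambda>z. \<phi> (fst z) (snd z)) has_derivative d z) (at z within \<Theta>)" if "z \<in> \<Theta>" for z by (rule \<phi>'[OF that])
    show "continuous_on \<Theta> (\<lambda>z. d z h)" for h
      unfolding d_def
      by (intro continuous_on_add continuous_on_mult continuous_on_diff continuous_on_inner continuous_on_scaleR
          continuous_on_divide continuous_on_norm continuous_on_const \<phi>_cont Ck_on_1_continuous[OF p_C1]
          Ck_on_1_continuous[OF v_C1']) (use p0 in auto)
  qed
  \<comment> \<open>The formula for the derivative contains only \<phi>, \<open>p\<close> and
    \<open>v\<close>, all C1, and divides by the nonzero \<open>norm p\<close>; this is where the
    second derivative of \<phi> comes from.\<close>
  have "Ck_on 1 \<Theta> (\<lambda>z. d z h)" for h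
    unfolding d_def divide_inverse
    by (intro Ck_on_1_add Ck_on_1_mult Ck_on_1_diff Ck_on_1_inner Ck_on_1_scaleR Ck_on_1_inverse_norm
        Ck_on_1_const \<phi>_C1 p_C1 v_C1' p0)
  then have \<phi>_C2: "Ck_on 2 \<Theta> (\<lambda>(t, x). \<phi> t x)"
    unfolding Ck_on_2_iff case_prod_unfold by (intro exI[of _ d] conjI ballI allI \<phi>')
  have grad: "grad (\<phi> t) x = p (t, x)" and pde: "vector_derivative (\<lambda>s. \<phi> s x) (at t within {0..})
      = \<beta> * \<phi> t x - p (t, x) \<bullet> (v t x + (\<phi> t x / norm (p (t, x))) *\<^sub>R p (t, x))" if z: "(t, x) \<in> \<Theta>" for t x
  proof -
    have der: "((\<lambda>(t, x). \<phi> t x) has_derivative d (t, x)) (at (t, x) within \<Theta>)"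
      using \<phi>'[OF z] by (simp add: case_prod_unfold)
    have "(\<Sum>b\<in>Basis. d (t, x) (0, b) *\<^sub>R b) = p (t, x)" by (simp add: d_def euclidean_representation)
    then show "grad (\<phi> t) x = p (t, x)" using GDERIV_imp_grad[OF slice_derivatives(2)[OF to z der]] by simp
    show "vector_derivative (\<lambda>s. \<phi> s x) (at t within {0..})
      = \<beta> * \<phi> t x - p (t, x) \<bullet> (v t x + (\<phi> t x / norm (p (t, x))) *\<^sub>R p (t, x))"
      using slice_derivatives(1)[OF to z der] by (simp add: d_def)
  qed
  have sol: "C2_solution v \<beta> \<phi>0 \<Theta> \<phi>"
    unfolding C2_solution_def
  proof (intro conjI allI impI \<phi>_C2, clarify)
    fix t x assume z: "(t, x) \<in> \<Theta>"
    show "vector_derivative (\<lambda>s. \<phi> s x) (at t within {0..}) + v t x \<bullet> grad (\<phi> t) x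
          = \<phi> t x * (\<beta> - norm (grad (\<phi> t) x))"
      unfolding grad[OF z] pde[OF z] using p0[OF z]
      by (simp add: inner_add_right dot_square_norm power2_eq_square inner_commute algebra_simps)
  next
    fix x assume z: "(0, x) \<in> \<Theta>"
    have "Y 0 (q (0, x)) = \<iota> (q (0, x))" using Y_0[OF goodU[of 0 "q (0, x)"]] q(1)[OF z] by simp
    then have "q (0, x) = x" using q(2)[OF z] by (simp add: \<iota>_def)
    then show "\<phi> 0 x = \<phi>0 x" by (simp add: \<phi>_def)
  qed
  have unique: "\<psi> t x = \<phi> t x" if \<psi>: "C2_solution v \<beta> \<phi>0 \<Theta> \<psi>" and z: "(t, x) \<in> \<Theta>" for \<psi> t x
  proof -
    have t: "0 \<le> t" using z by (auto simp: \<Theta>_def)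
    note qz = q[OF z, simplified]
    have "(s, fst (Y s (q (t, x)))) \<in> \<Theta>" if "s \<in> {0..t}" for s
      using that qz(1) U_mono[OF N_mono[of s t]] by (intro \<Theta>I) auto
    from solution_equals_characteristic[OF to \<Theta>\<Omega> \<psi> goodU[OF t qz(1)] t this]
    have "\<psi> t x = snd (snd (Y t (q (t, x))))" using qz(2) by simp
    also have "\<dots> = \<phi> t x" using Y_value[OF goodU[OF t qz(1)] t order_refl] by (simp add: \<phi>_def)
    finally show ?thesis .
  qed
  have S0\<Theta>: "(t, fst (Y t \<xi>)) \<in> \<Theta>" "q (t, fst (Y t \<xi>)) = \<xi>" if "0 \<le> t" "\<xi> \<in> S0" for t \<xi>
    using \<Theta>I[of t \<xi>] q_eq[of t \<xi>] that U(2) by auto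
  have zero: "{x. (t, x) \<in> \<Theta> \<and> \<phi> t x = 0} = \<Sigma> t" if t: "0 \<le> t" for t
  proof
    show "{x. (t, x) \<in> \<Theta> \<and> \<phi> t x = 0} \<subseteq> \<Sigma> t"
    proof clarify
      fix x assume z: "(t, x) \<in> \<Theta>" and "\<phi> t x = 0"
      then have "\<phi>0 (q (t, x)) = 0" by (simp add: \<phi>_def)
      moreover have "q (t, x) \<in> \<Omega>" using q(1)[OF z] U(3) W(3) by blast
      ultimately have "q (t, x) \<in> S0" using S0_eq by blast
      then show "x \<in> \<Sigma> t" using q(2)[OF z] \<Sigma>[OF t] by force
    qed
    show "\<Sigma> t \<subseteq> {x. (t, x) \<in> \<Theta> \<and> \<phi> t x = 0}"
      unfolding \<Sigma>[OF t] using S0\<Theta>[OF t] S0_eq by (auto simp: \<phi>_def)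
  qed
  have bounds: "\<beta> - \<alpha> \<le> norm (grad (\<phi> t) x) \<and> norm (grad (\<phi> t) x) \<le> \<beta> + \<alpha>" if t: "0 \<le> t" and x: "x \<in> \<Sigma> t" for t x
  proof -
    obtain \<xi> where \<xi>: "\<xi> \<in> S0" "x = fst (Y t \<xi>)" using x \<Sigma>[OF t] by auto
    have "grad (\<phi> t) x = fst (snd (Y t \<xi>))"
      using grad[of t x] S0\<Theta>[OF t \<xi>(1)] \<xi>(2) by (simp add: p_def)
    then show ?thesis using S0_Y(2,3)[OF \<xi>(1) t] by simp
  qed
  have "\<forall>n::nat. \<exists>e>0. \<forall>t\<in>{0..real n}. \<forall>\<xi>\<in>S0. \<forall>y. norm (fst (Y t \<xi>) - y) < e \<longrightarrow> (t, y) \<in> \<Theta>"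
    by (intro allI uniform_tube[OF to S0\<Theta>(1)]) auto
  then obtain e where e: "\<And>n. e n > 0"
    and eT: "\<And>n t \<xi> y. t \<in> {0..real n} \<Longrightarrow> \<xi> \<in> S0 \<Longrightarrow> norm (fst (Y t \<xi>) - y) < e n \<Longrightarrow> (t, y) \<in> \<Theta>"
    by metis
  \<comment> \<open>The index goes up to \<open>N t + 1\<close> because \<open>t\<close> lies in
    \<open>[0, N t + 1]\<close>; a minimum over an initial segment decreases as the segment
    grows.\<close>
  define \<epsilon> where "\<epsilon> t = Min (e ` {..Suc (N t)})" for t
  have tub: "tubular_neighborhood \<Omega> \<Sigma> \<Theta>"
    unfolding tubular_neighborhood_def
  proof (intro conjI exI[of _ \<epsilon>] allI impI)
    show "(\<Union>t\<in>{0..}. {t} \<times> \<Sigma> t) \<subseteq> \<Theta>" using \<Sigma> S0\<Theta> by auto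
    show "0 < \<epsilon> t" for t unfolding \<epsilon>_def using e by (subst Min_gr_iff) auto
    show "antimono_on {0..} \<epsilon>"
    proof (rule monotone_onI)
      fix s t :: real assume "s \<le> t"
      then have "{..Suc (N s)} \<subseteq> {..Suc (N t)}" using N_mono by auto
      then show "\<epsilon> t \<le> \<epsilon> s" unfolding \<epsilon>_def by (intro Min_antimono image_mono) auto
    qed
    fix t :: real assume t: "0 \<le> t"
    have "\<epsilon> t \<le> e (Suc (N t))" unfolding \<epsilon>_def by (intro Min_le) auto
    then show "{t} \<times> tube (\<Sigma> t) (\<epsilon> t) \<subseteq> \<Theta>"
      using eT[of t "Suc (N t)"] NI[OF t] \<Sigma>[OF t] by (force simp: tube_def)
  qed (rule \<Theta>\<Omega>)
  have "openin (top_of_set ({0..} \<times> \<Omega>)) \<Theta>"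
    using openin_subset_trans[OF to[unfolded time_open_def] \<Theta>\<Omega>] by auto
  with tub sol unique zero bounds show ?thesis
    by (intro exI[of _ \<Theta>] conjI exI[of _ \<phi>]) auto
qed

end

section \<open>From the stated hypotheses to the working assumptions\<close>

lemma space_Ck_continuous: "space_Ck k \<Omega> w \<Longrightarrow> continuous_on ({0..} \<times> \<Omega>) (\<lambda>(t, x). w t x)"
  by (cases k) simp_all

lemma space_Ck_partials:
  assumes "space_Ck (Suc k) \<Omega> w"
  obtains w' where "\<And>i t x. 0 \<le> t \<Longrightarrow> x \<in> \<Omega> \<Longrightarrow> ((\<lambda>r. w t (x + r *\<^sub>R axis i 1)) has_vector_derivative w' i t x) (at 0)"
    "\<And>i. space_Ck k \<Omega> (w' i)"
proof -
  have "\<forall>i. \<exists>w'. (\<forall>t\<ge>0. \<forall>x\<in>\<Omega>. ((\<lambda>r. w t (x + r *\<^sub>R axis i 1)) has_vector_derivative w' t x) (at 0)) \<and> space_Ck k \<Omega> w'"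
    using assms unfolding space_Ck.simps by (rule conjunct2)
  from choice[OF this] show thesis using that by blast
qed

text \<open>Relative openness of \<Theta> is part of the conclusion because
  \<open>Ck_on 2 \<Theta>\<close> refers to derivatives within \<Theta>, which are unique on such
  sets.\<close>

theorem theorem2p4:
  fixes \<Omega> :: "(real^3) set"
    and v :: "real \<Rightarrow> real^3 \<Rightarrow> real^3"
    and \<Sigma> :: "real \<Rightarrow> (real^3) set"
    and \<phi>0 :: "real^3 \<Rightarrow> real"
    and \<alpha> \<beta> :: real
  assumes "open \<Omega>" "connected \<Omega>" "bounded \<Omega>"
    and "velocity_regular \<Omega> v"
    and "velocity_tangential \<Omega> v"
    and "velocity_gradient_bounded \<Omega> v"
    and "closed_C2_surface (\<Sigma> 0)" "\<Sigma> 0 \<subseteq> \<Omega>"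
    and "Ck_on 2 \<Omega> \<phi>0"
    and "{x \<in> \<Omega>. \<phi>0 x = 0} = \<Sigma> 0"
    and "\<forall>x\<in>\<Sigma> 0. grad \<phi>0 x \<noteq> 0"
    and "\<forall>t\<ge>0. \<Sigma> t = (\<lambda>\<xi>. flow \<Omega> v t 0 \<xi>) ` \<Sigma> 0"
    and "\<alpha> > 0"
    and "\<forall>p. \<forall>t\<ge>0. \<forall>x\<in>\<Omega>.
           - \<alpha> * (norm p)\<^sup>2 \<le> (jacobian (v t) (at x) *v p) \<bullet> p \<and>
           (jacobian (v t) (at x) *v p) \<bullet> p \<le> \<alpha> * (norm p)\<^sup>2"
    and "\<beta> > \<alpha>"
    and "\<forall>x\<in>\<Sigma> 0. \<beta> - \<alpha> \<le> norm (grad \<phi>0 x) \<and> norm (grad \<phi>0 x) \<le> \<beta> + \<alpha>"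
  shows "\<exists>\<Theta>. tubular_neighborhood \<Omega> \<Sigma> \<Theta> \<and>
           openin (top_of_set ({0..} \<times> \<Omega>)) \<Theta> \<and>
           (\<exists>\<phi>. C2_solution v \<beta> \<phi>0 \<Theta> \<phi> \<and>
              (\<forall>\<psi>. C2_solution v \<beta> \<phi>0 \<Theta> \<psi> \<longrightarrow> (\<forall>(t, x)\<in>\<Theta>. \<psi> t x = \<phi> t x)) \<and>
              (\<forall>t\<ge>0. {x. (t, x) \<in> \<Theta> \<and> \<phi> t x = 0} = \<Sigma> t) \<and>
              (\<forall>t\<ge>0. \<forall>x\<in>\<Sigma> t. \<beta> - \<alpha> \<le> norm (grad (\<phi> t) x) \<and> norm (grad (\<phi> t) x) \<le> \<beta> + \<alpha>))"
proof -
  have Ck: "space_Ck (Suc (Suc (Suc 0))) \<Omega> v"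
    using assms(4) by (simp add: velocity_regular_def numeral_eq_Suc)
  obtain w where w: "\<And>i t x. 0 \<le> t \<Longrightarrow> x \<in> \<Omega> \<Longrightarrow> ((\<lambda>r. v t (x + r *\<^sub>R axis i 1)) has_vector_derivative w i t x) (at 0)"
    and w_Ck: "\<And>i. space_Ck (Suc (Suc 0)) \<Omega> (w i)" by (rule space_Ck_partials[OF Ck]) (rule that, assumption+)
  \<comment> \<open>Second derivatives of \<open>v\<close> enter because the equation for
    \<open>p\<close> contains the gradient of \<open>v\<close> and the field has to be C1.\<close>
  have "\<exists>w2. (\<forall>j t x. 0 \<le> t \<longrightarrow> x \<in> \<Omega> \<longrightarrow> ((\<lambda>r. w i t (x + r *\<^sub>R axis j 1)) has_vector_derivative w2 j t x) (at 0))
      \<and> (\<forall>j. space_Ck (Suc 0) \<Omega> (w2 j))" for i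
    by (rule space_Ck_partials[OF w_Ck[of i]]) blast
  then obtain w2 where w2: "\<And>i j t x. 0 \<le> t \<Longrightarrow> x \<in> \<Omega> \<Longrightarrow> ((\<lambda>r. w i t (x + r *\<^sub>R axis j 1)) has_vector_derivative w2 i j t x) (at 0)"
    and w2_Ck: "\<And>i j. space_Ck (Suc 0) \<Omega> (w2 i j)" by metis
  note v_cont = space_Ck_continuous[OF Ck] and w_cont = space_Ck_continuous[OF w_Ck]
    and w2_cont = space_Ck_continuous[OF w2_Ck]
  interpret transport_problem \<Omega> v w w2 \<beta>
    by unfold_locales (fact assms(1) v_cont w_cont w2_cont | erule (1) w w2)+
  obtain d where d: "\<And>x. x \<in> \<Omega> \<Longrightarrow> (\<phi>0 has_derivative d x) (at x within \<Omega>)" and d1: "\<And>h. Ck_on 1 \<Omega> (\<lambda>x. d x h)"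
    using assms(9) unfolding Ck_on_2_iff by blast
  have "\<forall>h. \<exists>f'. (\<forall>x\<in>\<Omega>. ((\<lambda>x. d x h) has_derivative f' x) (at x within \<Omega>)) \<and> (\<forall>k. continuous_on \<Omega> (\<lambda>x. f' x k))"
    using d1 unfolding Ck_on_1_iff by blast
  then obtain dd where dd: "\<And>h x. x \<in> \<Omega> \<Longrightarrow> ((\<lambda>x. d x h) has_derivative dd h x) (at x within \<Omega>)"
    and dd_cont: "\<And>h k. continuous_on \<Omega> (\<lambda>x. dd h x k)" by metis
  have at\<Omega>: "at x within \<Omega> = at x" if "x \<in> \<Omega>" for x by (rule at_within_open[OF that assms(1)])
  \<comment> \<open>\<open>Ck_on 2\<close> delivers second derivatives one direction at a time, so
    gradient and Hessian are put together from the basis directions.\<close>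
  define g0 :: "real^3 \<Rightarrow> real^3" where "g0 x = (\<Sum>b\<in>Basis. d x b *\<^sub>R b)" for x
  define H0 where "H0 x = Blinfun (\<lambda>k. \<Sum>b\<in>Basis. dd b x k *\<^sub>R b)" for x :: "real^3"
  have \<phi>0': "(\<phi>0 has_derivative (\<lambda>h. h \<bullet> g0 x)) (at x)" if "x \<in> \<Omega>" for x
  proof (rule has_derivative_eq_rhs)
    show D: "(\<phi>0 has_derivative d x) (at x)" using d[OF that] at\<Omega>[OF that] by simp
    show "d x = (\<lambda>h. h \<bullet> g0 x)"
    proof
      fix h
      have "d x (\<Sum>b\<in>Basis. (h \<bullet> b) *\<^sub>R b) = (\<Sum>b\<in>Basis. (h \<bullet> b) *\<^sub>R d x b)"
        using linear_sum[OF has_derivative_linear[OF D], of "\<lambda>b. (h \<bullet> b) *\<^sub>R b" Basis]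
          linear_scale[OF has_derivative_linear[OF D]] by simp
      then show "d x h = h \<bullet> g0 x"
        by (simp add: euclidean_representation g0_def inner_sum_right mult.commute)
    qed
  qed
  have g0_raw: "(g0 has_derivative (\<lambda>k. \<Sum>b\<in>Basis. dd b x k *\<^sub>R b)) (at x)" if "x \<in> \<Omega>" for x
    unfolding g0_def[abs_def]
    by (intro has_derivative_sum has_derivative_scaleR_left) (use dd[OF that] at\<Omega>[OF that] in simp)
  have H0: "blinfun_apply (H0 x) = (\<lambda>k. \<Sum>b\<in>Basis. dd b x k *\<^sub>R b)" if "x \<in> \<Omega>" for x
    unfolding H0_def by (rule bounded_linear_Blinfun_apply[OF has_derivative_bounded_linear[OF g0_raw[OF that]]])
  have g0': "(g0 has_derivative blinfun_apply (H0 x)) (at x)" if "x \<in> \<Omega>" for x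
    unfolding H0[OF that] by (rule g0_raw[OF that])
  have H0_cont: "continuous_on \<Omega> H0"
  proof (rule continuous_on_blinfun_componentwise)
    fix k :: "real^3"
    have "continuous_on \<Omega> (\<lambda>x. \<Sum>b\<in>Basis. dd b x k *\<^sub>R b)"
      by (intro continuous_on_sum continuous_on_scaleR continuous_on_const dd_cont)
    then show "continuous_on \<Omega> (\<lambda>x. blinfun_apply (H0 x) k)"
      by (rule continuous_on_eq) (simp add: H0)
  qed
  have grad_g0: "grad \<phi>0 x = g0 x" if "x \<in> \<Omega>" for x
    by (rule GDERIV_imp_grad) (use \<phi>0'[OF that] in \<open>simp add: gderiv_def\<close>)
  have Dv_bound: "\<bar>Dv t x p \<bullet> p\<bar> \<le> \<alpha> * (norm p)\<^sup>2" if "0 \<le> t" "x \<in> \<Omega>" for t x p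
    using assms(14) that jacobian_v[OF that, of p] by (metis abs_le_iff minus_le_iff mult_minus_left)
  interpret level_set_problem \<Omega> v w w2 \<beta> \<phi>0 g0 H0 "\<Sigma> 0" \<alpha>
  proof unfold_locales
    show "compact (\<Sigma> 0)" using assms(7) by (simp add: closed_C2_surface_def)
    show "bounded \<Omega>" "\<Sigma> 0 \<subseteq> \<Omega>" "{x \<in> \<Omega>. \<phi>0 x = 0} = \<Sigma> 0" "0 < \<alpha>" "\<alpha> < \<beta>"
      "velocity_tangential \<Omega> v" by fact+
    show "continuous_on ({0..} \<times> closure \<Omega>) (\<lambda>(t, x). v t x)" "locally_Lipschitz_in_space (closure \<Omega>) v"
      using assms(4) by (simp_all add: velocity_regular_def)
    show "\<beta> - \<alpha> \<le> norm (g0 x) \<and> norm (g0 x) \<le> \<beta> + \<alpha>" if "x \<in> \<Sigma> 0" for x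
      using assms(16) that grad_g0[OF subsetD[OF assms(8) that]] by metis
  qed (fact \<phi>0' g0' H0_cont Dv_bound)+
  show ?thesis
  proof (rule global_solution)
    show "Ck_on 1 ({0..} \<times> \<Omega>) (\<lambda>(t, x). v t x)" using assms(4) by (simp add: velocity_regular_def)
    show "\<Sigma> t = (\<lambda>\<xi>. fst (Y t \<xi>)) ` \<Sigma> 0" if "0 \<le> t" for t
      by (rule trans[OF assms(12)[rule_format, OF that] image_cong[OF refl S0_flow[OF _ that]]])
  qed
qed

end
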